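(* Let $n(\varepsilon,d)$ denote, for a class $F_d$ of real functions on a domain $\Omega_d\subset\mathbb{R}^d$ and a norm $\|\cdot\|$ on functions on $\Omega_d$, the minimal number $n$ of function values such that some algorithm using only $n$ values of $f$ approximates every $f\in F_d$ with error $\|f-A(f)\|\le\varepsilon$. Then: (i) Uniform approximation (error measured in $\|\cdot\|_\infty$ on $[-1/2,1/2]^d$) of functions from the class $$F_d^1=\Bigl\{f\in C^\infty([-1/2,1/2]^d):\ \sup_{k\in\mathbb{N}_0}\sum_{\beta\in\mathbb{N}_0^d,\ |\beta|=k}\frac{\|D^\beta f\|_\infty}{\beta!}\le 1\Bigr\}$$ is quasi-polynomially tractable, i.e. there exist constants $C,t>0$ such that $n(\varepsilon,d)\le C\exp\{t(1+\ln(1/\varepsilon))(1+\ln d)\}$ for all $0<\varepsilon<1$ and all $d\in\mathbb{N}$. (ii) For each $d$ let $r_d>0$ be such that the Euclidean ball $B(0,r_d)=\{x\in\mathbb{R}^d:\|x\|_2\le r_d\}$ has volume (Lebesgue measure) one. Uniform approximation (error measured in $\|\cdot\|_\infty$ on $B(0,r_d)$) of functions from the class $$F_d^2=\Bigl\{f\in C^\infty(B(0,r_d)):\ \sup_{k\in\mathbb{N}_0}\|\partial_\nu^k f\|_\infty\le 1\Bigr\}$$ is weakly tractable, i.e. $\lim_{\varepsilon^{-1}+d\to\infty}\frac{\ln n(\varepsilon,d)}{\varepsilon^{-1}+d}=0$. (iii) With $r_d$ as in (ii), approximation in the $L_1(B(0,r_d))$-norm of functions from the class $$F_d^3=\Bigl\{f\in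 C^\infty(B(0,r_d)):\ \sup_{k\in\mathbb{N}_0}\int_0^{r_d}S(\partial_\nu^k f,r)\,dr\le 1\Bigr\}$$ is weakly tractable, i.e. $\lim_{\varepsilon^{-1}+d\to\infty}\frac{\ln n(\varepsilon,d)}{\varepsilon^{-1}+d}=0$.
   Context: Multi-index notation: for $\alpha\in\mathbb{N}_0^d$, $|\alpha|=\alpha_1+\dots+\alpha_d$, $\alpha!=\alpha_1!\cdots\alpha_d!$, and $D^\alpha f=\partial^{|\alpha|}f/\partial x_1^{\alpha_1}\cdots\partial x_d^{\alpha_d}$. For $x\neq 0$, $(\partial_\nu^k f)(x)$ denotes the $k$-th derivative of $f$ at $x$ in the "normal" direction $x/\|x\|_2$, i.e. $\frac{d^k}{ds^k}f\bigl(x+s\,x/\|x\|_2\bigr)\big|_{s=0}$ (with $\partial_\nu^0 f=f$). For a function $g$ and $0<r\le r_d$, $S(g,r)=\frac{1}{\sigma(r\mathbb{S}^{d-1})}\int_{r\mathbb{S}^{d-1}}|g(y)|\,d\sigma(y)$ is the average of $|g|$ over the sphere of radius $r$, where $\sigma$ is the $(d-1)$-dimensional surface (Hausdorff) measure and $\mathbb{S}^{d-1}$ the unit sphere. Here $n(\varepsilon,d)$ is the information complexity: the minimal number of function evaluations needed by an algorithm to achieve worst-case error at most $\varepsilon$ over the class $F_d$ in the stated norm. *)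

theory Defs
  imports "HOL-Analysis.Analysis"
begin

definition Rd :: "nat \<Rightarrow> (nat \<Rightarrow> real) set" where
  "Rd d = PiE {..<d} (\<lambda>_. (UNIV :: real set))"

definition norm2 :: "nat \<Rightarrow> (nat \<Rightarrow> real) \<Rightarrow> real" where
  "norm2 d x = sqrt (\<Sum>i<d. (x i)\<^sup>2)"

definition zerod :: "nat \<Rightarrow> (nat \<Rightarrow> real)" where
  "zerod d = restrict (\<lambda>_. 0) {..<d}"

definition lebd :: "nat \<Rightarrow> (nat \<Rightarrow> real) measure" where
  "lebd d = PiM {..<d} (\<lambda>_. lborel)"

definition cube :: "nat \<Rightarrow> (nat \<Rightarrow> real) set" where
  "cube d = PiE {..<d} (\<lambda>_. {-1/2..1/2})"

definition ocube :: "nat \<Rightarrow> (nat \<Rightarrow> real) set" where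
  "ocube d = PiE {..<d} (\<lambda>_. {-1/2<..<1/2})"

definition cballd :: "nat \<Rightarrow> real \<Rightarrow> (nat \<Rightarrow> real) set" where
  "cballd d r = {x \<in> Rd d. norm2 d x \<le> r}"

definition oballd :: "nat \<Rightarrow> real \<Rightarrow> (nat \<Rightarrow> real) set" where
  "oballd d r = {x \<in> Rd d. norm2 d x < r}"

definition sphered :: "nat \<Rightarrow> real \<Rightarrow> (nat \<Rightarrow> real) set" where
  "sphered d r = {x \<in> Rd d. norm2 d x = r}"

definition partial :: "nat \<Rightarrow> ((nat \<Rightarrow> real) \<Rightarrow> real) \<Rightarrow> (nat \<Rightarrow> real) \<Rightarrow> real" where
  "partial i f x = deriv (\<lambda>t. f (x(i := x i + t))) 0"

fun pd_list :: "nat list \<Rightarrow> ((nat \<Rightarrow> real) \<Rightarrow> real) \<Rightarrow> (nat \<Rightarrow> real) \<Rightarrow> real" where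
  "pd_list [] f = f"
| "pd_list (i # is) f = partial i (pd_list is f)"

definition Dmulti :: "nat \<Rightarrow> (nat \<Rightarrow> nat) \<Rightarrow> ((nat \<Rightarrow> real) \<Rightarrow> real) \<Rightarrow> (nat \<Rightarrow> real) \<Rightarrow> real" where
  "Dmulti d \<beta> f = pd_list (concat (map (\<lambda>i. replicate (\<beta> i) i) [0..<d])) f"

definition mindices :: "nat \<Rightarrow> nat \<Rightarrow> (nat \<Rightarrow> nat) set" where
  "mindices d k = {\<beta>. (\<forall>i\<ge>d. \<beta> i = 0) \<and> (\<Sum>i<d. \<beta> i) = k}"

text \<open>C^infinity(K) for a closed domain K with interior U: f continuous on K, all iterated
  partial derivatives exist at every point of U and extend continuously to K.\<close>
definition smooth_on :: "nat \<Rightarrow> (nat \<Rightarrow> real) set \<Rightarrow> (nat \<Rightarrow> real) set \<Rightarrow> ((nat \<Rightarrow> real) \<Rightarrow> real) \<Rightarrow> bool" where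
  "smooth_on d U K f \<longleftrightarrow> continuous_on K f \<and>
     (\<forall>is. set is \<subseteq> {..<d} \<longrightarrow>
        (\<forall>i<d. \<forall>x\<in>U. (\<lambda>t. pd_list is f (x(i := x i + t))) differentiable (at 0)) \<and>
        (\<exists>g. continuous_on K g \<and> (\<forall>x\<in>U. g x = pd_list is f x)))"

text \<open>k-th derivative in the normal direction x/||x||_2 (for x \<noteq> 0).\<close>
definition ndiff :: "nat \<Rightarrow> nat \<Rightarrow> ((nat \<Rightarrow> real) \<Rightarrow> real) \<Rightarrow> (nat \<Rightarrow> real) \<Rightarrow> real" where
  "ndiff d k f x = (deriv ^^ k) (\<lambda>s. f (restrict (\<lambda>i. x i + s * x i / norm2 d x) {..<d})) 0"

definition supn :: "(nat \<Rightarrow> real) set \<Rightarrow> ((nat \<Rightarrow> real) \<Rightarrow> real) \<Rightarrow> ennreal" where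
  "supn U g = (SUP x\<in>U. ennreal \<bar>g x\<bar>)"

definition ediam :: "nat \<Rightarrow> (nat \<Rightarrow> real) set \<Rightarrow> ennreal" where
  "ediam d C = (SUP x\<in>C. SUP y\<in>C. ennreal (norm2 d (\<lambda>i. x i - y i)))"

definition hconst :: "nat \<Rightarrow> real" where
  "hconst s = pi powr (real s / 2) / Gamma (real s / 2 + 1)"

definition haus_delta :: "nat \<Rightarrow> nat \<Rightarrow> real \<Rightarrow> (nat \<Rightarrow> real) set \<Rightarrow> ennreal" where
  "haus_delta d s \<delta> A =
     (INF C \<in> {C :: nat \<Rightarrow> (nat \<Rightarrow> real) set. A \<subseteq> (\<Union>n. C n) \<and> (\<forall>n. ediam d (C n) \<le> ennreal \<delta>)}.
        (\<Sum>n. (if C n = {} then 0 else ennreal (hconst s) * (ediam d (C n) / 2) ^ s)))"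

definition haus_outer :: "nat \<Rightarrow> nat \<Rightarrow> (nat \<Rightarrow> real) set \<Rightarrow> ennreal" where
  "haus_outer d s A = (SUP \<delta>\<in>{0<..}. haus_delta d s \<delta> A)"

definition hausdorff :: "nat \<Rightarrow> nat \<Rightarrow> (nat \<Rightarrow> real) measure" where
  "hausdorff d s = measure_of (Rd d) (sets (lebd d)) (haus_outer d s)"

definition sph_avg :: "nat \<Rightarrow> ((nat \<Rightarrow> real) \<Rightarrow> real) \<Rightarrow> real \<Rightarrow> ennreal" where
  "sph_avg d g r =
     (\<integral>\<^sup>+ y \<in> sphered d r. ennreal \<bar>g y\<bar> \<partial>hausdorff d (d - 1))
       / emeasure (hausdorff d (d - 1)) (sphered d r)"

fun info :: "(real list \<Rightarrow> 'p) \<Rightarrow> ('p \<Rightarrow> real) \<Rightarrow> nat \<Rightarrow> real list" where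
  "info \<psi> f 0 = []"
| "info \<psi> f (Suc k) = (let ys = info \<psi> f k in ys @ [f (\<psi> ys)])"

definition achieves :: "'p set \<Rightarrow> ('p \<Rightarrow> real) set \<Rightarrow> (('p \<Rightarrow> real) \<Rightarrow> ('p \<Rightarrow> real) \<Rightarrow> ennreal)
    \<Rightarrow> real \<Rightarrow> nat \<Rightarrow> bool" where
  "achieves \<Omega> F err \<epsilon> n \<longleftrightarrow>
     (\<exists>\<psi> \<phi>. (\<forall>ys. \<psi> ys \<in> \<Omega>) \<and> (\<forall>f\<in>F. err f (\<phi> (info \<psi> f n)) \<le> ennreal \<epsilon>))"

text \<open>n(eps,d); infinity if no algorithm exists.\<close>
definition infc :: "'p set \<Rightarrow> ('p \<Rightarrow> real) set \<Rightarrow> (('p \<Rightarrow> real) \<Rightarrow> ('p \<Rightarrow> real) \<Rightarrow> ennreal)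
    \<Rightarrow> real \<Rightarrow> enat" where
  "infc \<Omega> F err \<epsilon> = (INF n \<in> {n. achieves \<Omega> F err \<epsilon> n}. enat n)"

definition err_sup :: "(nat \<Rightarrow> real) set \<Rightarrow> ((nat \<Rightarrow> real) \<Rightarrow> real) \<Rightarrow> ((nat \<Rightarrow> real) \<Rightarrow> real) \<Rightarrow> ennreal" where
  "err_sup K f g = (SUP x\<in>K. ennreal \<bar>f x - g x\<bar>)"

definition err_L1 :: "nat \<Rightarrow> (nat \<Rightarrow> real) set \<Rightarrow> ((nat \<Rightarrow> real) \<Rightarrow> real) \<Rightarrow> ((nat \<Rightarrow> real) \<Rightarrow> real) \<Rightarrow> ennreal" where
  "err_L1 d K f g = (if g \<in> borel_measurable (lebd d)
       then (\<integral>\<^sup>+ x \<in> K. ennreal \<bar>f x - g x\<bar> \<partial>lebd d) else \<infinity>)"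

definition F1 :: "nat \<Rightarrow> ((nat \<Rightarrow> real) \<Rightarrow> real) set" where
  "F1 d = {f. smooth_on d (ocube d) (cube d) f \<and>
     (\<forall>k. (\<Sum>\<beta>\<in>mindices d k. supn (ocube d) (Dmulti d \<beta> f) / ennreal (\<Prod>i<d. fact (\<beta> i))) \<le> 1)}"

definition F2 :: "nat \<Rightarrow> real \<Rightarrow> ((nat \<Rightarrow> real) \<Rightarrow> real) set" where
  "F2 d r = {f. smooth_on d (oballd d r) (cballd d r) f \<and>
     (\<forall>k. supn (oballd d r - {zerod d}) (ndiff d k f) \<le> 1)}"

definition F3 :: "nat \<Rightarrow> real \<Rightarrow> ((nat \<Rightarrow> real) \<Rightarrow> real) set" where
  "F3 d r = {f. smooth_on d (oballd d r) (cballd d r) f \<and>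
     (\<forall>k. (\<integral>\<^sup>+ \<rho> \<in> {0<..<r}. sph_avg d (ndiff d k f) \<rho> \<partial>lborel) \<le> 1)}"

definition quasi_poly_tractable :: "(real \<Rightarrow> nat \<Rightarrow> enat) \<Rightarrow> bool" where
  "quasi_poly_tractable N \<longleftrightarrow> (\<exists>C t. C > 0 \<and> t > 0 \<and>
     (\<forall>\<epsilon> d. 0 < \<epsilon> \<and> \<epsilon> < 1 \<and> d \<ge> 1 \<longrightarrow>
        (\<exists>n. N \<epsilon> d = enat n \<and> real n \<le> C * exp (t * (1 + ln (1 / \<epsilon>)) * (1 + ln (real d))))))"

definition weakly_tractable :: "(real \<Rightarrow> nat \<Rightarrow> enat) \<Rightarrow> bool" where
  "weakly_tractable N \<longleftrightarrow>
     (\<forall>\<epsilon> d. 0 < \<epsilon> \<and> \<epsilon> < 1 \<and> d \<ge> 1 \<longrightarrow> N \<epsilon> d \<noteq> \<infinity>) \<and>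
     (\<forall>\<eta>>0. \<exists>M. \<forall>\<epsilon> d. 0 < \<epsilon> \<and> \<epsilon> < 1 \<and> d \<ge> 1 \<and> 1 / \<epsilon> + real d \<ge> M \<longrightarrow>
        \<bar>ln (real (the_enat (N \<epsilon> d))) / (1 / \<epsilon> + real d)\<bar> < \<eta>)"

end

theory Submission
  imports Defs "HOL-Computational_Algebra.Polynomial" "HOL-Real_Asymp.Real_Asymp"
begin

text \<open>
  In all three classes a function is approximated by its Taylor polynomial of order \<open>k\<close> at the
  origin, whose error decays like \<open>2\<^sup>-\<^sup>k\<close> on the cube and like \<open>R\<^sup>k / k!\<close> on the ball of radius
  \<open>R \<le> sqrt d / 2\<close>; so \<open>k = O(ln (1/\<epsilon>))\<close>, respectively \<open>k = O(sqrt d + ln (1/\<epsilon>))\<close>, is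
  enough. The Taylor polynomial lies in a space of dimension at most \<open>(d + 1)\<^sup>k\<^sup>-\<^sup>1\<close> and is determined,
  up to an arbitrarily small error, by that many values of \<open>f\<close> at points \<open>h \<cdot> p\<close>, where the points
  \<open>p\<close> are unisolvent for polynomials of degree less than \<open>k\<close>: if \<open>|f(x) - T(x)| \<le> C |x|\<^sup>k\<close>
  uniformly over the class near the origin, then the error of the reconstruction is of order \<open>h\<close>.

  For the third class the \<open>L\<^sub>1\<close> error is estimated along rays. Averaging over directions with
  respect to Lebesgue measure is the same as averaging with respect to the normalised Hausdorff
  measure of a sphere, because both measures give equal mass to all caps of equal radius. The local
  bound \<open>C |x|\<^sup>k\<close> follows since the homogeneous Taylor terms are controlled pointwise by their
  \<open>L\<^sub>1\<close> norms (a form of degree \<open>k\<close> is annihilated by \<open>k + 1\<close> differences), with a constant that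
  is geometric in \<open>k\<close>.
\<close>

subsection \<open>The space of coordinate vectors\<close>

lemma Rd_eqI: "x \<in> Rd d \<Longrightarrow> y \<in> Rd d \<Longrightarrow> (\<And>i. i < d \<Longrightarrow> x i = y i) \<Longrightarrow> x = y"
  unfolding Rd_def by (auto intro: PiE_ext)

lemma restrict_in_Rd [simp]: "restrict f {..<d} \<in> Rd d"
  by (auto simp: Rd_def)

lemma Rd_undefined: "x \<in> Rd d \<Longrightarrow> \<not> i < d \<Longrightarrow> x i = undefined"
  by (simp add: Rd_def PiE_def extensional_def)

lemma fun_upd_in_Rd: "x \<in> Rd d \<Longrightarrow> i < d \<Longrightarrow> x(i := t) \<in> Rd d"
  by (auto simp: Rd_def PiE_def extensional_def)

lemma zerod_in_Rd [simp]: "zerod d \<in> Rd d"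
  by (simp add: zerod_def)

lemma zerod_nth [simp]: "i < d \<Longrightarrow> zerod d i = 0"
  by (simp add: zerod_def)

definition obox :: "nat \<Rightarrow> (nat \<Rightarrow> real) \<Rightarrow> real \<Rightarrow> (nat \<Rightarrow> real) set" where
  "obox d x e = PiE {..<d} (\<lambda>i. {x i - e<..<x i + e})"

lemma obox_iff: "y \<in> obox d x e \<longleftrightarrow> y \<in> Rd d \<and> (\<forall>i<d. \<bar>y i - x i\<bar> < e)"
proof -
  have "y i \<in> {x i - e<..<x i + e} \<longleftrightarrow> \<bar>y i - x i\<bar> < e" for i
    by auto
  then show ?thesis
    unfolding obox_def Rd_def PiE_iff by blast
qed

lemma obox_mono: "e \<le> e' \<Longrightarrow> obox d x e \<subseteq> obox d x e'"
  by (fastforce simp: obox_iff)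

lemma ocube_eq_obox: "ocube d = obox d (zerod d) (1/2)"
  unfolding ocube_def obox_def by (rule PiE_cong) simp

definition line :: "nat \<Rightarrow> (nat \<Rightarrow> real) \<Rightarrow> (nat \<Rightarrow> real) \<Rightarrow> real \<Rightarrow> nat \<Rightarrow> real" where
  "line d x v s = restrict (\<lambda>i. x i + s * v i) {..<d}"

lemma line_in_Rd [simp]: "line d x v s \<in> Rd d"
  by (simp add: line_def)

lemma line_nth [simp]: "i < d \<Longrightarrow> line d x v s i = x i + s * v i"
  by (simp add: line_def)

lemma line_0: "x \<in> Rd d \<Longrightarrow> line d x v 0 = x"
  by (rule Rd_eqI) auto

lemma line_line: "line d (line d x v s) v t = line d x v (s + t)"
  by (rule Rd_eqI[of _ d]) (auto simp: algebra_simps)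

abbreviation ray :: "nat \<Rightarrow> (nat \<Rightarrow> real) \<Rightarrow> real \<Rightarrow> nat \<Rightarrow> real" where
  "ray d \<equiv> line d (zerod d)"

lemma ray_0: "ray d x 0 = zerod d"
  by (rule line_0) simp

lemma ray_1: "x \<in> Rd d \<Longrightarrow> ray d x 1 = x"
  by (rule Rd_eqI) auto

subsection \<open>The Euclidean norm\<close>

lemma norm2_L2_set: "norm2 d x = L2_set x {..<d}"
  by (simp add: norm2_def L2_set_def)

lemma norm2_nonneg [simp]: "norm2 d x \<ge> 0"
  by (simp add: norm2_L2_set)

lemma abs_le_norm2: "i < d \<Longrightarrow> \<bar>x i\<bar> \<le> norm2 d x"
  unfolding norm2_def by (rule real_le_rsqrt) (auto intro: member_le_sum)

lemma norm2_le_sum_abs: "norm2 d x \<le> (\<Sum>i<d. \<bar>x i\<bar>)"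
  unfolding norm2_L2_set by (rule L2_set_le_sum_abs)

lemma norm2_le_mult_abs_bound:
  assumes "\<And>i. i < d \<Longrightarrow> \<bar>x i\<bar> \<le> e"
  shows "norm2 d x \<le> d * e"
proof -
  have "norm2 d x \<le> (\<Sum>i<d. \<bar>x i\<bar>)"
    by (rule norm2_le_sum_abs)
  also have "\<dots> \<le> (\<Sum>i<d. e)"
    by (rule sum_mono) (simp add: assms)
  finally show ?thesis by simp
qed

lemma norm2_triangle: "norm2 d (\<lambda>i. x i + y i) \<le> norm2 d x + norm2 d y"
  unfolding norm2_L2_set by (rule L2_set_triangle_ineq)

lemma norm2_scale:
  assumes "\<And>i. i < d \<Longrightarrow> y i = c * x i"
  shows "norm2 d y = \<bar>c\<bar> * norm2 d x"
proof -
  have "(\<Sum>i<d. (y i)\<^sup>2) = c\<^sup>2 * (\<Sum>i<d. (x i)\<^sup>2)"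
    by (simp add: sum_distrib_left assms power_mult_distrib)
  then show ?thesis by (simp add: norm2_def real_sqrt_mult)
qed

lemma norm2_cong: "(\<And>i. i < d \<Longrightarrow> x i = y i) \<Longrightarrow> norm2 d x = norm2 d y"
  using norm2_scale[of d x 1 y] by simp

lemma norm2_ray [simp]: "norm2 d (ray d x s) = \<bar>s\<bar> * norm2 d x"
  by (rule norm2_scale) simp

lemma norm2_zero_iff: "x \<in> Rd d \<Longrightarrow> norm2 d x = 0 \<longleftrightarrow> x = zerod d"
  by (auto simp: norm2_L2_set L2_set_eq_0_iff intro!: Rd_eqI[of _ d])

lemma norm2_zerod [simp]: "norm2 d (zerod d) = 0"
  by (simp add: norm2_zero_iff)

lemma norm2_pos_iff: "x \<in> Rd d \<Longrightarrow> norm2 d x > 0 \<longleftrightarrow> x \<noteq> zerod d"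
  using norm2_zero_iff[of x d] norm2_nonneg[of d x] by (auto simp: order_less_le)

definition dist2 :: "nat \<Rightarrow> (nat \<Rightarrow> real) \<Rightarrow> (nat \<Rightarrow> real) \<Rightarrow> real" where
  "dist2 d x y = norm2 d (\<lambda>i. x i - y i)"

lemma dist2_self [simp]: "dist2 d x x = 0"
  by (simp add: dist2_def norm2_def)

lemma dist2_commute: "dist2 d x y = dist2 d y x"
  using norm2_scale[of d "\<lambda>i. x i - y i" "-1" "\<lambda>i. y i - x i"] by (simp add: dist2_def)

lemma dist2_triangle: "dist2 d x z \<le> dist2 d x y + dist2 d y z"
  using norm2_triangle[of d "\<lambda>i. x i - y i" "\<lambda>i. y i - z i"] by (simp add: dist2_def)

lemma abs_diff_le_dist2: "i < d \<Longrightarrow> \<bar>x i - y i\<bar> \<le> dist2 d x y"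
  unfolding dist2_def by (rule abs_le_norm2[of i d "\<lambda>i. x i - y i"])

lemma dist2_zerod [simp]: "dist2 d x (zerod d) = norm2 d x"
  unfolding dist2_def by (rule norm2_cong) simp

subsection \<open>Topology in coordinates\<close>

lemma tendsto_coordinates:
  fixes f :: "'a \<Rightarrow> nat \<Rightarrow> real"
  assumes "\<And>t. f t \<in> Rd d" "l \<in> Rd d" "\<And>i. i < d \<Longrightarrow> ((\<lambda>t. f t i) \<longlongrightarrow> l i) F"
  shows "(f \<longlongrightarrow> l) F"
proof -
  have "((\<lambda>t. f t i) \<longlongrightarrow> l i) F" for i
  proof (cases "i < d")
    case False
    then have "f t i = l i" for t
      using Rd_undefined assms(1,2) by metis
    then show ?thesis by simp
  qed (rule assms(3))
  then have "limitin (product_topology (\<lambda>_. euclidean) UNIV) f l F"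
    by (auto simp: limitin_componentwise)
  then show ?thesis
    by (simp add: euclidean_product_topology)
qed

lemma tendsto_line: "(line d x v \<longlongrightarrow> line d x v s) (at s within A)"
  by (rule tendsto_coordinates[of _ d]) (auto intro!: tendsto_intros)

lemma continuous_on_coordinate: "continuous_on S (\<lambda>x :: nat \<Rightarrow> real. x i)"
  by (rule continuous_on_subset[OF continuous_on_product_coordinates]) simp

lemma continuous_on_norm2: "continuous_on S (norm2 d)"
  unfolding norm2_def[abs_def] by (intro continuous_intros continuous_on_coordinate)

lemma openin_Rd_obox: "openin (top_of_set (Rd d)) (obox d x e)"
proof -
  have "obox d x e = Rd d \<inter> (\<Inter>i<d. {y. \<bar>y i - x i\<bar> < e})"
    by (auto simp: obox_iff)
  moreover have "open (\<Inter>i<d. {y. \<bar>y i - x i\<bar> < e})"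
    by (intro open_INT ballI open_Collect_less continuous_intros continuous_on_coordinate) simp
  ultimately show ?thesis
    by (simp add: openin_open_Int)
qed

lemma openin_Rd_ocube: "openin (top_of_set (Rd d)) (ocube d)"
  unfolding ocube_eq_obox by (rule openin_Rd_obox)

lemma openin_Rd_oballd: "openin (top_of_set (Rd d)) (oballd d R)"
proof -
  have "oballd d R = Rd d \<inter> {x. norm2 d x < R}"
    by (auto simp: oballd_def)
  moreover have "open {x. norm2 d x < R}"
    by (intro open_Collect_less continuous_on_norm2 continuous_intros)
  ultimately show ?thesis
    by (simp add: openin_open_Int)
qed

lemma openin_Rd_contains_obox:
  assumes "U \<subseteq> Rd d" "openin (top_of_set U) V" "x \<in> V"
  obtains e where "e > 0" "obox d x e \<inter> U \<subseteq> V"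
proof -
  obtain W where W: "open W" "V = U \<inter> W"
    using assms(2) by (auto simp: openin_open)
  then obtain X where X: "x \<in> PiE UNIV X" "\<And>i. open (X i)" "PiE UNIV X \<subseteq> W"
    using product_topology_open_contains_basis[of "\<lambda>_. euclidean" UNIV W x] assms(3)
    by (auto simp: open_fun_def)
  have "\<exists>e>0. \<forall>t. \<bar>t - x i\<bar> < e \<longrightarrow> t \<in> X i" for i
    using X(1) X(2)[of i] by (auto simp: open_dist dist_real_def PiE_iff)
  then obtain \<delta> where \<delta>: "\<And>i. \<delta> i > 0" "\<And>i t. \<bar>t - x i\<bar> < \<delta> i \<Longrightarrow> t \<in> X i"
    by metis
  define e where "e = Min (insert 1 (\<delta> ` {..<d}))"
  have e: "e > 0" "\<And>i. i < d \<Longrightarrow> e \<le> \<delta> i"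
    unfolding e_def using \<delta>(1) by (auto intro!: Min_le)
  have "y \<in> V" if y: "y \<in> obox d x e \<inter> U" for y
  proof -
    have "y i \<in> X i" for i
    proof (cases "i < d")
      case True
      then show ?thesis
        using y e(2) by (intro \<delta>(2)) (fastforce simp: obox_iff)
    next
      case False
      then have "y i = x i"
        using y assms W(2) Rd_undefined by (metis IntD2 subsetD IntD1)
      then show ?thesis using X(1) by auto
    qed
    then show ?thesis using X(3) W(2) y by blast
  qed
  then show ?thesis using that e(1) by blast
qed

lemma openin_Rd_E:
  assumes "openin (top_of_set (Rd d)) U" "x \<in> U"
  obtains e where "e > 0" "obox d x e \<subseteq> U"
  using openin_Rd_contains_obox[OF subset_refl assms]
  by (metis (no_types, lifting) IntI obox_iff subset_iff)

lemma eventually_in_openin_Rd: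
  assumes "openin (top_of_set (Rd d)) U" "l \<in> U" "(f \<longlongrightarrow> l) F" "\<And>t. f t \<in> Rd d"
  shows "\<forall>\<^sub>F t in F. f t \<in> U"
proof -
  obtain W where W: "open W" "U = Rd d \<inter> W"
    using assms(1) by (auto simp: openin_open)
  then have "\<forall>\<^sub>F t in F. f t \<in> W"
    using assms(2,3) by (intro topological_tendstoD) auto
  then show ?thesis using W(2) assms(4) by simp
qed

lemma continuous_on_Rd_obox:
  fixes F :: "(nat \<Rightarrow> real) \<Rightarrow> real"
  assumes "continuous_on U F" "U \<subseteq> Rd d" "x \<in> U" "\<epsilon> > 0"
  obtains e where "e > 0" "\<And>y. y \<in> obox d x e \<inter> U \<Longrightarrow> \<bar>F y - F x\<bar> < \<epsilon>"
proof -
  have "openin (top_of_set U) (U \<inter> F -` ball (F x) \<epsilon>)"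
    by (rule continuous_openin_preimage_gen[OF assms(1)]) simp
  then obtain e where "e > 0" "obox d x e \<inter> U \<subseteq> U \<inter> F -` ball (F x) \<epsilon>"
    using assms by (elim openin_Rd_contains_obox[OF assms(2)]) auto
  then show ?thesis
    using that[of e] by (auto simp: subset_iff dist_real_def abs_minus_commute)
qed

subsection \<open>Partial derivatives\<close>

definition pdiff_on :: "nat \<Rightarrow> (nat \<Rightarrow> real) set \<Rightarrow> ((nat \<Rightarrow> real) \<Rightarrow> real) \<Rightarrow> bool" where
  "pdiff_on d U F \<longleftrightarrow> (\<forall>i<d. \<forall>x\<in>U. (\<lambda>t. F (x(i := x i + t))) differentiable (at 0))"

lemma has_real_derivative_coordinate:
  assumes "pdiff_on d U F" "i < d" "x(i := x i + s) \<in> U"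
  shows "((\<lambda>t. F (x(i := x i + t))) has_real_derivative partial i F (x(i := x i + s))) (at s)"
proof -
  define y where "y = x(i := x i + s)"
  have "(\<lambda>t. F (y(i := y i + t))) differentiable (at 0)"
    using assms unfolding pdiff_on_def y_def by blast
  then have "((\<lambda>t. F (y(i := y i + t))) has_real_derivative partial i F y) (at 0)"
    unfolding partial_def using DERIV_deriv_iff_real_differentiable by blast
  moreover have "(\<lambda>t. F (y(i := y i + t))) = (\<lambda>t. F (x(i := x i + (t + s))))"
    by (simp add: y_def ac_simps)
  ultimately show ?thesis
    using DERIV_shift[of "\<lambda>t. F (x(i := x i + t))" _ 0 s] by (simp add: y_def)
qed

lemma partial_cong:
  assumes U: "openin (top_of_set (Rd d)) U" and FG: "\<And>y. y \<in> U \<Longrightarrow> F y = G y"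
    and x: "x \<in> U" and i: "i < d"
  shows "partial i F x = partial i G x"
proof -
  have xR: "x \<in> Rd d"
    using openin_imp_subset[OF U] x by auto
  have "((\<lambda>t. (x(i := x i + t)) j) \<longlongrightarrow> x j) (nhds 0)" for j
    by (cases "j = i") (auto intro!: tendsto_eq_intros filterlim_ident)
  then have "((\<lambda>t. x(i := x i + t)) \<longlongrightarrow> x) (nhds 0)"
    by (intro tendsto_coordinates[of _ d] fun_upd_in_Rd xR i)
  then have "\<forall>\<^sub>F t in nhds 0. x(i := x i + t) \<in> U"
    by (rule eventually_in_openin_Rd[OF U x]) (simp add: xR i fun_upd_in_Rd)
  then have "\<forall>\<^sub>F t in nhds 0. F (x(i := x i + t)) = G (x(i := x i + t))"
    by eventually_elim (rule FG)
  then show ?thesis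
    unfolding partial_def by (rule deriv_cong_ev) simp
qed

lemma linearization_error_le:
  fixes g :: "real \<Rightarrow> real"
  assumes "\<And>t. t \<in> closed_segment a b \<Longrightarrow> (g has_real_derivative g' t) (at t)"
    and "\<And>t. t \<in> closed_segment a b \<Longrightarrow> \<bar>g' t - D\<bar> \<le> e"
  shows "\<bar>g b - g a - D * (b - a)\<bar> \<le> e * \<bar>b - a\<bar>"
proof -
  have "norm ((g b - D * b) - (g a - D * a)) \<le> e * norm (b - a)"
  proof (rule field_differentiable_bound[where f = "\<lambda>t. g t - D * t"])
    show "((\<lambda>t. g t - D * t) has_real_derivative g' t - D) (at t within closed_segment a b)"
      if "t \<in> closed_segment a b" for t
      by (rule has_field_derivative_at_within)
        (use that assms(1) in \<open>auto intro!: derivative_eq_intros\<close>)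
  qed (use assms(2) in auto)
  then show ?thesis by (simp add: algebra_simps)
qed

lemma increment_error_le:
  assumes F: "pdiff_on d U F" and x: "x \<in> Rd d"
    and box: "\<And>y. y \<in> Rd d \<Longrightarrow> (\<And>i. i < d \<Longrightarrow> \<bar>y i - x i\<bar> \<le> \<bar>u i\<bar>) \<Longrightarrow>
      y \<in> U \<and> (\<forall>i<d. \<bar>partial i F y - D i\<bar> \<le> e)"
  shows "\<bar>F (line d x u 1) - F x - (\<Sum>i<d. D i * u i)\<bar> \<le> e * (\<Sum>i<d. \<bar>u i\<bar>)"
proof -
  define p where "p n = restrict (\<lambda>i. if i < n then x i + u i else x i) {..<d}" for n
  have p_0: "p 0 = x" and p_d: "p d = line d x u 1"
    using x by (auto intro!: Rd_eqI[of _ d] simp: p_def)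
  have coordinate_step: "\<bar>F (p (Suc n)) - F (p n) - D n * u n\<bar> \<le> e * \<bar>u n\<bar>" if n: "n < d" for n
  proof -
    have p_n: "p n n = x n" "p (Suc n) = (p n)(n := p n n + u n)"
      using n by (auto simp: p_def fun_eq_iff less_Suc_eq)
    have "\<bar>F ((p n)(n := p n n + u n)) - F ((p n)(n := p n n + 0)) - D n * (u n - 0)\<bar>
        \<le> e * \<bar>u n - 0\<bar>"
    proof (rule linearization_error_le)
      fix t assume "t \<in> closed_segment 0 (u n)"
      then have t: "\<bar>t\<bar> \<le> \<bar>u n\<bar>"
        by (auto simp: closed_segment_eq_real_ivl split: if_splits)
      have "(p n)(n := p n n + t) \<in> Rd d"
        using n by (intro fun_upd_in_Rd) (auto simp: p_def)
      moreover have "\<bar>((p n)(n := p n n + t)) i - x i\<bar> \<le> \<bar>u i\<bar>" if "i < d" for i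
        using that n t by (auto simp: p_def)
      ultimately have in_U: "(p n)(n := p n n + t) \<in> U"
        and close: "\<bar>partial n F ((p n)(n := p n n + t)) - D n\<bar> \<le> e"
        using box n by blast+
      show "((\<lambda>t. F ((p n)(n := p n n + t))) has_real_derivative
          partial n F ((p n)(n := p n n + t))) (at t)"
        by (rule has_real_derivative_coordinate[OF F n in_U])
      show "\<bar>partial n F ((p n)(n := p n n + t)) - D n\<bar> \<le> e"
        by (rule close)
    qed
    then show ?thesis by (simp flip: p_n(2))
  qed
  have "F (line d x u 1) - F x = (\<Sum>n<d. F (p (Suc n)) - F (p n))"
    by (simp add: sum_lessThan_telescope[of "\<lambda>n. F (p n)"] p_0 p_d)
  then have "F (line d x u 1) - F x - (\<Sum>i<d. D i * u i)
      = (\<Sum>n<d. F (p (Suc n)) - F (p n) - D n * u n)"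
    by (simp add: sum_subtractf)
  also have "\<bar>\<dots>\<bar> \<le> (\<Sum>n<d. e * \<bar>u n\<bar>)"
    by (rule order_trans[OF sum_abs sum_mono]) (simp add: coordinate_step)
  finally show ?thesis by (simp add: sum_distrib_left)
qed

lemma partials_close_obox:
  assumes U: "openin (top_of_set (Rd d)) U" and x: "x \<in> U" and "\<epsilon> > 0"
    and C: "\<And>i. i < d \<Longrightarrow> continuous_on U (partial i F)"
  obtains \<delta> where "\<delta> > 0" "obox d x \<delta> \<subseteq> U"
    "\<And>i y. i < d \<Longrightarrow> y \<in> obox d x \<delta> \<Longrightarrow> \<bar>partial i F y - partial i F x\<bar> < \<epsilon>"
proof -
  have UR: "U \<subseteq> Rd d"
    by (rule openin_imp_subset[OF U])
  obtain r where r: "r > 0" "obox d x r \<subseteq> U"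
    using openin_Rd_E[OF U x] .
  have "\<exists>e>0. \<forall>y\<in>obox d x e \<inter> U. \<bar>partial i F y - partial i F x\<bar> < \<epsilon>" if "i < d" for i
    using continuous_on_Rd_obox[OF C[OF that] UR x \<open>\<epsilon> > 0\<close>] by metis
  then obtain e where e: "\<And>i. i < d \<Longrightarrow> e i > 0"
      "\<And>i y. i < d \<Longrightarrow> y \<in> obox d x (e i) \<inter> U \<Longrightarrow> \<bar>partial i F y - partial i F x\<bar> < \<epsilon>"
    by metis
  define \<delta> where "\<delta> = Min (insert r (e ` {..<d}))"
  have \<delta>: "\<delta> > 0" "\<delta> \<le> r" "\<And>i. i < d \<Longrightarrow> \<delta> \<le> e i"
    unfolding \<delta>_def using e(1) r(1) by (auto intro!: Min_le)
  have "obox d x \<delta> \<subseteq> U"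
    using obox_mono[OF \<delta>(2)] r(2) by blast
  then show ?thesis
    using that[OF \<delta>(1)] e(2) obox_mono[OF \<delta>(3)] by blast
qed

lemma line_increment_error_le:
  assumes F: "pdiff_on d U F" and y: "y \<in> Rd d"
    and box: "obox d y \<delta> \<subseteq> U" "\<And>i z. i < d \<Longrightarrow> z \<in> obox d y \<delta> \<Longrightarrow> \<bar>partial i F z - partial i F y\<bar> \<le> e"
    and t: "\<bar>t\<bar> * (1 + (\<Sum>i<d. \<bar>v i\<bar>)) < \<delta>"
  shows "\<bar>F (line d y v t) - F y - (\<Sum>i<d. partial i F y * v i) * t\<bar> \<le> e * \<bar>t\<bar> * (\<Sum>i<d. \<bar>v i\<bar>)"
proof -
  have tv: "\<bar>t * v i\<bar> < \<delta>" if "i < d" for i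
  proof -
    have "\<bar>v i\<bar> \<le> 1 + (\<Sum>i<d. \<bar>v i\<bar>)"
      using that by (intro add_increasing member_le_sum) auto
    then have "\<bar>t\<bar> * \<bar>v i\<bar> \<le> \<bar>t\<bar> * (1 + (\<Sum>i<d. \<bar>v i\<bar>))"
      by (rule mult_left_mono) simp
    then show ?thesis using t by (simp add: abs_mult)
  qed
  have "\<bar>F (line d y (\<lambda>i. t * v i) 1) - F y - (\<Sum>i<d. partial i F y * (t * v i))\<bar>
      \<le> e * (\<Sum>i<d. \<bar>t * v i\<bar>)"
  proof (rule increment_error_le[OF F y])
    fix z assume "z \<in> Rd d" "\<And>i. i < d \<Longrightarrow> \<bar>z i - y i\<bar> \<le> \<bar>t * v i\<bar>"
    then have "z \<in> obox d y \<delta>"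
      using tv by (auto simp: obox_iff intro: le_less_trans)
    then show "z \<in> U \<and> (\<forall>i<d. \<bar>partial i F z - partial i F y\<bar> \<le> e)"
      using box by blast
  qed
  then show ?thesis
    by (simp add: line_def abs_mult sum_distrib_left mult_ac)
qed

lemma has_real_derivative_line:
  assumes U: "openin (top_of_set (Rd d)) U" and F: "pdiff_on d U F" and L: "line d x v s \<in> U"
    and C: "\<And>i. i < d \<Longrightarrow> continuous_on U (partial i F)"
  shows "((\<lambda>s. F (line d x v s)) has_real_derivative
    (\<Sum>i<d. partial i F (line d x v s) * v i)) (at s)"
proof -
  define y where "y = line d x v s"
  let ?D = "\<Sum>i<d. partial i F y * v i" and ?V = "\<Sum>i<d. \<bar>v i\<bar>"
  have y: "y \<in> U" "y \<in> Rd d"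
    using L by (auto simp: y_def)
  have "?V \<ge> 0"
    by (simp add: sum_nonneg)
  then have V: "1 + ?V > 0"
    by linarith
  have "((\<lambda>t. F (line d y v t)) has_real_derivative ?D) (at 0)"
    unfolding has_field_derivative_def has_derivative_at_alt
  proof (intro conjI allI impI)
    fix e :: real assume "e > 0"
    then have "e / (1 + ?V) > 0"
      using V by simp
    then obtain \<delta> where \<delta>: "\<delta> > 0" "obox d y \<delta> \<subseteq> U"
        "\<And>i z. i < d \<Longrightarrow> z \<in> obox d y \<delta> \<Longrightarrow> \<bar>partial i F z - partial i F y\<bar> < e / (1 + ?V)"
      using partials_close_obox[OF U y(1) _ C] by blast
    have "\<bar>F (line d y v t) - F y - ?D * t\<bar> \<le> e * \<bar>t\<bar>" if t: "\<bar>t\<bar> < \<delta> / (1 + ?V)" for t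
    proof -
      have "\<bar>F (line d y v t) - F y - ?D * t\<bar> \<le> e / (1 + ?V) * \<bar>t\<bar> * ?V"
        using t V \<delta>(3)
        by (intro line_increment_error_le[OF F y(2) \<delta>(2)])
          (auto simp: pos_less_divide_eq less_imp_le)
      also have "\<dots> = e * \<bar>t\<bar> * (?V / (1 + ?V))"
        by simp
      also have "\<dots> \<le> e * \<bar>t\<bar> * 1"
        using V \<open>e > 0\<close> by (intro mult_left_mono) (auto simp: pos_divide_le_eq)
      finally show ?thesis by simp
    qed
    then show "\<exists>\<delta>>0. \<forall>t. norm (t - 0) < \<delta> \<longrightarrow>
        norm (F (line d y v t) - F (line d y v 0) - ?D * (t - 0)) \<le> e * norm (t - 0)"
      using V \<delta>(1) by (intro exI[of _ "\<delta> / (1 + ?V)"]) (auto simp: line_0[OF y(2)])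
  qed (rule bounded_linear_mult_right)
  then show ?thesis
    using DERIV_shift[of "\<lambda>s. F (line d x v s)" ?D 0 s] by (simp add: y_def line_line add.commute)
qed

subsection \<open>Symmetry of mixed partial derivatives\<close>

lemma mixed_difference_mean_value:
  assumes F: "pdiff_on d U F" "pdiff_on d U (partial i F)"
    and ij: "i < d" "j < d" "i \<noteq> j" and h: "h > 0"
    and square: "\<And>s t. 0 \<le> s \<Longrightarrow> s \<le> h \<Longrightarrow> 0 \<le> t \<Longrightarrow> t \<le> h \<Longrightarrow> x(i := x i + s, j := x j + t) \<in> U"
  obtains s t where "0 < s" "s < h" "0 < t" "t < h"
    "F (x(i := x i + h, j := x j + h)) - F (x(i := x i + h)) - F (x(j := x j + h)) + F x
       = h * h * partial j (partial i F) (x(i := x i + s, j := x j + t))"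
proof -
  define z where "z s t = x(i := x i + s, j := x j + t)" for s t
  have deriv_i: "((\<lambda>s. F (z s t)) has_real_derivative partial i F (z s t)) (at s)"
    if "z s t \<in> U" for s t
    using has_real_derivative_coordinate[OF F(1) ij(1), of "x(j := x j + t)"] that ij(3)
    by (simp add: z_def fun_upd_twist[of i j])
  have deriv_j: "((\<lambda>t. partial i F (z s t)) has_real_derivative
      partial j (partial i F) (z s t)) (at t)"
    if "z s t \<in> U" for s t
    using has_real_derivative_coordinate[OF F(2) ij(2), of "x(i := x i + s)"] that ij(3)
    by (simp add: z_def)
  have z_U: "z s t \<in> U" if "0 \<le> s" "s \<le> h" "0 \<le> t" "t \<le> h" for s t
    using square that by (simp add: z_def)
  have "\<exists>s>0. s < h \<and> (F (z h h) - F (z h 0)) - (F (z 0 h) - F (z 0 0))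
      = (h - 0) * (partial i F (z s h) - partial i F (z s 0))"
    by (rule MVT2[OF h, of "\<lambda>s. F (z s h) - F (z s 0)"])
      (use h in \<open>auto intro!: DERIV_diff deriv_i z_U\<close>)
  then obtain s where s: "0 < s" "s < h"
      "(F (z h h) - F (z h 0)) - (F (z 0 h) - F (z 0 0))
          = h * (partial i F (z s h) - partial i F (z s 0))"
    by auto
  have "\<exists>t>0. t < h \<and> partial i F (z s h) - partial i F (z s 0)
      = (h - 0) * partial j (partial i F) (z s t)"
    by (rule MVT2[OF h]) (use s in \<open>auto intro!: deriv_j z_U\<close>)
  then obtain t where t: "0 < t" "t < h"
      "partial i F (z s h) - partial i F (z s 0) = h * partial j (partial i F) (z s t)"
    by auto
  have "z h 0 = x(i := x i + h)" "z 0 h = x(j := x j + h)" "z 0 0 = x"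
    using ij(3) by (auto simp: z_def fun_eq_iff)
  then show ?thesis
    using s t by (intro that[of s t]) (auto simp: z_def)
qed

lemma mixed_difference_error_le:
  assumes U: "openin (top_of_set (Rd d)) U" and x: "x \<in> U" and ij: "i < d" "j < d" "i \<noteq> j"
    and F: "pdiff_on d U F" "pdiff_on d U (partial i F)"
    and C: "continuous_on U (partial j (partial i F))" and e: "e > 0"
  obtains r where "r > 0"
    "\<And>h. 0 < h \<Longrightarrow> h < r \<Longrightarrow>
      \<bar>(F (x(i := x i + h, j := x j + h)) - F (x(i := x i + h)) - F (x(j := x j + h)) + F x)
        - h * h * partial j (partial i F) x\<bar> \<le> h * h * e"
proof -
  let ?G = "partial j (partial i F)"
  have UR: "U \<subseteq> Rd d"
    by (rule openin_imp_subset[OF U])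
  obtain r1 where r1: "r1 > 0" "obox d x r1 \<subseteq> U"
    using openin_Rd_E[OF U x] .
  obtain r2 where r2: "r2 > 0" "\<And>y. y \<in> obox d x r2 \<inter> U \<Longrightarrow> \<bar>?G y - ?G x\<bar> < e"
    using continuous_on_Rd_obox[OF C UR x e] by blast
  have "\<bar>(F (x(i := x i + h, j := x j + h)) - F (x(i := x i + h)) - F (x(j := x j + h)) + F x)
      - h * h * ?G x\<bar> \<le> h * h * e" if h: "0 < h" "h < min r1 r2" for h
  proof -
    have square: "x(i := x i + s, j := x j + t) \<in> obox d x r2 \<inter> U"
      if "0 \<le> s" "s \<le> h" "0 \<le> t" "t \<le> h" for s t
    proof -
      have "x(i := x i + s, j := x j + t) \<in> Rd d"
        using ij x UR by (intro fun_upd_in_Rd) auto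
      then show ?thesis
        using that h r1 r2(1) ij(3) by (auto simp: obox_iff subset_iff)
    qed
    obtain s t where st: "0 < s" "s < h" "0 < t" "t < h"
        "F (x(i := x i + h, j := x j + h)) - F (x(i := x i + h)) - F (x(j := x j + h)) + F x
          = h * h * ?G (x(i := x i + s, j := x j + t))"
      using mixed_difference_mean_value[OF F ij h(1), of x] square by blast
    have "\<bar>?G (x(i := x i + s, j := x j + t)) - ?G x\<bar> \<le> e"
      using st square[of s t] by (intro less_imp_le r2(2)) simp
    then have "h * h * \<bar>?G (x(i := x i + s, j := x j + t)) - ?G x\<bar> \<le> h * h * e"
      using h(1) by simp
    then show ?thesis
      unfolding st(5) right_diff_distrib[symmetric] abs_mult by simp
  qed
  then show ?thesis
    using r1(1) r2(1) by (intro that[of "min r1 r2"]) auto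
qed

lemma partial_commute:
  assumes U: "openin (top_of_set (Rd d)) U" and x: "x \<in> U" and ij: "i < d" "j < d"
    and F: "pdiff_on d U F" "pdiff_on d U (partial i F)" "pdiff_on d U (partial j F)"
    and C: "continuous_on U (partial i (partial j F))" "continuous_on U (partial j (partial i F))"
  shows "partial i (partial j F) x = partial j (partial i F) x"
proof (cases "i = j")
  case False
  let ?G = "partial j (partial i F)" and ?H = "partial i (partial j F)"
  let ?\<Delta> = "\<lambda>h. F (x(i := x i + h, j := x j + h)) - F (x(i := x i + h)) - F (x(j := x j + h)) + F x"
  have "\<bar>?H x - ?G x\<bar> \<le> e" if "e > 0" for e
  proof -
    have e2: "e / 2 > 0" using that by simp
    obtain r1 where r1: "r1 > 0" "\<And>h. 0 < h \<Longrightarrow> h < r1 \<Longrightarrow> \<bar>?\<Delta> h - h * h * ?G x\<bar> \<le> h * h * (e / 2)"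
      using mixed_difference_error_le[OF U x ij False F(1,2) C(2) e2] by blast
    obtain r2 where r2: "r2 > 0" "\<And>h. 0 < h \<Longrightarrow> h < r2 \<Longrightarrow>
        \<bar>(F (x(j := x j + h, i := x i + h)) - F (x(j := x j + h)) - F (x(i := x i + h)) + F x)
          - h * h * ?H x\<bar> \<le> h * h * (e / 2)"
      using mixed_difference_error_le[OF U x ij(2,1) False[symmetric] F(1,3) C(1) e2] by blast
    define h where "h = min r1 r2 / 2"
    have h: "h > 0" "h < r1" "h < r2"
      using r1(1) r2(1) by (auto simp: h_def)
    have "\<bar>?\<Delta> h - h * h * ?H x\<bar> \<le> h * h * (e / 2)"
      using r2(2)[OF h(1,3)] False by (simp add: fun_upd_twist[of i j] algebra_simps)
    then have "\<bar>h * h * ?H x - h * h * ?G x\<bar> \<le> h * h * e"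
      using r1(2)[OF h(1,2)] by linarith
    then have "h * h * \<bar>?H x - ?G x\<bar> \<le> h * h * e"
      using h(1) by (simp add: abs_mult flip: right_diff_distrib)
    then show ?thesis using h(1) by simp
  qed
  then have "\<bar>?H x - ?G x\<bar> \<le> 0"
    by (rule field_le_epsilon[of _ 0, simplified])
  then show ?thesis by simp
qed simp

subsection \<open>Multi-indices\<close>

abbreviation incr :: "nat \<Rightarrow> (nat \<Rightarrow> nat) \<Rightarrow> nat \<Rightarrow> nat" where
  "incr i \<beta> \<equiv> \<beta>(i := Suc (\<beta> i))"

lemma mindices_0: "mindices d 0 = {\<lambda>_. 0}"
proof -
  have "\<beta> = (\<lambda>_. 0)" if "\<forall>i\<ge>d. \<beta> i = 0" "\<forall>i<d. \<beta> i = 0" for \<beta> :: "nat \<Rightarrow> nat"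
    using that by (meson ext not_le)
  then show ?thesis by (auto simp: mindices_def)
qed

lemma sum_incr: "i < d \<Longrightarrow> (\<Sum>j<d. incr i \<beta> j) = Suc (\<Sum>j<d. \<beta> j)"
  by (subst (1 2) sum.remove[of _ i]) auto

lemma incr_in_mindices: "\<beta> \<in> mindices d k \<Longrightarrow> i < d \<Longrightarrow> incr i \<beta> \<in> mindices d (Suc k)"
  using sum_incr[of i d \<beta>] by (auto simp: mindices_def)

lemma decr_in_mindices:
  assumes "\<gamma> \<in> mindices d (Suc k)" "i < d" "\<gamma> i > 0"
  shows "\<gamma>(i := \<gamma> i - 1) \<in> mindices d k"
proof -
  define \<beta> where "\<beta> = \<gamma>(i := \<gamma> i - 1)"
  have "\<gamma> = incr i \<beta>"
    using assms by (auto simp: \<beta>_def fun_eq_iff)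
  then have "Suc (\<Sum>j<d. \<beta> j) = Suc k"
    using sum_incr[OF assms(2), of \<beta>] assms(1) by (auto simp: mindices_def)
  then show ?thesis
    using assms by (auto simp: mindices_def simp flip: \<beta>_def) (auto simp: \<beta>_def)
qed

lemma mindices_Suc: "mindices d (Suc k) = (\<Union>i<d. incr i ` mindices d k)"
proof (intro equalityI subsetI)
  fix \<gamma> assume \<gamma>: "\<gamma> \<in> mindices d (Suc k)"
  then have "(\<Sum>i<d. \<gamma> i) \<noteq> 0" by (auto simp: mindices_def)
  then obtain i where i: "i < d" "\<gamma> i > 0"
    by (auto dest: sum.not_neutral_contains_not_neutral)
  have "\<gamma> = incr i (\<gamma>(i := \<gamma> i - 1))"
    using i by auto
  with decr_in_mindices[OF \<gamma> i] i(1) show "\<gamma> \<in> (\<Union>i<d. incr i ` mindices d k)"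
    by blast
qed (auto intro: incr_in_mindices)

lemma finite_mindices [simp]: "finite (mindices d k)"
  by (induction k) (auto simp: mindices_0 mindices_Suc)

lemma card_mindices_le: "card (\<Union>j\<le>k. mindices d j) \<le> (d + 1) ^ k"
proof (induction k)
  case 0
  then show ?case by (simp add: mindices_0)
next
  case (Suc k)
  let ?M = "\<Union>j\<le>k. mindices d j"
  have "(\<Union>j\<le>Suc k. mindices d j) \<subseteq> ?M \<union> (\<Union>i<d. incr i ` ?M)"
    by (auto simp: atMost_Suc mindices_Suc)
  then have "card (\<Union>j\<le>Suc k. mindices d j) \<le> card (?M \<union> (\<Union>i<d. incr i ` ?M))"
    by (intro card_mono) auto
  also have "\<dots> \<le> card ?M + card (\<Union>i<d. incr i ` ?M)"
    by (rule card_Un_le)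
  also have "card (\<Union>i<d. incr i ` ?M) \<le> (\<Sum>i<d. card (incr i ` ?M))"
    by (rule card_UN_le) simp
  also have "\<dots> \<le> (\<Sum>i<d. card ?M)"
    by (intro sum_mono card_image_le) auto
  finally have "card (\<Union>j\<le>Suc k. mindices d j) \<le> (d + 1) * card ?M" by simp
  also have "\<dots> \<le> (d + 1) * (d + 1) ^ k"
    by (rule mult_left_mono[OF Suc]) simp
  finally show ?case by simp
qed

definition mpow :: "nat \<Rightarrow> (nat \<Rightarrow> real) \<Rightarrow> (nat \<Rightarrow> nat) \<Rightarrow> real" where
  "mpow d x \<beta> = (\<Prod>i<d. x i ^ \<beta> i)"

lemma mpow_zero [simp]: "mpow d x (\<lambda>_. 0) = 1"
  by (simp add: mpow_def)

lemma mpow_incr: "i < d \<Longrightarrow> mpow d x (incr i \<beta>) = x i * mpow d x \<beta>"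
  unfolding mpow_def by (subst (1 2) prod.remove[of _ i]) auto

lemma mpow_scale:
  assumes "\<beta> \<in> mindices d k" "\<And>i. i < d \<Longrightarrow> y i = c * x i"
  shows "mpow d y \<beta> = c ^ k * mpow d x \<beta>"
proof -
  have "mpow d y \<beta> = (\<Prod>i<d. c ^ \<beta> i * x i ^ \<beta> i)"
    unfolding mpow_def by (intro prod.cong) (auto simp: assms power_mult_distrib)
  also have "\<dots> = c ^ (\<Sum>i<d. \<beta> i) * mpow d x \<beta>"
    by (simp add: prod.distrib mpow_def power_sum)
  finally show ?thesis using assms(1) by (simp add: mindices_def)
qed

lemma abs_mpow_le:
  assumes "\<beta> \<in> mindices d k" "\<And>i. i < d \<Longrightarrow> \<bar>x i\<bar> \<le> b"
  shows "\<bar>mpow d x \<beta>\<bar> \<le> b ^ k"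
proof -
  have "\<bar>mpow d x \<beta>\<bar> = (\<Prod>i<d. \<bar>x i\<bar> ^ \<beta> i)"
    unfolding mpow_def by (simp add: abs_prod power_abs)
  also have "\<dots> \<le> (\<Prod>i<d. b ^ \<beta> i)"
    by (intro prod_mono) (auto intro!: power_mono assms)
  also have "\<dots> = b ^ k"
    using assms(1) by (simp add: mindices_def flip: power_sum)
  finally show ?thesis .
qed

lemma continuous_on_mpow: "continuous_on S (\<lambda>x. mpow d x \<beta>)"
  unfolding mpow_def by (intro continuous_intros continuous_on_coordinate)

definition mfact :: "nat \<Rightarrow> (nat \<Rightarrow> nat) \<Rightarrow> real" where
  "mfact d \<beta> = (\<Prod>i<d. fact (\<beta> i))"

lemma mfact_pos [simp]: "mfact d \<beta> > 0"
  by (auto simp: mfact_def intro: prod_pos)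

lemma mfact_zero [simp]: "mfact d (\<lambda>_. 0) = 1"
  by (simp add: mfact_def)

lemma mfact_incr: "i < d \<Longrightarrow> mfact d (incr i \<beta>) = (1 + real (\<beta> i)) * mfact d \<beta>"
  unfolding mfact_def by (subst (1 2) prod.remove[of _ i]) auto

lemma sum_incr_mindices:
  fixes c :: "(nat \<Rightarrow> nat) \<Rightarrow> real"
  assumes i: "i < d"
  shows "(\<Sum>\<beta>\<in>mindices d k. c (incr i \<beta>) / mfact d \<beta>)
    = (\<Sum>\<gamma>\<in>mindices d (Suc k). real (\<gamma> i) * (c \<gamma> / mfact d \<gamma>))"
proof -
  have "(\<Sum>\<beta>\<in>mindices d k. c (incr i \<beta>) / mfact d \<beta>)
      = (\<Sum>\<gamma>\<in>{\<gamma>\<in>mindices d (Suc k). \<gamma> i > 0}. real (\<gamma> i) * (c \<gamma> / mfact d \<gamma>))"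
  proof (rule sum.reindex_bij_witness[where i = "\<lambda>\<gamma>. \<gamma>(i := \<gamma> i - 1)" and j = "incr i"])
    fix \<beta> assume "\<beta> \<in> mindices d k"
    show "real (incr i \<beta> i) * (c (incr i \<beta>) / mfact d (incr i \<beta>)) = c (incr i \<beta>) / mfact d \<beta>"
      by (simp add: mfact_incr i)
  qed (use i decr_in_mindices[of _ d k i] in \<open>auto intro: incr_in_mindices\<close>)
  also have "\<dots> = (\<Sum>\<gamma>\<in>mindices d (Suc k). real (\<gamma> i) * (c \<gamma> / mfact d \<gamma>))"
    by (rule sum.mono_neutral_left) auto
  finally show ?thesis .
qed

lemma sum_mindices_Suc:
  fixes c :: "(nat \<Rightarrow> nat) \<Rightarrow> real"
  shows "(\<Sum>\<beta>\<in>mindices d k. \<Sum>i<d. c (incr i \<beta>) / mfact d \<beta>)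
    = real (Suc k) * (\<Sum>\<gamma>\<in>mindices d (Suc k). c \<gamma> / mfact d \<gamma>)"
proof -
  have "(\<Sum>\<beta>\<in>mindices d k. \<Sum>i<d. c (incr i \<beta>) / mfact d \<beta>)
      = (\<Sum>i<d. \<Sum>\<gamma>\<in>mindices d (Suc k). real (\<gamma> i) * (c \<gamma> / mfact d \<gamma>))"
    by (subst sum.swap) (simp add: sum_incr_mindices)
  also have "\<dots> = (\<Sum>\<gamma>\<in>mindices d (Suc k). real (\<Sum>i<d. \<gamma> i) * (c \<gamma> / mfact d \<gamma>))"
    by (subst sum.swap) (simp only: of_nat_sum sum_distrib_right)
  also have "\<dots> = (\<Sum>\<gamma>\<in>mindices d (Suc k). real (Suc k) * (c \<gamma> / mfact d \<gamma>))"
    by (rule sum.cong) (simp_all add: mindices_def)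
  finally show ?thesis by (simp add: sum_distrib_left)
qed

subsection \<open>Polynomials in several variables\<close>

definition hform :: "nat \<Rightarrow> nat \<Rightarrow> ((nat \<Rightarrow> nat) \<Rightarrow> real) \<Rightarrow> (nat \<Rightarrow> real) \<Rightarrow> real" where
  "hform d k c x = (\<Sum>\<beta>\<in>mindices d k. c \<beta> * mpow d x \<beta>)"

lemma hform_scale: "(\<And>i. i < d \<Longrightarrow> y i = a * x i) \<Longrightarrow> hform d k c y = a ^ k * hform d k c x"
  unfolding hform_def by (simp add: sum_distrib_left mpow_scale mult_ac)

lemma hform_ray: "hform d k c (ray d x s) = s ^ k * hform d k c x"
  by (rule hform_scale) simp

lemma hform_zerod: "k > 0 \<Longrightarrow> hform d k c (zerod d) = 0"
  using hform_ray[of d k c "zerod d" 0] by (auto simp: ray_0 power_0_left)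

definition mpoly :: "nat \<Rightarrow> nat \<Rightarrow> ((nat \<Rightarrow> nat) \<Rightarrow> real) \<Rightarrow> (nat \<Rightarrow> real) \<Rightarrow> real" where
  "mpoly d k c x = (\<Sum>j<k. hform d j c x)"

lemma mpoly_Suc: "mpoly d (Suc k) c x = mpoly d k c x + hform d k c x"
  by (simp add: mpoly_def)

lemma mpoly_diff: "mpoly d k (\<lambda>\<beta>. c1 \<beta> - c2 \<beta>) x = mpoly d k c1 x - mpoly d k c2 x"
  by (simp add: mpoly_def hform_def left_diff_distrib sum_subtractf)

lemma continuous_on_hform: "continuous_on S (hform d k c)"
  unfolding hform_def[abs_def] by (intro continuous_intros continuous_on_mpow)

lemma continuous_on_mpoly: "continuous_on S (mpoly d k c)"
  unfolding mpoly_def[abs_def] by (intro continuous_intros continuous_on_hform)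

subsection \<open>Differentials and Taylor polynomials\<close>

definition tcoef :: "nat \<Rightarrow> ((nat \<Rightarrow> real) \<Rightarrow> real) \<Rightarrow> (nat \<Rightarrow> real) \<Rightarrow> (nat \<Rightarrow> nat) \<Rightarrow> real" where
  "tcoef d f x \<beta> = Dmulti d \<beta> f x / mfact d \<beta>"

definition differential ::
    "nat \<Rightarrow> nat \<Rightarrow> ((nat \<Rightarrow> real) \<Rightarrow> real) \<Rightarrow> (nat \<Rightarrow> real) \<Rightarrow> (nat \<Rightarrow> real) \<Rightarrow> real" where
  "differential d k f x v = fact k * hform d k (tcoef d f x) v"

lemma Dmulti_0: "Dmulti d (\<lambda>_. 0) f = f"
proof -
  have "concat (map (\<lambda>i. replicate 0 i) [0..<d]) = ([] :: nat list)" by auto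
  then show ?thesis unfolding Dmulti_def by (simp only: pd_list.simps)
qed

lemma hform_0_tcoef: "hform d 0 (tcoef d f x) v = f x"
  by (simp add: hform_def mindices_0 tcoef_def Dmulti_0)

lemma differential_0: "differential d 0 f x v = f x"
  by (simp add: differential_def hform_0_tcoef)

lemma differential_scale:
  "(\<And>i. i < d \<Longrightarrow> w i = a * v i) \<Longrightarrow> differential d k f x w = a ^ k * differential d k f x v"
  unfolding differential_def by (simp add: hform_scale mult.left_commute)

lemma differential_cong:
  "(\<And>i. i < d \<Longrightarrow> w i = v i) \<Longrightarrow> differential d k f x w = differential d k f x v"
  using differential_scale[of d w 1 v k f x] by simp

abbreviation taylor :: "nat \<Rightarrow> nat \<Rightarrow> ((nat \<Rightarrow> real) \<Rightarrow> real) \<Rightarrow> (nat \<Rightarrow> real) \<Rightarrow> real" where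
  "taylor d k f \<equiv> mpoly d k (tcoef d f (zerod d))"

lemma taylor_ray:
  "taylor d k f (ray d v s) = (\<Sum>m<k. differential d m f (zerod d) v / fact m * s ^ m)"
  by (simp add: mpoly_def differential_def hform_ray mult.commute)

lemma taylor_zerod: "k > 0 \<Longrightarrow> taylor d k f (zerod d) = f (zerod d)"
  by (cases k) (auto simp: mpoly_def sum.lessThan_Suc_shift hform_zerod hform_0_tcoef
      simp del: sum.lessThan_Suc)

subsection \<open>Smooth functions\<close>

lemma count_index_list:
  "count (mset (concat (map (\<lambda>i. replicate (\<beta> i) i) [0..<n]))) j = (if j < n then \<beta> j else 0)"
  by (induction n) auto

lemma set_index_list: "set (concat (map (\<lambda>i. replicate (\<beta> i) i) [0..<d])) \<subseteq> {..<d}"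
  by auto

locale smooth_function =
  fixes d :: nat and U K :: "(nat \<Rightarrow> real) set" and f :: "(nat \<Rightarrow> real) \<Rightarrow> real"
  assumes U: "openin (top_of_set (Rd d)) U" and UK: "U \<subseteq> K" and smooth: "smooth_on d U K f"
begin

lemma U_Rd: "U \<subseteq> Rd d"
  by (rule openin_imp_subset[OF U])

lemma pdiff_on_pd_list: "set is \<subseteq> {..<d} \<Longrightarrow> pdiff_on d U (pd_list is f)"
  using smooth unfolding smooth_on_def pdiff_on_def by blast

lemma continuous_on_pd_list:
  assumes "set is \<subseteq> {..<d}"
  shows "continuous_on U (pd_list is f)"
proof -
  obtain g where "continuous_on K g" "\<And>x. x \<in> U \<Longrightarrow> g x = pd_list is f x"
    using smooth assms unfolding smooth_on_def by blast
  then show ?thesis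
    using continuous_on_subset[OF _ UK, of g] continuous_on_cong[of U U g] by metis
qed

lemma continuous_on_interior: "continuous_on U f"
  using continuous_on_pd_list[of "[]"] by simp

lemma pd_list_swap:
  assumes "set is \<subseteq> {..<d}" "i < d" "j < d" "x \<in> U"
  shows "pd_list (i # j # is) f x = pd_list (j # i # is) f x"
  unfolding pd_list.simps
proof (rule partial_commute[OF U \<open>x \<in> U\<close> \<open>i < d\<close> \<open>j < d\<close>])
  show "pdiff_on d U (pd_list is f)" "pdiff_on d U (partial i (pd_list is f))"
      "pdiff_on d U (partial j (pd_list is f))"
    using pdiff_on_pd_list[of "is"] pdiff_on_pd_list[of "i # is"] pdiff_on_pd_list[of "j # is"]
        assms
    by simp_all
  show "continuous_on U (partial i (partial j (pd_list is f)))"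
      "continuous_on U (partial j (partial i (pd_list is f)))"
    using continuous_on_pd_list[of "i # j # is"] continuous_on_pd_list[of "j # i # is"] assms
    by simp_all
qed

lemma pd_list_move_to_front:
  "set is \<subseteq> {..<d} \<Longrightarrow> i \<in> set is \<Longrightarrow> x \<in> U \<Longrightarrow> pd_list is f x = pd_list (i # remove1 i is) f x"
proof (induction "is" arbitrary: x)
  case (Cons j js)
  show ?case
  proof (cases "i = j")
    case False
    then have i: "i \<in> set js" "i < d" "j < d" "set js \<subseteq> {..<d}"
      using Cons.prems by auto
    have "pd_list (j # js) f x = pd_list (j # i # remove1 i js) f x"
      using Cons.IH i Cons.prems by (auto intro!: partial_cong[OF U])
    also have "\<dots> = pd_list (i # j # remove1 i js) f x"
      using i Cons.prems set_remove1_subset[of i js] by (intro pd_list_swap) auto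
    finally show ?thesis using False by simp
  qed auto
qed simp

lemma pd_list_cong_mset:
  "mset is = mset js \<Longrightarrow> set is \<subseteq> {..<d} \<Longrightarrow> x \<in> U \<Longrightarrow> pd_list is f x = pd_list js f x"
proof (induction "is" arbitrary: js x)
  case (Cons i "is")
  have i: "i \<in> set js"
    using Cons.prems(1) by (metis list.set_intros(1) set_mset_mset)
  have js: "set js \<subseteq> {..<d}"
    using Cons.prems(1,2) by (metis set_mset_mset)
  have "mset is = mset (remove1 i js)"
    using Cons.prems(1) by (metis mset_remove1 add_mset_remove_trivial mset.simps(2))
  then have "pd_list (i # is) f x = pd_list (i # remove1 i js) f x"
    using Cons.IH Cons.prems by (auto intro!: partial_cong[OF U])
  then show ?case
    using pd_list_move_to_front[OF js i Cons.prems(3)] by simp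
qed simp

lemma partial_Dmulti:
  assumes "i < d" "x \<in> U"
  shows "partial i (Dmulti d \<beta> f) x = Dmulti d (incr i \<beta>) f x"
proof -
  let ?is = "\<lambda>\<beta>. concat (map (\<lambda>i. replicate (\<beta> i) i) [0..<d])"
  have "pd_list (i # ?is \<beta>) f x = pd_list (?is (incr i \<beta>)) f x"
  proof (rule pd_list_cong_mset)
    show "mset (i # ?is \<beta>) = mset (?is (incr i \<beta>))"
      using assms
      by (intro multiset_eqI) (simp only: mset.simps count_add_mset count_index_list, simp)
  qed (use assms set_index_list in auto)
  then show ?thesis by (simp add: Dmulti_def)
qed

lemma pdiff_on_Dmulti: "pdiff_on d U (Dmulti d \<beta> f)"
  unfolding Dmulti_def by (rule pdiff_on_pd_list[OF set_index_list])

lemma continuous_on_Dmulti: "continuous_on U (Dmulti d \<beta> f)"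
  unfolding Dmulti_def by (rule continuous_on_pd_list[OF set_index_list])

lemma continuous_on_partial_Dmulti: "i < d \<Longrightarrow> continuous_on U (partial i (Dmulti d \<beta> f))"
  using continuous_on_Dmulti[of "incr i \<beta>"]
  by (subst continuous_on_cong[OF refl partial_Dmulti[of i]]) auto

lemma has_real_derivative_differential:
  assumes L: "line d x v s \<in> U"
  shows "((\<lambda>s. differential d k f (line d x v s) v) has_real_derivative
    differential d (Suc k) f (line d x v s) v) (at s)"
proof -
  let ?y = "line d x v s"
  have "((\<lambda>s. differential d k f (line d x v s) v) has_real_derivative fact k * (\<Sum>\<beta>\<in>mindices d k.
      (\<Sum>i<d. partial i (Dmulti d \<beta> f) ?y * v i) / mfact d \<beta> * mpow d v \<beta>)) (at s)"
    unfolding differential_def hform_def tcoef_def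
    by (intro DERIV_cmult DERIV_sum DERIV_cdivide DERIV_cmult_right
        has_real_derivative_line[OF U pdiff_on_Dmulti L] continuous_on_partial_Dmulti)
  moreover have "(\<Sum>i<d. partial i (Dmulti d \<beta> f) ?y * v i) / mfact d \<beta> * mpow d v \<beta>
      = (\<Sum>i<d. Dmulti d (incr i \<beta>) f ?y * mpow d v (incr i \<beta>) / mfact d \<beta>)" for \<beta>
    using L
    by (simp add: partial_Dmulti mpow_incr sum_distrib_left sum_distrib_right sum_divide_distrib
        mult_ac)
  ultimately show ?thesis
    using sum_mindices_Suc[of "\<lambda>\<gamma>. Dmulti d \<gamma> f ?y * mpow d v \<gamma>" d k]
    by (simp add: differential_def hform_def tcoef_def mult_ac)
qed

lemma iterated_deriv_line:
  "line d x v s \<in> U \<Longrightarrow> (deriv ^^ k) (\<lambda>s. f (line d x v s)) s = differential d k f (line d x v s) v"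
proof (induction k arbitrary: s)
  case 0
  then show ?case by (simp add: differential_0)
next
  case (Suc k)
  have "\<forall>\<^sub>F t in nhds s. line d x v t \<in> U"
    using tendsto_line[of d x v s UNIV] Suc.prems
    by (intro eventually_in_openin_Rd[OF U Suc.prems]) (auto simp: tendsto_at_iff_tendsto_nhds)
  then have "\<forall>\<^sub>F t in nhds s. (deriv ^^ k) (\<lambda>s. f (line d x v s)) t
      = differential d k f (line d x v t) v"
    by eventually_elim (rule Suc.IH)
  then have "deriv ((deriv ^^ k) (\<lambda>s. f (line d x v s))) s
      = deriv (\<lambda>t. differential d k f (line d x v t) v) s"
    by (rule deriv_cong_ev) simp
  then show ?case
    using DERIV_imp_deriv[OF has_real_derivative_differential[OF Suc.prems]] by simp
qed

lemma ndiff_eq_differential: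
  assumes "x \<in> U"
  shows "ndiff d k f x = differential d k f x (\<lambda>i. x i / norm2 d x)"
proof -
  let ?v = "\<lambda>i. x i / norm2 d x"
  have x: "line d x ?v 0 = x"
    using assms U_Rd by (auto intro: line_0)
  have "ndiff d k f x = (deriv ^^ k) (\<lambda>s. f (line d x ?v s)) 0"
    unfolding ndiff_def line_def by simp
  then show ?thesis
    using iterated_deriv_line[of x ?v 0 k] assms by (simp add: x)
qed

lemma taylor_lagrange_remainder:
  assumes "b > 0" "k > 0" and L: "\<And>t. 0 \<le> t \<Longrightarrow> t \<le> b \<Longrightarrow> ray d v t \<in> U"
  obtains t where "0 < t" "t < b"
    "f (ray d v b) - taylor d k f (ray d v b) = differential d k f (ray d v t) v / fact k * b ^ k"
proof -
  have "\<exists>t>0. t < b \<and> f (ray d v b) = (\<Sum>m<k. differential d m f (ray d v 0) v / fact m * b ^ m)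
      + differential d k f (ray d v t) v / fact k * b ^ k"
    using assms
    by (intro Maclaurin[where f = "\<lambda>s. f (ray d v s)"
          and diff = "\<lambda>m s. differential d m f (ray d v s) v"])
      (auto simp: differential_0 intro!: has_real_derivative_differential)
  then show ?thesis
    using that by (auto simp: taylor_ray ray_0)
qed

lemma taylor_integral_remainder:
  assumes "b > 0" "k > 0" and L: "\<And>t. 0 \<le> t \<Longrightarrow> t \<le> b \<Longrightarrow> ray d v t \<in> U"
  shows "f (ray d v b) - taylor d k f (ray d v b) = integral {0..b}
    (\<lambda>s. (b - s) ^ (k - 1) / fact (k - 1) * differential d k f (ray d v s) v)"
proof -
  define D where "D m s = differential d m f (ray d v s) v" for m s
  have D_0: "D 0 = (\<lambda>s. f (ray d v s))"
    by (simp add: D_def differential_0 fun_eq_iff)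
  have D_deriv: "(D m has_vector_derivative D (Suc m) t) (at t within {0..b})"
    if "0 \<le> t" "t \<le> b" for m t
    unfolding D_def has_real_derivative_iff_has_vector_derivative[symmetric]
    by (rule has_field_derivative_at_within[OF has_real_derivative_differential[OF L[OF that]]])
  have "f (ray d v b) = (\<Sum>m<k. ((b - 0) ^ m / fact m) *\<^sub>R D m 0)
      + integral {0..b} (\<lambda>s. ((b - s) ^ (k - 1) / fact (k - 1)) *\<^sub>R D k s)"
    by (rule Taylor_integral[where f = "\<lambda>s. f (ray d v s)", OF \<open>k > 0\<close> D_0 D_deriv])
      (use \<open>b > 0\<close> in auto)
  then show ?thesis
    by (simp add: taylor_ray D_def ray_0 mult.commute)
qed

lemma continuous_on_differential_ray:
  assumes "\<And>t. t \<in> A \<Longrightarrow> ray d v t \<in> U"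
  shows "continuous_on A (\<lambda>s. differential d k f (ray d v s) v)"
  by (intro continuous_at_imp_continuous_on ballI
      DERIV_isCont[OF has_real_derivative_differential] assms)

end

lemma abs_le_of_ray_interior:
  fixes F :: "(nat \<Rightarrow> real) \<Rightarrow> real"
  assumes F: "continuous_on K F" and x: "x \<in> K" "x \<in> Rd d" and UK: "U \<subseteq> K"
    and ray: "\<And>t. 0 < t \<Longrightarrow> t < 1 \<Longrightarrow> ray d x t \<in> U" and U: "\<And>y. y \<in> U \<Longrightarrow> \<bar>F y\<bar> \<le> e"
  shows "\<bar>F x\<bar> \<le> e"
proof -
  have interior: "\<forall>\<^sub>F t in at_left 1. ray d x t \<in> U"
    using eventually_at_left_real[of 0 "1::real"] by (auto elim!: eventually_mono intro: ray)
  have "(ray d x \<longlongrightarrow> x) (at_left 1)"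
    using tendsto_line[of d "zerod d" x 1 "{..<1}"] by (simp add: ray_1 x)
  then have "((\<lambda>t. F (ray d x t)) \<longlongrightarrow> F x) (at_left 1)"
    by (rule continuous_on_tendsto_compose[OF F _ x(1)])
      (use interior UK in \<open>auto elim!: eventually_mono\<close>)
  then have "((\<lambda>t. \<bar>F (ray d x t)\<bar>) \<longlongrightarrow> \<bar>F x\<bar>) (at_left 1)"
    by (rule tendsto_rabs)
  then show ?thesis
    by (rule tendsto_upperbound) (use interior U in \<open>auto elim!: eventually_mono\<close>)
qed

subsection \<open>Interpolation points\<close>

definition fun_subspace :: "('p \<Rightarrow> 'a :: field) set \<Rightarrow> bool" where
  "fun_subspace S \<longleftrightarrow> (\<lambda>_. 0) \<in> S \<and> (\<forall>u\<in>S. \<forall>v\<in>S. (\<lambda>y. u y + v y) \<in> S) \<and>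
     (\<forall>a. \<forall>u\<in>S. (\<lambda>y. a * u y) \<in> S)"

lemma fun_subspaceD:
  assumes "fun_subspace S"
  shows "(\<lambda>_. 0) \<in> S"
    and "u \<in> S \<Longrightarrow> v \<in> S \<Longrightarrow> (\<lambda>y. u y + v y) \<in> S"
    and "u \<in> S \<Longrightarrow> (\<lambda>y. a * u y) \<in> S"
  using assms by (auto simp: fun_subspace_def)

lemma fun_subspace_sum:
  assumes "fun_subspace S" "finite P" "\<And>p. p \<in> P \<Longrightarrow> u p \<in> S"
  shows "(\<lambda>y. \<Sum>p\<in>P. u p y) \<in> S"
  using assms(2,3) by (induction P) (auto intro: fun_subspaceD[OF assms(1)])

lemma fun_subspace_diff_scale:
  assumes S: "fun_subspace S" and "u \<in> S" "v \<in> S"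
  shows "(\<lambda>y. u y - a * v y) \<in> S"
  using fun_subspaceD(2)[OF S \<open>u \<in> S\<close> fun_subspaceD(3)[OF S \<open>v \<in> S\<close>, of "- a"]] by simp

definition interpolant :: "'p set \<Rightarrow> ('p \<Rightarrow> 'p \<Rightarrow> 'a :: field) \<Rightarrow> ('p \<Rightarrow> 'a) \<Rightarrow> 'p \<Rightarrow> 'a" where
  "interpolant P w u y = (\<Sum>p\<in>P. w p y * u p)"

definition cardinal_functions :: "'p set \<Rightarrow> ('p \<Rightarrow> 'p \<Rightarrow> 'a :: field) \<Rightarrow> bool" where
  "cardinal_functions P w \<longleftrightarrow> (\<forall>p\<in>P. \<forall>q\<in>P. w p q = of_bool (p = q))"

definition newton_update ::
    "('p \<Rightarrow> 'p \<Rightarrow> 'a :: field) \<Rightarrow> 'p \<Rightarrow> ('p \<Rightarrow> 'a) \<Rightarrow> 'p \<Rightarrow> 'p \<Rightarrow> 'a" where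
  "newton_update w q \<psi> p = (\<lambda>y. if p = q then \<psi> y / \<psi> q else w p y - w p q / \<psi> q * \<psi> y)"

lemma interpolant_at_node:
  assumes "cardinal_functions P w" "finite P" "p \<in> P"
  shows "interpolant P w u p = u p"
proof -
  have "interpolant P w u p = (\<Sum>q\<in>P. if q = p then u q else 0)"
    using assms unfolding interpolant_def cardinal_functions_def by (intro sum.cong) auto
  then show ?thesis using assms(2,3) by simp
qed

lemma cardinal_newton_update:
  assumes "cardinal_functions P w" "\<psi> q \<noteq> 0" "\<And>p. p \<in> P \<Longrightarrow> \<psi> p = 0"
  shows "cardinal_functions (insert q P) (newton_update w q \<psi>)"
  using assms by (auto simp: cardinal_functions_def newton_update_def)

lemma interpolant_newton_update:
  assumes "finite P" "q \<notin> P"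
  shows "interpolant (insert q P) (newton_update w q \<psi>) u y
    = interpolant P w u y + \<psi> y / \<psi> q * (u q - interpolant P w u q)"
proof -
  have "(\<Sum>p\<in>P. newton_update w q \<psi> p y * u p)
      = (\<Sum>p\<in>P. w p y * u p - \<psi> y / \<psi> q * (w p q * u p))"
    using assms(2) by (intro sum.cong) (auto simp: newton_update_def left_diff_distrib)
  then show ?thesis
    using assms
    by (simp add: interpolant_def newton_update_def sum_subtractf right_diff_distrib
        flip: sum_distrib_left sum_divide_distrib)
qed

lemma newton_update_in_fun_subspace:
  assumes S: "fun_subspace S" and "p \<noteq> q \<Longrightarrow> w p \<in> S" "\<psi> \<in> S"
  shows "newton_update w q \<psi> p \<in> S"
proof (cases "p = q")
  case True
  then show ?thesis
    using fun_subspaceD(3)[OF S \<open>\<psi> \<in> S\<close>, of "inverse (\<psi> q)"]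
    by (simp add: newton_update_def divide_inverse mult.commute)
next
  case False
  then show ?thesis
    using fun_subspace_diff_scale[OF S assms(2,3), of "w p q / \<psi> q"]
    by (simp add: newton_update_def)
qed

lemma residual_in_fun_subspace:
  assumes S: "fun_subspace S" and "finite P" "\<And>p. p \<in> P \<Longrightarrow> w p \<in> S" "u \<in> S"
  shows "(\<lambda>y. u y - interpolant P w u y) \<in> S"
proof -
  have "interpolant P w u \<in> S"
    unfolding interpolant_def[abs_def] mult.commute[of _ "u _"]
    using assms by (intro fun_subspace_sum[OF S] fun_subspaceD(3)[OF S]) auto
  then show ?thesis
    using fun_subspace_diff_scale[OF S \<open>u \<in> S\<close>, of "interpolant P w u" 1] by simp
qed

text \<open>Newton's method: the nodes are added one at a time, each where the residual of the function
  to be included does not vanish.\<close>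

lemma cardinal_functions_exist:
  fixes \<phi> :: "'b \<Rightarrow> 'p \<Rightarrow> 'a :: field"
  assumes S: "fun_subspace S" and "finite B" "\<And>b. b \<in> B \<Longrightarrow> \<phi> b \<in> S"
  shows "\<exists>P w. finite P \<and> P \<subseteq> X \<and> card P \<le> card B \<and> (\<forall>p\<in>P. w p \<in> S) \<and> cardinal_functions P w \<and>
    (\<forall>b\<in>B. \<forall>y\<in>X. \<phi> b y = interpolant P w (\<phi> b) y)"
  using assms(2,3)
proof (induction B)
  case empty
  then show ?case
    by (intro exI[of _ "{}"]) (auto simp: cardinal_functions_def)
next
  case (insert a B)
  then obtain P w where P: "finite P" "P \<subseteq> X" "card P \<le> card B"
      and w: "\<forall>p\<in>P. w p \<in> S" "cardinal_functions P w"
      and exact: "\<forall>b\<in>B. \<forall>y\<in>X. \<phi> b y = interpolant P w (\<phi> b) y"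
    by (metis insertCI)
  define \<psi> where "\<psi> y = \<phi> a y - interpolant P w (\<phi> a) y" for y
  show ?case
  proof (cases "\<forall>y\<in>X. \<psi> y = 0")
    case True
    then show ?thesis
      using P w exact insert.hyps by (intro exI[of _ P] exI[of _ w]) (simp add: \<psi>_def)
  next
    case False
    then obtain q where q: "q \<in> X" "\<psi> q \<noteq> 0" by auto
    have \<psi>_nodes: "\<psi> p = 0" if "p \<in> P" for p
      using that by (simp add: \<psi>_def interpolant_at_node w(2) P(1))
    then have q_new: "q \<notin> P" using q by auto
    have "\<psi> \<in> S"
      unfolding \<psi>_def[abs_def] using w(1) insert.prems
      by (intro residual_in_fun_subspace[OF S P(1)]) auto
    then have "newton_update w q \<psi> p \<in> S" if "p \<in> insert q P" for p
      using that w(1) by (intro newton_update_in_fun_subspace[OF S]) auto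
    moreover have "\<phi> b y = interpolant (insert q P) (newton_update w q \<psi>) (\<phi> b) y"
      if "b \<in> insert a B" "y \<in> X" for b y
      using that q(1) q(2)[unfolded \<psi>_def] exact
      by (auto simp: interpolant_newton_update P(1) q_new \<psi>_def)
    moreover have "card (insert q P) \<le> card (insert a B)"
      using P(1,3) q_new insert.hyps by simp
    ultimately show ?thesis
      using P q cardinal_newton_update[OF w(2), of \<psi> q] \<psi>_nodes
      by (intro exI[of _ "insert q P"] exI[of _ "newton_update w q \<psi>"]) auto
  qed
qed

subsection \<open>Stable recovery of polynomials from samples near the origin\<close>

definition poly_growth :: "nat \<Rightarrow> nat \<Rightarrow> ((nat \<Rightarrow> real) \<Rightarrow> real) set" where
  "poly_growth d m = {u. \<exists>A\<ge>0. \<forall>y. \<bar>u y\<bar> \<le> A * (1 + norm2 d y) ^ m}"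

lemma fun_subspace_poly_growth: "fun_subspace (poly_growth d m)"
  unfolding fun_subspace_def
proof (intro conjI ballI allI)
  show "(\<lambda>_. 0) \<in> poly_growth d m"
    by (auto simp: poly_growth_def)
next
  fix u v assume "u \<in> poly_growth d m" "v \<in> poly_growth d m"
  then obtain A B where AB: "A \<ge> 0" "B \<ge> 0"
      "\<And>y. \<bar>u y\<bar> \<le> A * (1 + norm2 d y) ^ m" "\<And>y. \<bar>v y\<bar> \<le> B * (1 + norm2 d y) ^ m"
    by (auto simp: poly_growth_def)
  have "\<bar>u y + v y\<bar> \<le> (A + B) * (1 + norm2 d y) ^ m" for y
    unfolding distrib_right using AB(3,4)[of y] by linarith
  then show "(\<lambda>y. u y + v y) \<in> poly_growth d m"
    using AB(1,2) by (auto simp: poly_growth_def intro!: exI[of _ "A + B"])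
next
  fix a u assume "u \<in> poly_growth d m"
  then obtain A where A: "A \<ge> 0" "\<And>y. \<bar>u y\<bar> \<le> A * (1 + norm2 d y) ^ m"
    by (auto simp: poly_growth_def)
  have "\<bar>a * u y\<bar> \<le> (\<bar>a\<bar> * A) * (1 + norm2 d y) ^ m" for y
    unfolding abs_mult mult.assoc by (rule mult_left_mono[OF A(2)]) simp
  then show "(\<lambda>y. a * u y) \<in> poly_growth d m"
    using A(1) by (auto simp: poly_growth_def intro!: exI[of _ "\<bar>a\<bar> * A"])
qed

lemma mpow_in_poly_growth:
  assumes "\<beta> \<in> mindices d j" "j \<le> m"
  shows "(\<lambda>y. mpow d y \<beta>) \<in> poly_growth d m"
proof -
  have "\<bar>mpow d y \<beta>\<bar> \<le> 1 * (1 + norm2 d y) ^ m" for y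
  proof -
    have "\<bar>y i\<bar> \<le> 1 + norm2 d y" if "i < d" for i
      using abs_le_norm2[OF that, of y] by linarith
    then have "\<bar>mpow d y \<beta>\<bar> \<le> (1 + norm2 d y) ^ j"
      by (rule abs_mpow_le[OF assms(1)])
    also have "\<dots> \<le> (1 + norm2 d y) ^ m"
      by (rule power_increasing[OF assms(2)]) simp
    finally show ?thesis by simp
  qed
  then show ?thesis
    unfolding poly_growth_def using zero_le_one by blast
qed

lemma mpoly_interpolation:
  assumes "k > 0"
  obtains P w where "finite P" "P \<subseteq> Rd d" "card P \<le> (d + 1) ^ (k - 1)"
    "\<And>p. p \<in> P \<Longrightarrow> w p \<in> poly_growth d (k - 1)"
    "\<And>c y. y \<in> Rd d \<Longrightarrow> mpoly d k c y = (\<Sum>p\<in>P. w p y * mpoly d k c p)"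
proof -
  let ?B = "\<Union>j\<le>k - 1. mindices d j"
  have "\<exists>P w. finite P \<and> P \<subseteq> Rd d \<and> card P \<le> card ?B \<and> (\<forall>p\<in>P. w p \<in> poly_growth d (k - 1)) \<and>
      cardinal_functions P w \<and>
      (\<forall>\<beta>\<in>?B. \<forall>y\<in>Rd d. mpow d y \<beta> = interpolant P w (\<lambda>y. mpow d y \<beta>) y)"
    by (rule cardinal_functions_exist[OF fun_subspace_poly_growth, where \<phi> = "\<lambda>\<beta> y. mpow d y \<beta>"])
      (auto intro: mpow_in_poly_growth)
  then obtain P w where P: "finite P" "P \<subseteq> Rd d" "card P \<le> card ?B"
      and w: "\<And>p. p \<in> P \<Longrightarrow> w p \<in> poly_growth d (k - 1)"
      and exact: "\<forall>\<beta>\<in>?B. \<forall>y\<in>Rd d. mpow d y \<beta> = interpolant P w (\<lambda>y. mpow d y \<beta>) y"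
    by blast
  have mpow_eq: "mpow d y \<beta> = (\<Sum>p\<in>P. w p y * mpow d p \<beta>)"
    if "j < k" "\<beta> \<in> mindices d j" "y \<in> Rd d" for j \<beta> y
  proof -
    have "\<beta> \<in> ?B" using that by auto
    then show ?thesis
      using exact that(3) unfolding interpolant_def by blast
  qed
  have "mpoly d k c y = (\<Sum>p\<in>P. w p y * mpoly d k c p)" if "y \<in> Rd d" for c y
  proof -
    have "mpoly d k c y = (\<Sum>j<k. \<Sum>\<beta>\<in>mindices d j. \<Sum>p\<in>P. w p y * (c \<beta> * mpow d p \<beta>))"
      using that unfolding mpoly_def hform_def
      by (intro sum.cong) (auto simp: mpow_eq sum_distrib_left mult_ac)
    also have "\<dots> = (\<Sum>j<k. \<Sum>p\<in>P. \<Sum>\<beta>\<in>mindices d j. w p y * (c \<beta> * mpow d p \<beta>))"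
      by (intro sum.cong refl sum.swap)
    also have "\<dots> = (\<Sum>p\<in>P. \<Sum>j<k. \<Sum>\<beta>\<in>mindices d j. w p y * (c \<beta> * mpow d p \<beta>))"
      by (rule sum.swap)
    finally show ?thesis
      by (simp add: mpoly_def hform_def sum_distrib_left)
  qed
  moreover have "card P \<le> (d + 1) ^ (k - 1)"
    using P(3) card_mindices_le by (rule order_trans)
  ultimately show ?thesis
    using that P w by blast
qed

lemma mpoly_ray: "mpoly d k c (ray d x h) = mpoly d k (\<lambda>\<beta>. h ^ (\<Sum>i<d. \<beta> i) * c \<beta>) x"
  unfolding mpoly_def hform_ray unfolding hform_def
  by (intro sum.cong refl) (auto simp: mindices_def sum_distrib_left mult.assoc intro!: sum.cong)

lemma mpoly_rescaled_interpolation: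
  assumes "\<And>c y. y \<in> Rd d \<Longrightarrow> mpoly d k c y = (\<Sum>p\<in>P. w p y * mpoly d k c p)"
    and "h > 0" "x \<in> Rd d"
  shows "mpoly d k c x = (\<Sum>p\<in>P. w p (ray d x (1 / h)) * mpoly d k c (ray d p h))"
proof -
  have "ray d (ray d x (1 / h)) h = x"
    using assms(2,3) by (intro Rd_eqI[of _ d]) auto
  then have "mpoly d k c x = mpoly d k (\<lambda>\<beta>. h ^ (\<Sum>i<d. \<beta> i) * c \<beta>) (ray d x (1 / h))"
    by (simp flip: mpoly_ray)
  also have "\<dots> = (\<Sum>p\<in>P. w p (ray d x (1 / h)) * mpoly d k (\<lambda>\<beta>. h ^ (\<Sum>i<d. \<beta> i) * c \<beta>) p)"
    by (rule assms(1)) simp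
  also have "\<dots> = (\<Sum>p\<in>P. w p (ray d x (1 / h)) * mpoly d k c (ray d p h))"
    by (simp only: mpoly_ray[of d k c _ h])
  finally show ?thesis .
qed

text \<open>Sampling at the points \<open>h p\<close> amplifies values by at most \<open>h\<^sup>1\<^sup>-\<^sup>k\<close>, while values of size
  \<open>|x|\<^sup>k\<close> are of order \<open>h\<^sup>k\<close> there.\<close>

lemma rescaled_product_le:
  fixes h :: real
  assumes "k > 0" "0 < h" "h \<le> 1" "A \<ge> 0" "C \<ge> 0" "0 \<le> s" "s \<le> \<rho>" "0 \<le> t" "t \<le> L"
    and a: "\<bar>a\<bar> \<le> A * (1 + s / h) ^ (k - 1)" and b: "\<bar>b\<bar> \<le> C * (h * t) ^ k"
  shows "\<bar>a * b\<bar> \<le> h * (A * ((1 + \<rho>) ^ (k - 1) * (C * L ^ k)))"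
proof -
  have "1 + s / h = (h + s) / h"
    using \<open>0 < h\<close> by (simp add: field_simps)
  also have "\<dots> \<le> (1 + \<rho>) / h"
    using assms(2,3,7) by (intro divide_right_mono) auto
  finally have "A * (1 + s / h) ^ (k - 1) \<le> A * ((1 + \<rho>) / h) ^ (k - 1)"
    using assms by (intro mult_left_mono power_mono) auto
  moreover have "C * (h * t) ^ k \<le> C * (h * L) ^ k"
    using assms by (intro mult_left_mono power_mono) auto
  ultimately have "\<bar>a * b\<bar> \<le> (A * ((1 + \<rho>) / h) ^ (k - 1)) * (C * (h * L) ^ k)"
    unfolding abs_mult using a b assms by (intro mult_mono) auto
  also have "\<dots> = h * (A * ((1 + \<rho>) ^ (k - 1) * (C * L ^ k)))"
    using \<open>0 < h\<close> power_minus_mult[OF \<open>k > 0\<close>, of h]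
    by (simp add: power_divide power_mult_distrib field_simps)
  finally show ?thesis .
qed

lemma abs_mpoly_le_of_rescaled_samples:
  assumes "k > 0" "0 < h" "h \<le> 1" "C \<ge> 0"
    and exact: "\<And>c y. y \<in> Rd d \<Longrightarrow> mpoly d k c y = (\<Sum>p\<in>P. w p y * mpoly d k c p)"
    and A: "\<And>p. p \<in> P \<Longrightarrow> A p \<ge> 0"
    and w: "\<And>p y. p \<in> P \<Longrightarrow> \<bar>w p y\<bar> \<le> A p * (1 + norm2 d y) ^ (k - 1)"
    and L: "\<And>p. p \<in> P \<Longrightarrow> norm2 d p \<le> L"
    and samples: "\<And>p. p \<in> P \<Longrightarrow> \<bar>mpoly d k c (ray d p h)\<bar> \<le> C * (h * norm2 d p) ^ k"
    and x: "x \<in> cballd d \<rho>"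
  shows "\<bar>mpoly d k c x\<bar> \<le> h * (\<Sum>p\<in>P. A p * ((1 + \<rho>) ^ (k - 1) * (C * L ^ k)))"
proof -
  have "\<bar>mpoly d k c x\<bar> = \<bar>\<Sum>p\<in>P. w p (ray d x (1 / h)) * mpoly d k c (ray d p h)\<bar>"
    using x by (simp add: mpoly_rescaled_interpolation[OF exact \<open>0 < h\<close>] cballd_def)
  also have "\<dots> \<le> (\<Sum>p\<in>P. h * (A p * ((1 + \<rho>) ^ (k - 1) * (C * L ^ k))))"
  proof (rule order_trans[OF sum_abs sum_mono])
    fix p assume p: "p \<in> P"
    have "\<bar>w p (ray d x (1 / h))\<bar> \<le> A p * (1 + norm2 d x / h) ^ (k - 1)"
      using w[OF p, of "ray d x (1 / h)"] \<open>0 < h\<close> by simp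
    moreover have "norm2 d x \<le> \<rho>"
      using x by (simp add: cballd_def)
    ultimately show "\<bar>w p (ray d x (1 / h)) * mpoly d k c (ray d p h)\<bar>
        \<le> h * (A p * ((1 + \<rho>) ^ (k - 1) * (C * L ^ k)))"
      using samples[OF p]
      by (intro rescaled_product_le[OF assms(1-3) A[OF p] \<open>C \<ge> 0\<close> norm2_nonneg _ norm2_nonneg
          L[OF p]])
  qed
  finally show ?thesis
    by (simp add: sum_distrib_left)
qed

lemma common_small_scale:
  fixes \<delta> \<eta> L W :: real
  assumes "\<delta> > 0" "\<eta> > 0" "L > 0" "W \<ge> 0"
  obtains h where "0 < h" "h \<le> 1" "h * L \<le> \<delta>" "h * W \<le> \<eta>"
proof -
  define h where "h = min (min 1 (\<delta> / L)) (\<eta> / (W + 1))"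
  have h: "0 < h" "h \<le> 1"
    using assms by (auto simp: h_def)
  have "h * L \<le> \<delta>"
    using \<open>L > 0\<close> by (simp add: h_def min_le_iff_disj flip: pos_le_divide_eq)
  moreover have "h * (W + 1) \<le> \<eta>"
    using \<open>W \<ge> 0\<close> by (simp add: h_def flip: pos_le_divide_eq)
  then have "h * W \<le> \<eta>"
    using h(1) by (simp add: distrib_left)
  ultimately show ?thesis
    using h by (intro that)
qed

lemma sampling_stability:
  assumes "k > 0" "\<delta> > 0" "\<eta> > 0" "\<rho> \<ge> 0" "C \<ge> 0"
  obtains Q where "finite Q" "Q \<subseteq> cballd d \<delta>" "card Q \<le> (d + 1) ^ (k - 1)"
    "\<And>c x. (\<And>q. q \<in> Q \<Longrightarrow> \<bar>mpoly d k c q\<bar> \<le> C * norm2 d q ^ k) \<Longrightarrow> x \<in> cballd d \<rho> \<Longrightarrow>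
      \<bar>mpoly d k c x\<bar> \<le> \<eta>"
proof -
  obtain P w where P: "finite P" "P \<subseteq> Rd d" "card P \<le> (d + 1) ^ (k - 1)"
      and w: "\<And>p. p \<in> P \<Longrightarrow> w p \<in> poly_growth d (k - 1)"
      and exact: "\<And>c y. y \<in> Rd d \<Longrightarrow> mpoly d k c y = (\<Sum>p\<in>P. w p y * mpoly d k c p)"
    using mpoly_interpolation[OF \<open>k > 0\<close>, of d thesis] by blast
  obtain A where A: "\<And>p. p \<in> P \<Longrightarrow> A p \<ge> 0"
      "\<And>p y. p \<in> P \<Longrightarrow> \<bar>w p y\<bar> \<le> A p * (1 + norm2 d y) ^ (k - 1)"
    using w unfolding poly_growth_def by (simp add: Bex_def) metis
  define L where "L = 1 + (\<Sum>p\<in>P. norm2 d p)"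
  have L: "L > 0" "\<And>p. p \<in> P \<Longrightarrow> norm2 d p \<le> L"
    using P(1) by (auto simp: L_def intro!: add_pos_nonneg sum_nonneg add_increasing member_le_sum)
  define W where "W = (\<Sum>p\<in>P. A p * ((1 + \<rho>) ^ (k - 1) * (C * L ^ k)))"
  have "W \<ge> 0"
    unfolding W_def using A(1) L(1) \<open>\<rho> \<ge> 0\<close> \<open>C \<ge> 0\<close> by (intro sum_nonneg mult_nonneg_nonneg) auto
  obtain h where h: "0 < h" "h \<le> 1" and hL: "h * L \<le> \<delta>" and hW: "h * W \<le> \<eta>"
    using common_small_scale[OF \<open>\<delta> > 0\<close> \<open>\<eta> > 0\<close> L(1) \<open>W \<ge> 0\<close>] .
  show ?thesis
  proof (rule that[of "(\<lambda>p. ray d p h) ` P"])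
    have "h * norm2 d p \<le> \<delta>" if "p \<in> P" for p
      using order_trans[OF mult_left_mono[OF L(2)[OF that]] hL] h(1) by simp
    then show "(\<lambda>p. ray d p h) ` P \<subseteq> cballd d \<delta>"
      using h(1) by (auto simp: cballd_def)
    show "card ((\<lambda>p. ray d p h) ` P) \<le> (d + 1) ^ (k - 1)"
      using card_image_le[OF P(1)] P(3) by (rule order_trans)
    fix c x
    assume small: "\<And>q. q \<in> (\<lambda>p. ray d p h) ` P \<Longrightarrow> \<bar>mpoly d k c q\<bar> \<le> C * norm2 d q ^ k"
      and x: "x \<in> cballd d \<rho>"
    have "\<bar>mpoly d k c (ray d p h)\<bar> \<le> C * (h * norm2 d p) ^ k" if "p \<in> P" for p
      using small[of "ray d p h"] that h(1) by simp
    then have "\<bar>mpoly d k c x\<bar> \<le> h * W"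
      unfolding W_def
      by (intro abs_mpoly_le_of_rescaled_samples[where w = w and d = d and x = x])
        (use \<open>k > 0\<close> h \<open>C \<ge> 0\<close> exact A L(2) x in auto)
    also note hW
    finally show "\<bar>mpoly d k c x\<bar> \<le> \<eta>" .
  qed (simp add: P(1))
qed

subsection \<open>Algorithms from sampling sets\<close>

lemma info_nonadaptive:
  assumes "n \<le> N" "\<And>ys. length ys < N \<Longrightarrow> \<psi> ys = q (length ys)"
  shows "info \<psi> f n = map (\<lambda>i. f (q i)) [0..<n]"
  using assms(1) by (induction n) (auto simp: Let_def assms(2))

lemma achieves_sampling:
  assumes Q: "finite Q" "Q \<subseteq> \<Omega>" and z: "z \<in> \<Omega>"
    and err: "\<And>f g. f \<in> F \<Longrightarrow> g \<in> F \<Longrightarrow> (\<And>q. q \<in> Q \<Longrightarrow> f q = g q) \<Longrightarrow> err f (G g) \<le> ennreal \<epsilon>"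
  shows "achieves \<Omega> F err \<epsilon> (card Q)"
proof -
  define N where "N = card Q"
  obtain q where q: "bij_betw q {0..<N} Q"
    unfolding N_def using ex_bij_betw_nat_finite[OF Q(1)] by auto
  define \<psi> where "\<psi> ys = (if length ys < N then q (length ys) else z)" for ys :: "real list"
  define \<phi> where "\<phi> ys = G (SOME g. g \<in> F \<and> info \<psi> g N = ys)" for ys
  have info: "info \<psi> f N = map (\<lambda>i. f (q i)) [0..<N]" for f
    by (rule info_nonadaptive[of N N]) (auto simp: \<psi>_def)
  have "err f (\<phi> (info \<psi> f N)) \<le> ennreal \<epsilon>" if f: "f \<in> F" for f
  proof -
    define g where "g = (SOME g. g \<in> F \<and> info \<psi> g N = info \<psi> f N)"
    have g: "g \<in> F \<and> info \<psi> g N = info \<psi> f N"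
      unfolding g_def by (rule someI[of _ f]) (simp add: f)
    have "f p = g p" if p: "p \<in> Q" for p
    proof -
      obtain i where "i < N" "p = q i"
        using q p by (auto simp: bij_betw_def)
      then show ?thesis using g by (auto simp: info)
    qed
    then have "err f (G g) \<le> ennreal \<epsilon>"
      using f g by (intro err) auto
    then show ?thesis by (simp add: \<phi>_def g_def)
  qed
  moreover have "\<psi> ys \<in> \<Omega>" for ys
    using q Q(2) z by (auto simp: \<psi>_def bij_betw_def)
  ultimately show ?thesis unfolding achieves_def N_def by blast
qed

lemma infc_le:
  assumes "achieves \<Omega> F err \<epsilon> n" "n \<le> N"
  shows "\<exists>m\<le>N. infc \<Omega> F err \<epsilon> = enat m"
proof -
  have "infc \<Omega> F err \<epsilon> \<le> enat n"
    unfolding infc_def using assms(1) by (intro INF_lower) auto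
  then obtain m where "infc \<Omega> F err \<epsilon> = enat m" "m \<le> n"
    using enat_ile by (metis enat_ord_simps(1))
  then show ?thesis using assms(2) by auto
qed

lemma infc_le_local_polynomial_approximation:
  assumes "k > 0" "\<delta> > 0" "\<eta> > 0" "\<rho> \<ge> 0" "C \<ge> 0" and \<Omega>: "cballd d \<delta> \<subseteq> \<Omega>"
    and local: "\<And>f x. f \<in> F \<Longrightarrow> x \<in> cballd d \<delta> \<Longrightarrow> \<bar>f x - mpoly d k (c f) x\<bar> \<le> C * norm2 d x ^ k"
    and err: "\<And>f g. f \<in> F \<Longrightarrow> g \<in> F \<Longrightarrow>
      (\<And>x. x \<in> cballd d \<rho> \<Longrightarrow> \<bar>mpoly d k (c f) x - mpoly d k (c g) x\<bar> \<le> \<eta>) \<Longrightarrow>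
      err f (G g) \<le> ennreal \<epsilon>"
  shows "\<exists>m \<le> (d + 1) ^ (k - 1). infc \<Omega> F err \<epsilon> = enat m"
proof -
  have "2 * C \<ge> 0" using \<open>C \<ge> 0\<close> by simp
  then obtain Q where Q: "finite Q" "Q \<subseteq> cballd d \<delta>" "card Q \<le> (d + 1) ^ (k - 1)"
    and stable: "\<And>c x. (\<And>q. q \<in> Q \<Longrightarrow> \<bar>mpoly d k c q\<bar> \<le> 2 * C * norm2 d q ^ k) \<Longrightarrow>
      x \<in> cballd d \<rho> \<Longrightarrow> \<bar>mpoly d k c x\<bar> \<le> \<eta>"
    using sampling_stability[OF assms(1-4), of "2 * C" d thesis] by blast
  have "achieves \<Omega> F err \<epsilon> (card Q)"
  proof (rule achieves_sampling[OF Q(1)])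
    show "Q \<subseteq> \<Omega>" using Q(2) \<Omega> by auto
    show "zerod d \<in> \<Omega>" using \<open>\<delta> > 0\<close> \<Omega> by (auto simp: cballd_def)
    fix f g assume fg: "f \<in> F" "g \<in> F" and agree: "\<And>q. q \<in> Q \<Longrightarrow> f q = g q"
    show "err f (G g) \<le> ennreal \<epsilon>"
    proof (rule err[OF fg])
      fix x assume x: "x \<in> cballd d \<rho>"
      have "\<bar>mpoly d k (\<lambda>\<beta>. c f \<beta> - c g \<beta>) q\<bar> \<le> 2 * C * norm2 d q ^ k" if q: "q \<in> Q" for q
      proof -
        have "q \<in> cballd d \<delta>" using q Q(2) by auto
        from local[OF fg(1) this] local[OF fg(2) this] agree[OF q] show ?thesis
          unfolding mpoly_diff by linarith
      qed
      from stable[OF this x] show "\<bar>mpoly d k (c f) x - mpoly d k (c g) x\<bar> \<le> \<eta>"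
        by (simp add: mpoly_diff)
    qed
  qed
  then show ?thesis using Q(3) by (rule infc_le)
qed

subsection \<open>Lebesgue measure in coordinates\<close>

lemma space_lebd [simp]: "space (lebd d) = Rd d"
  by (simp add: lebd_def space_PiM Rd_def)

lemma sigma_finite_lebd: "sigma_finite_measure (lebd d)"
proof -
  interpret product_sigma_finite "\<lambda>_::nat. lborel :: real measure" by standard
  show ?thesis unfolding lebd_def by (rule sigma_finite) simp
qed

lemma coordinate_measurable [measurable]: "i < d \<Longrightarrow> (\<lambda>x. x i) \<in> borel_measurable (lebd d)"
  unfolding lebd_def using measurable_component_singleton[of i "{..<d}" "\<lambda>_. lborel"] by simp

lemma measurable_lebdI:
  assumes "\<And>i. i < d \<Longrightarrow> (\<lambda>x. f x i) \<in> borel_measurable N" "\<And>x. x \<in> space N \<Longrightarrow> f x \<in> Rd d"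
  shows "f \<in> measurable N (lebd d)"
proof -
  have "(\<lambda>x i. f x i) \<in> measurable N (lebd d)"
    unfolding lebd_def by (rule measurable_PiM_single') (use assms in \<open>auto simp: Rd_def\<close>)
  then show ?thesis by simp
qed

lemma norm2_measurable [measurable]: "norm2 d \<in> borel_measurable (lebd d)"
proof -
  have "(\<lambda>x. \<Sum>i<d. (x i)\<^sup>2) \<in> borel_measurable (lebd d)"
    by (intro borel_measurable_sum borel_measurable_power) auto
  then show ?thesis unfolding norm2_def[abs_def] by measurable
qed

lemma dist2_measurable [measurable (raw)]:
  assumes "f \<in> measurable N (lebd d)" "g \<in> measurable N (lebd d)"
  shows "(\<lambda>p. dist2 d (f p) (g p)) \<in> borel_measurable N"
proof -
  have "(\<lambda>p. \<Sum>i<d. (f p i - g p i)\<^sup>2) \<in> borel_measurable N"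
    using assms[THEN measurable_compose[OF _ coordinate_measurable]]
    by (intro borel_measurable_sum borel_measurable_power borel_measurable_diff) auto
  then show ?thesis unfolding dist2_def norm2_def by measurable
qed

lemma mpow_measurable [measurable]: "(\<lambda>x. mpow d x \<beta>) \<in> borel_measurable (lebd d)"
  unfolding mpow_def by (intro borel_measurable_prod borel_measurable_power) auto

lemma hform_measurable [measurable]: "hform d k c \<in> borel_measurable (lebd d)"
  unfolding hform_def[abs_def] by measurable

lemma line_measurable [measurable]: "(\<lambda>u. line d x u t) \<in> measurable (lebd d) (lebd d)"
proof (rule measurable_lebdI)
  fix i assume "i < d"
  then show "(\<lambda>u. line d x u t i) \<in> borel_measurable (lebd d)" by simp
qed simp

lemma sets_lebd_Collect:
  assumes "Measurable.pred (lebd d) P"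
  shows "{x \<in> Rd d. P x} \<in> sets (lebd d)"
  using assms by (simp add: pred_def)

lemma cballd_sets [measurable]: "cballd d R \<in> sets (lebd d)"
  unfolding cballd_def by (rule sets_lebd_Collect) measurable

lemma oballd_sets [measurable]: "oballd d R \<in> sets (lebd d)"
  unfolding oballd_def by (rule sets_lebd_Collect) measurable

lemma sphered_sets [measurable]: "sphered d R \<in> sets (lebd d)"
  unfolding sphered_def by (rule sets_lebd_Collect) measurable

lemma PiE_sets_lebd: "(\<And>i. i < d \<Longrightarrow> A i \<in> sets borel) \<Longrightarrow> PiE {..<d} A \<in> sets (lebd d)"
  unfolding lebd_def by (rule sets_PiM_I_finite) auto

lemma obox_sets [measurable]: "obox d x e \<in> sets (lebd d)"
  unfolding obox_def by (rule PiE_sets_lebd) simp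

lemma borel_measurable_continuous_on_lebd:
  fixes F :: "(nat \<Rightarrow> real) \<Rightarrow> real"
  assumes U: "U \<in> sets (lebd d)" and F: "continuous_on U F"
  shows "(\<lambda>x. indicator U x * F x) \<in> borel_measurable (lebd d)"
proof -
  have "(\<lambda>x. x i) \<in> borel_measurable (lebd d)" for i
  proof (cases "i < d")
    case False
    then have "(\<lambda>x. x i) \<in> borel_measurable (lebd d) \<longleftrightarrow>
        (\<lambda>x. undefined :: real) \<in> borel_measurable (lebd d)"
      by (intro measurable_cong) (simp add: Rd_undefined)
    then show ?thesis by simp
  qed simp
  then have "(\<lambda>x. x) \<in> measurable (lebd d) borel"
    by (rule measurable_coordinatewise_then_product)
  then have "(\<lambda>x. x) \<in> measurable (restrict_space (lebd d) U) (restrict_space borel U)"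
    by (rule measurable_restrict_space3) auto
  then have "F \<in> borel_measurable (restrict_space (lebd d) U)"
    using borel_measurable_continuous_on_restrict[OF F] measurable_compose by blast
  then show ?thesis
    using borel_measurable_restrict_space_iff[of U "lebd d" F] U
    by (simp add: sets.Int_space_eq2[of _ "lebd d", simplified])
qed

lemma emeasure_lebd_PiE:
  assumes "\<And>i. i < d \<Longrightarrow> A i \<in> sets borel"
  shows "emeasure (lebd d) (PiE {..<d} A) = (\<Prod>i<d. emeasure lborel (A i))"
proof -
  interpret product_sigma_finite "\<lambda>_::nat. lborel :: real measure" by standard
  show ?thesis unfolding lebd_def by (rule emeasure_PiM) (use assms in auto)
qed

lemma emeasure_lebd_obox: "e \<ge> 0 \<Longrightarrow> emeasure (lebd d) (obox d x e) = ennreal ((2 * e) ^ d)"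
  unfolding obox_def by (subst emeasure_lebd_PiE) (auto simp: ennreal_power)

lemma emeasure_lebd_cbox:
  "e \<ge> 0 \<Longrightarrow> emeasure (lebd d) (PiE {..<d} (\<lambda>i. {x i - e..x i + e})) = ennreal ((2 * e) ^ d)"
  by (subst emeasure_lebd_PiE) (auto simp: ennreal_power)

lemma obox_zerod_subset_cballd: "obox d (zerod d) e \<subseteq> cballd d (d * e)"
proof
  fix x assume "x \<in> obox d (zerod d) e"
  then have "x \<in> Rd d" "\<And>i. i < d \<Longrightarrow> \<bar>x i\<bar> \<le> e"
    by (auto simp: obox_iff intro: less_imp_le)
  then show "x \<in> cballd d (d * e)"
    by (simp add: cballd_def norm2_le_mult_abs_bound)
qed

subsection \<open>Linear changes of variables\<close>

lemma nn_integral_lebd_split: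
  assumes i: "i < d" and g: "g \<in> borel_measurable (lebd d)"
  shows "(\<integral>\<^sup>+x. g x \<partial>lebd d) = (\<integral>\<^sup>+x. \<integral>\<^sup>+y. g (x(i := y)) \<partial>lborel \<partial>PiM ({..<d} - {i}) (\<lambda>_. lborel))"
    and "(\<lambda>x. \<integral>\<^sup>+y. g (x(i := y)) \<partial>lborel) \<in> borel_measurable (PiM ({..<d} - {i}) (\<lambda>_. lborel))"
proof -
  interpret product_sigma_finite "\<lambda>_::nat. lborel :: real measure" by standard
  define I where "I = {..<d} - {i}"
  have I: "finite I" "i \<notin> I" "insert i I = {..<d}"
    using i by (auto simp: I_def)
  show "(\<integral>\<^sup>+x. g x \<partial>lebd d) = (\<integral>\<^sup>+x. \<integral>\<^sup>+y. g (x(i := y)) \<partial>lborel \<partial>PiM ({..<d} - {i}) (\<lambda>_. lborel))"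
    using product_nn_integral_insert[OF I(1,2), of g] g by (simp add: I(3) lebd_def flip: I_def)
  have "(\<lambda>(x, y). x(i := y)) \<in> measurable (PiM I (\<lambda>_. lborel) \<Otimes>\<^sub>M lborel) (lebd d)"
    using measurable_add_dim[of i I "\<lambda>_. lborel"] by (simp add: lebd_def I(3))
  from measurable_compose[OF this g]
  show "(\<lambda>x. \<integral>\<^sup>+y. g (x(i := y)) \<partial>lborel) \<in> borel_measurable (PiM ({..<d} - {i}) (\<lambda>_. lborel))"
    by (intro lborel.borel_measurable_nn_integral) (simp add: split_def flip: I_def)
qed

lemma nn_integral_lebd_affine_coordinate:
  assumes i: "i < d" and g: "g \<in> borel_measurable (lebd d)" and a: "a \<in> borel_measurable (lebd d)"
    and indep: "\<And>x t. x \<in> Rd d \<Longrightarrow> a (x(i := t)) = a x" and c: "c \<noteq> (0::real)"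
  shows "ennreal \<bar>c\<bar> * (\<integral>\<^sup>+x. g (x(i := a x + c * x i)) \<partial>lebd d) = (\<integral>\<^sup>+x. g x \<partial>lebd d)"
proof -
  let ?N = "PiM ({..<d} - {i}) (\<lambda>_. lborel) :: (nat \<Rightarrow> real) measure"
  define h where "h x = g (x(i := a x + c * x i))" for x
  have "(\<lambda>x. x(i := a x + c * x i)) \<in> measurable (lebd d) (lebd d)"
  proof (rule measurable_lebdI)
    fix j assume j: "j < d"
    show "(\<lambda>x. (x(i := a x + c * x i)) j) \<in> borel_measurable (lebd d)"
      using a i j by (cases "j = i") auto
  qed (use i in \<open>auto intro: fun_upd_in_Rd\<close>)
  from measurable_compose[OF this g] have h: "h \<in> borel_measurable (lebd d)"
    unfolding h_def .
  have fibre: "ennreal \<bar>c\<bar> * (\<integral>\<^sup>+y. h (x(i := y)) \<partial>lborel) = (\<integral>\<^sup>+y. g (x(i := y)) \<partial>lborel)"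
    if x: "x \<in> space ?N" for x
  proof -
    have x_upd: "x(i := y) \<in> Rd d" for y
      using x i by (auto simp: space_PiM Rd_def PiE_def extensional_def)
    have "a (x(i := y)) = a (x(i := 0))" for y
      using indep[OF x_upd[of 0], of y] by simp
    then have "h (x(i := y)) = g (x(i := a (x(i := 0)) + c * y))" for y
      unfolding h_def by (metis fun_upd_same fun_upd_upd)
    moreover have "(\<lambda>y. x(i := y)) \<in> measurable lborel (lebd d)"
      using measurable_component_update[OF x, of i] i by (simp add: lebd_def insert_absorb)
    from measurable_compose[OF this g] have "(\<lambda>y. g (x(i := y))) \<in> borel_measurable borel"
      by simp
    ultimately show ?thesis
      using nn_integral_real_affine[OF _ c, of "\<lambda>y. g (x(i := y))" "a (x(i := 0))"] by simp
  qed
  have "ennreal \<bar>c\<bar> * (\<integral>\<^sup>+x. h x \<partial>lebd d) = (\<integral>\<^sup>+x. ennreal \<bar>c\<bar> * (\<integral>\<^sup>+y. h (x(i := y)) \<partial>lborel) \<partial>?N)"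
    unfolding nn_integral_lebd_split(1)[OF i h]
    by (rule nn_integral_cmult[symmetric, OF nn_integral_lebd_split(2)[OF i h]])
  also have "\<dots> = (\<integral>\<^sup>+x. g x \<partial>lebd d)"
    unfolding nn_integral_lebd_split(1)[OF i g] by (rule nn_integral_cong) (rule fibre)
  finally show ?thesis by (simp add: h_def)
qed

lemma nn_integral_lebd_affine_coordinates:
  assumes "finite J" "J \<subseteq> {..<d}" and g: "g \<in> borel_measurable (lebd d)"
    and "\<And>i. i \<in> J \<Longrightarrow> a i \<in> borel_measurable (lebd d)"
    and "\<And>i l x t. i \<in> J \<Longrightarrow> l \<in> J \<Longrightarrow> x \<in> Rd d \<Longrightarrow> a i (x(l := t)) = a i x" and c: "c \<noteq> (0::real)"
  shows "ennreal (\<bar>c\<bar> ^ card J) * (\<integral>\<^sup>+x. g (\<lambda>i. if i \<in> J then a i x + c * x i else x i) \<partial>lebd d)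
    = (\<integral>\<^sup>+x. g x \<partial>lebd d)"
  using assms(1,2,4,5)
proof (induction J)
  case (insert l J)
  define T where "T J x = (\<lambda>i. if i \<in> J then a i x + c * x i else x i)" for J x
  have "T J \<in> measurable (lebd d) (lebd d)"
  proof (rule measurable_lebdI)
    fix i assume "i < d"
    then show "(\<lambda>x. T J x i) \<in> borel_measurable (lebd d)"
      using insert.prems(2)[of i] by (cases "i \<in> J") (auto simp: T_def)
  next
    fix x assume "x \<in> space (lebd d)"
    then show "T J x \<in> Rd d"
      using insert.prems(1) by (auto simp: T_def Rd_def PiE_def extensional_def)
  qed
  from measurable_compose[OF this g] have gT: "(\<lambda>x. g (T J x)) \<in> borel_measurable (lebd d)" .
  have "a i (x(l := t)) = a i x" if "i \<in> J" "x \<in> Rd d" for i x t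
    by (rule insert.prems(3)) (use that in auto)
  then have "T (insert l J) x = T J (x(l := a l x + c * x l))" if "x \<in> Rd d" for x
    using insert.hyps(2) that by (auto simp: T_def fun_eq_iff simp del: fun_upd_apply) auto
  then have "(\<integral>\<^sup>+x. g (T (insert l J) x) \<partial>lebd d)
      = (\<integral>\<^sup>+x. g (T J (x(l := a l x + c * x l))) \<partial>lebd d)"
    by (intro nn_integral_cong) simp
  then have "ennreal (\<bar>c\<bar> ^ card (insert l J)) * (\<integral>\<^sup>+x. g (T (insert l J) x) \<partial>lebd d)
      = ennreal (\<bar>c\<bar> ^ card J) * (ennreal \<bar>c\<bar> * (\<integral>\<^sup>+x. g (T J (x(l := a l x + c * x l))) \<partial>lebd d))"
    using insert.hyps by (simp add: ennreal_mult mult_ac)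
  also have "ennreal \<bar>c\<bar> * (\<integral>\<^sup>+x. g (T J (x(l := a l x + c * x l))) \<partial>lebd d)
      = (\<integral>\<^sup>+x. g (T J x) \<partial>lebd d)"
  proof (rule nn_integral_lebd_affine_coordinate[OF _ gT _ _ c])
    show "l < d" "a l \<in> borel_measurable (lebd d)"
      using insert.prems(1,2) by auto
    show "a l (x(l := t)) = a l x" if "x \<in> Rd d" for x t
      by (rule insert.prems(3)) (use that in auto)
  qed
  also have "ennreal (\<bar>c\<bar> ^ card J) * (\<integral>\<^sup>+x. g (T J x) \<partial>lebd d) = (\<integral>\<^sup>+x. g x \<partial>lebd d)"
    unfolding T_def using insert.IH insert.prems by auto
  finally show ?case unfolding T_def .
qed simp

lemma nn_integral_lebd_affine:
  assumes g: "g \<in> borel_measurable (lebd d)" and c: "c \<noteq> (0::real)"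
  shows "ennreal (\<bar>c\<bar> ^ d) * (\<integral>\<^sup>+x. g (line d b x c) \<partial>lebd d) = (\<integral>\<^sup>+x. g x \<partial>lebd d)"
proof -
  have "line d b x c = (\<lambda>i. if i \<in> {..<d} then b i + c * x i else x i)" if "x \<in> Rd d" for x
    using that by (auto simp: line_def fun_eq_iff Rd_undefined)
  then have "(\<integral>\<^sup>+x. g (line d b x c) \<partial>lebd d)
      = (\<integral>\<^sup>+x. g (\<lambda>i. if i \<in> {..<d} then b i + c * x i else x i) \<partial>lebd d)"
    by (intro nn_integral_cong) simp
  then show ?thesis
    using nn_integral_lebd_affine_coordinates[of "{..<d}" d g "\<lambda>i _. b i" c] g c by simp
qed

definition shear :: "nat \<Rightarrow> nat \<Rightarrow> (nat \<Rightarrow> real) \<Rightarrow> (nat \<Rightarrow> real) \<Rightarrow> nat \<Rightarrow> real" where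
  "shear d j w x = restrict (\<lambda>i. if i = j then x j else x i + w i * x j) {..<d}"

lemma shear_in_Rd [simp]: "shear d j w x \<in> Rd d"
  by (simp add: shear_def)

lemma shear_nth: "i < d \<Longrightarrow> shear d j w x i = (if i = j then x j else x i + w i * x j)"
  by (simp add: shear_def)

lemma shear_measurable: "j < d \<Longrightarrow> shear d j w \<in> measurable (lebd d) (lebd d)"
  by (rule measurable_lebdI) (auto simp: shear_nth)

lemma nn_integral_lebd_shear:
  assumes j: "j < d" and g: "g \<in> borel_measurable (lebd d)"
  shows "(\<integral>\<^sup>+x. g (shear d j w x) \<partial>lebd d) = (\<integral>\<^sup>+x. g x \<partial>lebd d)"
proof -
  have "shear d j w x = (\<lambda>i. if i \<in> {..<d} - {j} then w i * x j + 1 * x i else x i)"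
    if "x \<in> Rd d" for x
    using that by (auto simp: shear_def fun_eq_iff Rd_undefined)
  then have "(\<integral>\<^sup>+x. g (shear d j w x) \<partial>lebd d)
      = (\<integral>\<^sup>+x. g (\<lambda>i. if i \<in> {..<d} - {j} then w i * x j + 1 * x i else x i) \<partial>lebd d)"
    by (intro nn_integral_cong) simp
  also have "\<dots> = (\<integral>\<^sup>+x. g x \<partial>lebd d)"
    using nn_integral_lebd_affine_coordinates[of "{..<d} - {j}" d g "\<lambda>i x. w i * x j" 1] j g
    by auto
  finally show ?thesis .
qed

subsection \<open>Reflections\<close>

definition dotd :: "nat \<Rightarrow> (nat \<Rightarrow> real) \<Rightarrow> (nat \<Rightarrow> real) \<Rightarrow> real" where
  "dotd d x y = (\<Sum>i<d. x i * y i)"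

lemma norm2_dotd: "norm2 d x = sqrt (dotd d x x)"
  by (simp add: norm2_def dotd_def power2_eq_square)

lemma dotd_commute: "dotd d x y = dotd d y x"
  by (simp add: dotd_def mult.commute)

lemma dotd_linear:
  "(\<And>i. i < d \<Longrightarrow> z i = x i - c * y i) \<Longrightarrow> dotd d z w = dotd d x w - c * dotd d y w"
  by (simp add: dotd_def left_diff_distrib sum_subtractf sum_distrib_left mult.assoc)

lemma dotd_remove: "j < d \<Longrightarrow> dotd d x y = x j * y j + (\<Sum>i\<in>{..<d} - {j}. x i * y i)"
  unfolding dotd_def by (rule sum.remove) auto

definition reflect :: "nat \<Rightarrow> (nat \<Rightarrow> real) \<Rightarrow> (nat \<Rightarrow> real) \<Rightarrow> nat \<Rightarrow> real" where
  "reflect d v x = restrict (\<lambda>i. x i - 2 * dotd d x v / dotd d v v * v i) {..<d}"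

lemma reflect_in_Rd [simp]: "reflect d v x \<in> Rd d"
  by (simp add: reflect_def)

lemma reflect_nth: "i < d \<Longrightarrow> reflect d v x i = x i - 2 * dotd d x v / dotd d v v * v i"
  by (simp add: reflect_def)

lemma norm2_reflected:
  assumes v: "dotd d v v \<noteq> 0" and w: "\<And>i. i < d \<Longrightarrow> w i = u i - 2 * dotd d u v / dotd d v v * v i"
  shows "norm2 d w = norm2 d u"
proof -
  have dot_w: "dotd d w z = dotd d u z - 2 * dotd d u v / dotd d v v * dotd d v z" for z
    by (rule dotd_linear[OF w])
  then have "dotd d u w = dotd d u u - 2 * dotd d u v / dotd d v v * dotd d u v"
      and "dotd d v w = - dotd d u v"
    using v dot_w[of u] dot_w[of v] by (simp_all add: dotd_commute[of d _ w] dotd_commute[of d v u])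
  then have "dotd d w w = dotd d u u"
    by (simp add: dot_w[of w])
  then show ?thesis by (simp add: norm2_dotd)
qed

lemma norm2_reflect: "dotd d v v \<noteq> 0 \<Longrightarrow> norm2 d (reflect d v x) = norm2 d x"
  by (rule norm2_reflected) (auto simp: reflect_nth)

lemma dist2_reflect:
  assumes "dotd d v v \<noteq> 0"
  shows "dist2 d (reflect d v x) (reflect d v y) = dist2 d x y"
proof -
  have dot_diff: "dotd d (\<lambda>i. x i - y i) v = dotd d x v - dotd d y v"
    using dotd_linear[of d "\<lambda>i. x i - y i" x 1 y v] by simp
  show ?thesis
    unfolding dist2_def
    by (intro norm2_reflected[OF assms])
      (simp add: reflect_nth dot_diff diff_divide_distrib left_diff_distrib right_diff_distrib)
qed

lemma reflect_reflect:
  assumes v: "dotd d v v \<noteq> 0" and x: "x \<in> Rd d"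
  shows "reflect d v (reflect d v x) = x"
proof (rule Rd_eqI[OF _ x])
  fix i assume i: "i < d"
  have "dotd d (reflect d v x) v = dotd d x v - (2 * dotd d x v / dotd d v v) * dotd d v v"
    by (rule dotd_linear) (simp add: reflect_nth)
  also have "\<dots> = - dotd d x v" using v by simp
  finally show "reflect d v (reflect d v x) i = x i" using i by (simp add: reflect_nth)
qed simp

lemma reflect_ray: "reflect d v (ray d x s) = ray d (reflect d v x) s"
proof (rule Rd_eqI[of _ d])
  fix i assume i: "i < d"
  have "dotd d (ray d x s) v = s * dotd d x v"
    by (simp add: dotd_def sum_distrib_left mult.assoc)
  then show "reflect d v (ray d x s) i = ray d (reflect d v x) s i"
    using i by (simp add: reflect_nth algebra_simps)
qed auto

lemma reflection_exists:
  assumes y: "y \<in> Rd d" and z: "z \<in> Rd d" and norm_eq: "norm2 d y = norm2 d z" and "y \<noteq> z"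
  obtains v where "dotd d v v \<noteq> 0" "reflect d v y = z" "reflect d v z = y"
proof -
  define v where "v i = y i - z i" for i
  obtain j where j: "j < d" "y j \<noteq> z j"
    using \<open>y \<noteq> z\<close> Rd_eqI[OF y z] by blast
  have "0 < v j * v j"
    using j by (auto simp: v_def zero_less_mult_iff)
  also have "\<dots> \<le> dotd d v v"
    unfolding dotd_def by (rule member_le_sum) (use j in auto)
  finally have v: "dotd d v v \<noteq> 0" by simp
  have "dotd d y y = dotd d z z"
    using norm_eq by (simp add: norm2_dotd)
  moreover have dot_v: "dotd d v w = dotd d y w - dotd d z w" for w
    using dotd_linear[of d v y 1 z w] by (simp add: v_def)
  ultimately have "dotd d v v = 2 * dotd d y v"
    using dot_v[of v] dot_v[of y] dot_v[of z]
      dotd_commute[of d y v] dotd_commute[of d z v] dotd_commute[of d y z]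
    by linarith
  then have "2 * dotd d y v / dotd d v v = 1"
    using v by simp
  then have "reflect d v y = z"
    by (intro Rd_eqI[OF _ z]) (auto simp: reflect_nth v_def)
  then show ?thesis
    using that v reflect_reflect[OF v y] by blast
qed

lemma reflect_eq_shear:
  assumes v: "dotd d v v \<noteq> 0" and j: "j < d" "v j \<noteq> 0" and x: "x \<in> Rd d"
  defines "flip \<equiv> \<lambda>x. x(j := - (2 * v j / dotd d v v) * (\<Sum>i\<in>{..<d} - {j}. x i * v i) + (-1) * x j)"
  shows "reflect d v x = shear d j (\<lambda>i. v i / v j) (flip (shear d j (\<lambda>i. - v i / v j) x))"
proof (rule Rd_eqI[of _ d])
  define n where "n = dotd d v v"
  define S where "S = (\<Sum>i\<in>{..<d} - {j}. x i * v i)"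
  define y where "y = shear d j (\<lambda>i. - v i / v j) x"
  have y: "y j = x j" "\<And>i. i < d \<Longrightarrow> i \<noteq> j \<Longrightarrow> y i = x i - v i / v j * x j"
    using j by (simp_all add: y_def shear_nth)
  have "(\<Sum>i\<in>{..<d} - {j}. y i * v i) = S - x j / v j * (\<Sum>i\<in>{..<d} - {j}. v i * v i)"
    by (simp add: y S_def sum_subtractf sum_distrib_left algebra_simps)
  also have "(\<Sum>i\<in>{..<d} - {j}. v i * v i) = n - v j * v j"
    using dotd_remove[OF j(1), of v v] by (simp add: n_def)
  finally have "flip y j = - (2 * v j / n) * (S - x j / v j * (n - v j * v j)) + (-1) * x j"
    by (simp add: flip_def n_def y)
  also have "\<dots> = x j - 2 * dotd d x v / n * v j"
    using j v dotd_remove[OF j(1), of x v] by (simp add: field_simps n_def S_def)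
  finally have flip_j: "flip y j = x j - 2 * dotd d x v / n * v j" .
  fix i assume i: "i < d"
  have "shear d j (\<lambda>i. v i / v j) (flip y) i = x i - 2 * dotd d x v / n * v i"
  proof (cases "i = j")
    case False
    then have "shear d j (\<lambda>i. v i / v j) (flip y) i = y i + v i / v j * flip y j"
      using i by (simp add: shear_nth) (simp add: flip_def)
    also have "\<dots> = x i - 2 * dotd d x v / n * v i"
      unfolding flip_j using y(2)[OF i False] j(2) by (simp add: field_simps)
    finally show ?thesis .
  qed (use i flip_j in \<open>simp add: shear_nth\<close>)
  then show "reflect d v x i = shear d j (\<lambda>i. v i / v j) (flip (shear d j (\<lambda>i. - v i / v j) x)) i"
    using i by (simp add: reflect_nth n_def y_def)
qed simp_all

lemma nn_integral_lebd_reflect: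
  assumes v: "dotd d v v \<noteq> 0" and g: "g \<in> borel_measurable (lebd d)"
  shows "(\<integral>\<^sup>+x. g (reflect d v x) \<partial>lebd d) = (\<integral>\<^sup>+x. g x \<partial>lebd d)"
proof -
  obtain j where j: "j < d" "v j \<noteq> 0"
    using v unfolding dotd_def by (force intro: ccontr)
  define a where "a x = - (2 * v j / dotd d v v) * (\<Sum>i\<in>{..<d} - {j}. x i * v i)" for x
  let ?flip = "\<lambda>x. x(j := a x + (-1) * x j)" and ?shear = "\<lambda>e. shear d j (\<lambda>i. e * v i / v j)"
  have a [measurable]: "a \<in> borel_measurable (lebd d)"
    unfolding a_def[abs_def]
    by (intro borel_measurable_times borel_measurable_const borel_measurable_sum) auto
  have a_indep: "a (x(j := t)) = a x" for x t
    unfolding a_def by (auto intro!: arg_cong2[where f = "(*)"] sum.cong)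
  have flip [measurable]: "?flip \<in> measurable (lebd d) (lebd d)"
  proof (rule measurable_lebdI)
    fix i assume "i < d"
    then show "(\<lambda>x. ?flip x i) \<in> borel_measurable (lebd d)"
      using j a by (cases "i = j") auto
  qed (use j in \<open>auto intro: fun_upd_in_Rd\<close>)
  note shear_measurable[OF j(1), measurable]
  have "(\<integral>\<^sup>+x. g (reflect d v x) \<partial>lebd d) = (\<integral>\<^sup>+x. g (?shear 1 (?flip (?shear (-1) x))) \<partial>lebd d)"
    by (intro nn_integral_cong) (simp add: reflect_eq_shear[OF v j] a_def)
  also have "\<dots> = (\<integral>\<^sup>+x. g (?shear 1 (?flip x)) \<partial>lebd d)"
    by (rule nn_integral_lebd_shear[OF j(1), of "\<lambda>x. g (?shear 1 (?flip x))"]) (use g in measurable)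
  also have "\<dots> = (\<integral>\<^sup>+x. g (?shear 1 x) \<partial>lebd d)"
    using nn_integral_lebd_affine_coordinate[OF j(1), of "\<lambda>x. g (?shear 1 x)" a "-1"] a_indep g
    by simp
  also have "\<dots> = (\<integral>\<^sup>+x. g x \<partial>lebd d)"
    by (rule nn_integral_lebd_shear[OF j(1) g])
  finally show ?thesis .
qed

subsection \<open>Volumes of balls\<close>

definition balld :: "nat \<Rightarrow> (nat \<Rightarrow> real) \<Rightarrow> real \<Rightarrow> (nat \<Rightarrow> real) set" where
  "balld d x r = {y \<in> Rd d. dist2 d x y < r}"

lemma oballd_eq_balld: "oballd d r = balld d (zerod d) r"
  by (simp add: oballd_def balld_def dist2_commute[of d "zerod d"])

lemma balld_sets [measurable]: "x \<in> Rd d \<Longrightarrow> balld d x r \<in> sets (lebd d)"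
  unfolding balld_def by (rule sets_lebd_Collect) measurable

lemma oballd_subset_cballd: "oballd d R \<subseteq> cballd d R"
  by (auto simp: oballd_def cballd_def)

lemma emeasure_balld:
  assumes x: "x \<in> Rd d" and r: "r > 0"
  shows "emeasure (lebd d) (balld d x r) = ennreal (r ^ d) * emeasure (lebd d) (oballd d 1)"
proof -
  have "dist2 d x (line d x y r) = r * norm2 d y" for y
    using r norm2_scale[of d "\<lambda>i. x i - line d x y r i" "- r" y] by (simp add: dist2_def)
  then have "(\<integral>\<^sup>+y. indicator (balld d x r) (line d x y r) \<partial>lebd d)
      = (\<integral>\<^sup>+y. indicator (oballd d 1) y \<partial>lebd d)"
    using r by (intro nn_integral_cong) (auto simp: indicator_def balld_def oballd_def)
  moreover have "indicator (balld d x r) \<in> borel_measurable (lebd d)"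
    using x by measurable
  ultimately show ?thesis
    using nn_integral_lebd_affine[of "indicator (balld d x r)" d r x] r x by simp
qed

lemma emeasure_oballd: "r > 0 \<Longrightarrow> emeasure (lebd d) (oballd d r)
    = ennreal (r ^ d) * emeasure (lebd d) (oballd d 1)"
  unfolding oballd_eq_balld[of d r] by (rule emeasure_balld) simp_all

lemma oballd_1_volume:
  obtains v where "v > 0" "emeasure (lebd d) (oballd d 1) = ennreal v"
proof -
  have "cballd d (real d * (1 / (real d + 1))) \<subseteq> oballd d 1"
    by (auto simp: cballd_def oballd_def elim!: le_less_trans)
  then have "obox d (zerod d) (1 / (real d + 1)) \<subseteq> oballd d 1"
    using obox_zerod_subset_cballd by blast
  then have "emeasure (lebd d) (oballd d 1)
      \<ge> emeasure (lebd d) (obox d (zerod d) (1 / (real d + 1)))"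
    by (rule emeasure_mono) simp
  moreover have "emeasure (lebd d) (obox d (zerod d) (1 / (real d + 1))) > 0"
    by (simp add: emeasure_lebd_obox)
  ultimately have "emeasure (lebd d) (oballd d 1) > 0"
    by (rule order_less_le_trans[rotated])
  have "oballd d 1 \<subseteq> obox d (zerod d) 1"
    by (auto simp: oballd_def obox_iff intro: le_less_trans[OF abs_le_norm2])
  then have "emeasure (lebd d) (oballd d 1) \<le> emeasure (lebd d) (obox d (zerod d) 1)"
    by (rule emeasure_mono) simp
  then have "emeasure (lebd d) (oballd d 1) < \<infinity>"
    by (rule le_less_trans) (simp add: emeasure_lebd_obox)
  then show ?thesis
    using \<open>emeasure (lebd d) (oballd d 1) > 0\<close> that[of "enn2real (emeasure (lebd d) (oballd d 1))"]
    by (simp add: enn2real_positive_iff)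
qed

lemma emeasure_oballd_Diff:
  assumes "0 < a" "a \<le> b"
  shows "emeasure (lebd d) (oballd d b - oballd d a)
    = ennreal (b ^ d - a ^ d) * emeasure (lebd d) (oballd d 1)"
proof -
  obtain v where v: "v > 0" "emeasure (lebd d) (oballd d 1) = ennreal v"
    by (rule oballd_1_volume)
  have volume: "emeasure (lebd d) (oballd d r) = ennreal (r ^ d * v)" if "r > 0" for r
    using that v emeasure_oballd[of r d] by (simp add: ennreal_mult)
  have "emeasure (lebd d) (oballd d b - oballd d a)
      = emeasure (lebd d) (oballd d b) - emeasure (lebd d) (oballd d a)"
    using assms volume[of a] by (intro emeasure_Diff) (auto simp: oballd_def sets_lebd_Collect)
  then show ?thesis
    using assms v
    by (simp add: volume ennreal_minus power_mono left_diff_distrib flip: ennreal_mult)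
qed

subsection \<open>Outer measures\<close>

locale outer_measure =
  fixes \<mu> :: "'a set \<Rightarrow> ennreal"
  assumes outer_measure_space: "outer_measure_space UNIV \<mu>"
begin

lemma empty [simp]: "\<mu> {} = 0"
  using outer_measure_space by (simp add: outer_measure_space_def positive_def)

lemma mono: "A \<subseteq> B \<Longrightarrow> \<mu> A \<le> \<mu> B"
  using outer_measure_space by (simp add: outer_measure_space_def increasing_def)

lemma UN_le: "\<mu> (\<Union>i. A i) \<le> (\<Sum>i. \<mu> (A i))"
proof -
  have "\<mu> (\<Union>i. A i) = \<mu> (\<Union>i. disjointed A i)"
    by (simp add: UN_disjointed_eq)
  also have "\<dots> \<le> (\<Sum>i. \<mu> (disjointed A i))"
    using outer_measure_space disjoint_family_disjointed[of A]
    by (simp add: outer_measure_space_def countably_subadditive_def)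
  also have "\<dots> \<le> (\<Sum>i. \<mu> (A i))"
    by (intro suminf_le mono disjointed_subset) auto
  finally show ?thesis .
qed

lemma Un_le: "\<mu> (A \<union> B) \<le> \<mu> A + \<mu> B"
proof -
  define C where "C i = (if i = 0 then A else if i = 1 then B else {})" for i :: nat
  have "A \<union> B = (\<Union>i. C i)"
    by (auto simp: C_def split: if_splits)
  then have "\<mu> (A \<union> B) \<le> (\<Sum>i. \<mu> (C i))"
    using UN_le by simp
  also have "\<dots> = (\<Sum>i\<in>{0, 1}. \<mu> (C i))"
    by (rule suminf_finite) (auto simp: C_def)
  finally show ?thesis by (simp add: C_def)
qed

lemma finite_UN_le: "finite P \<Longrightarrow> \<mu> (\<Union>p\<in>P. A p) \<le> (\<Sum>p\<in>P. \<mu> (A p))"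
proof (induction P rule: finite_induct)
  case (insert p P)
  have "\<mu> (\<Union>q\<in>insert p P. A q) \<le> \<mu> (A p) + \<mu> (\<Union>q\<in>P. A q)"
    using Un_le[of "A p" "\<Union>q\<in>P. A q"] by simp
  also have "\<dots> \<le> \<mu> (A p) + (\<Sum>q\<in>P. \<mu> (A q))"
    by (rule add_left_mono[OF insert.IH])
  finally show ?case using insert.hyps by simp
qed simp

lemma sum_separated_le:
  fixes A :: "nat \<Rightarrow> 'a set"
  assumes "\<And>n. \<mu> (\<Union>j<n. A j) + \<mu> (A n) \<le> \<mu> ((\<Union>j<n. A j) \<union> A n)"
  shows "(\<Sum>j<n. \<mu> (A j)) \<le> \<mu> (\<Union>j<n. A j)"
proof (induction n)
  case (Suc n)
  have "(\<Sum>j<Suc n. \<mu> (A j)) \<le> \<mu> (\<Union>j<n. A j) + \<mu> (A n)"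
    using Suc by (simp add: add_right_mono)
  also have "\<dots> \<le> \<mu> ((\<Union>j<n. A j) \<union> A n)"
    by (rule assms)
  finally show ?case by (simp add: lessThan_Suc Un_commute)
qed simp

text \<open>Layers of equal parity are separated from each other.\<close>

lemma suminf_layers_le:
  assumes B: "incseq B"
    and sep: "\<And>n X Y. X \<subseteq> B n \<Longrightarrow> Y \<subseteq> (\<Union>n. B n) - B (Suc n) \<Longrightarrow> \<mu> X + \<mu> Y \<le> \<mu> (X \<union> Y)"
  shows "(\<Sum>n. \<mu> (B (Suc n) - B n)) \<le> (SUP n. \<mu> (B n)) + (SUP n. \<mu> (B n))"
proof -
  let ?s = "SUP n. \<mu> (B n)"
  define L where "L n = B (Suc n) - B n" for n
  have L_subset: "L m \<subseteq> B n" if "m < n" for m n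
    using incseqD[OF B, of "Suc m" n] that by (auto simp: L_def)
  have parity_class: "(\<Sum>j<m. \<mu> (L (2 * j + p))) \<le> ?s" for m p
  proof -
    have "(\<Sum>j<m. \<mu> (L (2 * j + p))) \<le> \<mu> (\<Union>j<m. L (2 * j + p))"
    proof (rule sum_separated_le)
      fix n
      show "\<mu> (\<Union>j<n. L (2 * j + p)) + \<mu> (L (2 * n + p))
          \<le> \<mu> ((\<Union>j<n. L (2 * j + p)) \<union> L (2 * n + p))"
      proof (cases n)
        case (Suc m)
        have "(\<Union>j<n. L (2 * j + p)) \<subseteq> B (2 * m + p + 1)"
          by (intro UN_least L_subset) (simp add: Suc)
        moreover have "L (2 * n + p) \<subseteq> (\<Union>n. B n) - B (Suc (2 * m + p + 1))"
          by (auto simp: L_def Suc)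
        ultimately show ?thesis by (rule sep)
      qed simp
    qed
    also have "\<dots> \<le> \<mu> (B (2 * m + p))"
      by (intro mono UN_least L_subset) simp
    also have "\<dots> \<le> ?s"
      by (rule SUP_upper) simp
    finally show ?thesis .
  qed
  have "(\<Sum>n<N. \<mu> (L n)) \<le> ?s + ?s" for N
  proof -
    have "(\<Sum>n<N. \<mu> (L n)) \<le> (\<Sum>n<2 * N. \<mu> (L n))"
      by (rule sum_mono2) auto
    also have "\<dots> = (\<Sum>j<N. \<mu> (L (2 * j + 0))) + (\<Sum>j<N. \<mu> (L (2 * j + 1)))"
      by (induction N) (auto simp: algebra_simps)
    also have "\<dots> \<le> ?s + ?s"
      by (intro add_mono parity_class)
    finally show ?thesis .
  qed
  then show ?thesis
    by (simp add: L_def suminf_eq_SUP SUP_le_iff)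
qed

lemma UN_le_add_layers:
  assumes "incseq B"
  shows "\<mu> (\<Union>n. B n) \<le> \<mu> (B N) + (\<Sum>n. \<mu> (B (Suc (n + N)) - B (n + N)))"
proof -
  have "B n \<subseteq> B N \<union> (\<Union>n. B (Suc (n + N)) - B (n + N))" for n
  proof (induction n)
    case (Suc n)
    show ?case
    proof (cases "N \<le> n")
      case True
      then have "B (Suc n) - B n = B (Suc ((n - N) + N)) - B ((n - N) + N)" by simp
      then show ?thesis using Suc by blast
    next
      case False
      then show ?thesis using incseqD[OF assms, of "Suc n" N] by auto
    qed
  qed (use incseqD[OF assms, of 0 N] in auto)
  then have "\<mu> (\<Union>n. B n) \<le> \<mu> (B N \<union> (\<Union>n. B (Suc (n + N)) - B (n + N)))"
    by (intro mono) blast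
  also have "\<dots> \<le> \<mu> (B N) + (\<Sum>n. \<mu> (B (Suc (n + N)) - B (n + N)))"
    using Un_le UN_le by (meson add_left_mono order_trans)
  finally show ?thesis .
qed

lemma UN_le_SUP_if_separated:
  assumes B: "incseq B"
    and sep: "\<And>n X Y. X \<subseteq> B n \<Longrightarrow> Y \<subseteq> (\<Union>n. B n) - B (Suc n) \<Longrightarrow> \<mu> X + \<mu> Y \<le> \<mu> (X \<union> Y)"
  shows "\<mu> (\<Union>n. B n) \<le> (SUP n. \<mu> (B n))"
proof (cases "(SUP n. \<mu> (B n)) = \<infinity>")
  case False
  let ?s = "SUP n. \<mu> (B n)"
  define l where "l n = \<mu> (B (Suc n) - B n)" for n
  have "suminf l \<le> ?s + ?s"
    unfolding l_def using B sep by (rule suminf_layers_le)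
  then have layers_finite: "suminf l \<noteq> \<infinity>"
    using False by (metis ennreal_add_eq_top infinity_ennreal_def neq_top_trans)
  have partial_sums: "\<mu> (\<Union>n. B n) + (\<Sum>n<N. l n) \<le> ?s + suminf l" for N
  proof -
    have "\<mu> (\<Union>n. B n) \<le> \<mu> (B N) + (\<Sum>n. l (n + N))"
      unfolding l_def by (rule UN_le_add_layers[OF B])
    also have "\<dots> \<le> ?s + (\<Sum>n. l (n + N))"
      by (intro add_right_mono SUP_upper) simp
    finally show ?thesis
      by (subst suminf_offset[of l N]) (auto simp: add.assoc[symmetric] intro: add_right_mono)
  qed
  have "\<mu> (\<Union>n. B n) + (SUP N. \<Sum>n<N. l n) = (SUP N. \<mu> (\<Union>n. B n) + (\<Sum>n<N. l n))"
    by (rule ennreal_SUP_add_right) simp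
  also have "\<dots> \<le> ?s + suminf l"
    by (rule SUP_least) (rule partial_sums)
  finally show ?thesis
    using layers_finite by (simp add: add.commute[of _ "suminf l"] flip: suminf_eq_SUP)
qed (metis infinity_ennreal_def top_greatest)

lemma superlevel_le_SUP:
  fixes u :: "'a \<Rightarrow> real"
  assumes sep: "\<And>A B e. e > 0 \<Longrightarrow> (\<And>x y. x \<in> A \<Longrightarrow> y \<in> B \<Longrightarrow> u x + e \<le> u y) \<Longrightarrow> \<mu> A + \<mu> B \<le> \<mu> (A \<union> B)"
  shows "\<mu> {x \<in> E. c < u x} \<le> (SUP n. \<mu> {x \<in> E. c + 1 / real (Suc n) \<le> u x})"
proof -
  define B where "B n = {x \<in> E. c + 1 / real (Suc n) \<le> u x}" for n
  have inverse_Suc: "1 / real (Suc (Suc n)) < 1 / real (Suc n)" for n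
    by (intro divide_strict_left_mono) auto
  have "B n \<subseteq> B (Suc n)" for n
    using inverse_Suc[of n] by (auto simp: B_def)
  then have "incseq B"
    by (rule incseq_SucI)
  have "{x \<in> E. c < u x} = (\<Union>n. B n)"
  proof (intro equalityI subsetI)
    fix x assume x: "x \<in> {x \<in> E. c < u x}"
    then obtain n where "inverse (real (Suc n)) < u x - c"
      using reals_Archimedean[of "u x - c"] by auto
    then show "x \<in> (\<Union>n. B n)"
      using x by (auto simp: B_def inverse_eq_divide intro!: exI[of _ n])
  next
    fix x assume "x \<in> (\<Union>n. B n)"
    then obtain n where "x \<in> E" "c + 1 / real (Suc n) \<le> u x"
      by (auto simp: B_def)
    moreover have "1 / real (Suc n) > 0" by simp
    ultimately have "x \<in> E" "c < u x" by linarith+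
    then show "x \<in> {x \<in> E. c < u x}" by simp
  qed
  also have "\<mu> (\<Union>n. B n) \<le> (SUP n. \<mu> (B n))"
  proof (rule UN_le_SUP_if_separated[OF \<open>incseq B\<close>])
    fix n X Y assume X: "X \<subseteq> B n" and Y: "Y \<subseteq> (\<Union>n. B n) - B (Suc n)"
    have "\<mu> Y + \<mu> X \<le> \<mu> (Y \<union> X)"
    proof (rule sep)
      show "1 / real (Suc n) - 1 / real (Suc (Suc n)) > 0"
        using inverse_Suc[of n] by simp
      show "u y + (1 / real (Suc n) - 1 / real (Suc (Suc n))) \<le> u x" if "y \<in> Y" "x \<in> X" for x y
        using that X Y by (fastforce simp: B_def)
    qed
    then show "\<mu> X + \<mu> Y \<le> \<mu> (X \<union> Y)"
      by (simp add: ac_simps)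
  qed
  finally show ?thesis by (simp add: B_def)
qed

lemma caratheodory_sublevel:
  fixes u :: "'a \<Rightarrow> real"
  assumes sep: "\<And>A B e. e > 0 \<Longrightarrow> (\<And>x y. x \<in> A \<Longrightarrow> y \<in> B \<Longrightarrow> u x + e \<le> u y) \<Longrightarrow> \<mu> A + \<mu> B \<le> \<mu> (A \<union> B)"
  shows "\<mu> (E \<inter> {x. u x \<le> c}) + \<mu> (E - {x. u x \<le> c}) = \<mu> E"
proof (rule antisym)
  let ?L = "E \<inter> {x. u x \<le> c}" and ?B = "\<lambda>n. {x \<in> E. c + 1 / real (Suc n) \<le> u x}"
  have "E - {x. u x \<le> c} = {x \<in> E. c < u x}" by auto
  then have "\<mu> ?L + \<mu> (E - {x. u x \<le> c}) \<le> \<mu> ?L + (SUP n. \<mu> (?B n))"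
    using superlevel_le_SUP[OF sep] by (simp add: add_left_mono)
  also have "\<dots> = (SUP n. \<mu> ?L + \<mu> (?B n))"
    by (rule ennreal_SUP_add_right) simp
  also have "\<dots> \<le> \<mu> E"
  proof (rule SUP_least)
    fix n
    have "\<mu> ?L + \<mu> (?B n) \<le> \<mu> (?L \<union> ?B n)"
      by (rule sep[of "1 / real (Suc n)"]) auto
    also have "\<dots> \<le> \<mu> E"
      by (rule mono) auto
    finally show "\<mu> ?L + \<mu> (?B n) \<le> \<mu> E" .
  qed
  finally show "\<mu> ?L + \<mu> (E - {x. u x \<le> c}) \<le> \<mu> E" .
  show "\<mu> E \<le> \<mu> ?L + \<mu> (E - {x. u x \<le> c})"
    using Un_le[of ?L "E - {x. u x \<le> c}"] by (simp add: Int_Diff_Un)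
qed

end

subsection \<open>Hausdorff outer measures\<close>

definition hterm :: "nat \<Rightarrow> nat \<Rightarrow> (nat \<Rightarrow> real) set \<Rightarrow> ennreal" where
  "hterm d s C = (if C = {} then 0 else ennreal (hconst s) * (ediam d C / 2) ^ s)"

lemma hterm_empty [simp]: "hterm d s {} = 0"
  by (simp add: hterm_def)

lemma hconst_pos [simp]: "hconst s > 0"
  by (simp add: hconst_def Gamma_real_pos)

lemma ediam_empty [simp]: "ediam d {} = 0"
  by (simp add: ediam_def bot_ennreal)

lemma ediam_le_iff: "ediam d C \<le> b \<longleftrightarrow> (\<forall>x\<in>C. \<forall>y\<in>C. ennreal (dist2 d x y) \<le> b)"
  by (auto simp: ediam_def dist2_def SUP_le_iff)

lemma dist2_le_ediam: "x \<in> C \<Longrightarrow> y \<in> C \<Longrightarrow> ennreal (dist2 d x y) \<le> ediam d C"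
  using ediam_le_iff[of d C "ediam d C"] by simp

lemma hterm_eq_ennreal:
  assumes "C \<noteq> {}" "ediam d C = ennreal D" "D \<ge> 0"
  shows "hterm d s C = ennreal (hconst s * (D / 2) ^ s)"
  using assms
  by (simp add: hterm_def ennreal_mult less_imp_le ennreal_power divide_ennreal[of _ 2, simplified])

lemma hterm_mono: "C = {} \<or> C' \<noteq> {} \<Longrightarrow> ediam d C \<le> ediam e C' \<Longrightarrow> hterm d s C \<le> hterm e s C'"
  by (auto simp: hterm_def intro!: mult_left_mono power_mono divide_right_mono_ennreal)

lemma hterm_le:
  assumes "ediam d C \<le> ennreal D" "D \<ge> 0"
  shows "hterm d s C \<le> ennreal (hconst s * (D / 2) ^ s)"
proof (cases "C = {}")
  case False
  obtain D' where "ediam d C = ennreal D'" "0 \<le> D'" "D' \<le> D"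
    using assms by (cases "ediam d C") (auto simp: top_unique)
  then show ?thesis
    using False
    by (auto simp: hterm_eq_ennreal less_imp_le intro!: ennreal_leI mult_left_mono power_mono)
qed simp

lemma haus_delta_le:
  assumes "A \<subseteq> (\<Union>n. C n)" "\<And>n. ediam d (C n) \<le> ennreal \<delta>"
  shows "haus_delta d s \<delta> A \<le> (\<Sum>n. hterm d s (C n))"
  unfolding haus_delta_def hterm_def using assms by (intro INF_lower) auto

lemma haus_delta_ge:
  assumes "\<And>C. A \<subseteq> (\<Union>n. C n) \<Longrightarrow> (\<And>n. ediam d (C n) \<le> ennreal \<delta>) \<Longrightarrow> x \<le> (\<Sum>n. hterm d s (C n))"
  shows "x \<le> haus_delta d s \<delta> A"
  unfolding haus_delta_def using assms unfolding hterm_def by (intro INF_greatest) auto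

lemma haus_delta_le_hterm:
  assumes "ediam d C \<le> ennreal \<delta>"
  shows "haus_delta d s \<delta> C \<le> hterm d s C"
proof -
  have "haus_delta d s \<delta> C \<le> (\<Sum>n. hterm d s (if n = (0::nat) then C else {}))"
    using assms by (intro haus_delta_le) (auto split: if_splits)
  also have "\<dots> = hterm d s C"
    by (subst suminf_finite[of "{0}"]) auto
  finally show ?thesis .
qed

lemma haus_delta_near_optimal_cover:
  assumes "haus_delta d s \<delta> A \<noteq> \<infinity>" "e > 0"
  obtains C where "A \<subseteq> (\<Union>n. C n)" "\<And>n. ediam d (C n) \<le> ennreal \<delta>"
    "(\<Sum>n. hterm d s (C n)) \<le> haus_delta d s \<delta> A + ennreal e"
proof -
  have "\<exists>C\<in>{C :: nat \<Rightarrow> (nat \<Rightarrow> real) set. A \<subseteq> (\<Union>n. C n) \<and> (\<forall>n. ediam d (C n) \<le> ennreal \<delta>)}.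
      (\<Sum>n. hterm d s (C n)) < haus_delta d s \<delta> A + ennreal e"
    by (rule INF_approx_ennreal) (use assms in \<open>simp_all add: haus_delta_def hterm_def\<close>)
  then show ?thesis using that by (auto intro: less_imp_le)
qed

lemma haus_delta_UN_le_covers:
  assumes cover: "\<And>i. A i \<subseteq> (\<Union>n. C i n)" and small: "\<And>i n. ediam d (C i n) \<le> ennreal \<delta>"
  shows "haus_delta d s \<delta> (\<Union>i. A i) \<le> (\<Sum>i. \<Sum>n. hterm d s (C i n))"
proof -
  define C' where "C' m = C (fst (prod_decode m)) (snd (prod_decode m))" for m
  have "haus_delta d s \<delta> (\<Union>i. A i) \<le> (\<Sum>m. hterm d s (C' m))"
  proof (rule haus_delta_le)
    show "(\<Union>i. A i) \<subseteq> (\<Union>m. C' m)"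
    proof
      fix x assume "x \<in> (\<Union>i. A i)"
      then obtain i n where "x \<in> C i n"
        using cover by blast
      then have "x \<in> C' (prod_encode (i, n))"
        by (simp add: C'_def)
      then show "x \<in> (\<Union>m. C' m)" by blast
    qed
  qed (simp add: C'_def small)
  also have "\<dots> = (\<Sum>i. \<Sum>n. hterm d s (C i n))"
    unfolding C'_def
    by (rule suminf_ennreal_2dimen[of _ "\<lambda>p. hterm d s (C (fst p) (snd p))"]) simp
  finally show ?thesis .
qed

lemma haus_delta_subadditive: "haus_delta d s \<delta> (\<Union>i. A i) \<le> (\<Sum>i. haus_delta d s \<delta> (A i))"
proof (cases "(\<Sum>i. haus_delta d s \<delta> (A i)) = \<infinity>")
  case False
  show ?thesis
  proof (rule ennreal_le_epsilon)
    fix e :: real assume e: "e > 0"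
    have "\<exists>C. A i \<subseteq> (\<Union>n. C n) \<and> (\<forall>n. ediam d (C n) \<le> ennreal \<delta>) \<and>
        (\<Sum>n. hterm d s (C n)) \<le> haus_delta d s \<delta> (A i) + ennreal (e * (1/2) ^ Suc i)" for i
    proof -
      have "haus_delta d s \<delta> (A i) \<noteq> \<infinity>"
        using False ennreal_suminf_lessD[of "\<lambda>i. haus_delta d s \<delta> (A i)" \<infinity> i]
        by (simp add: less_top)
      moreover have "e * (1/2) ^ Suc i > 0"
        using e by simp
      ultimately show ?thesis
        using haus_delta_near_optimal_cover by metis
    qed
    then obtain C where cover: "\<And>i. A i \<subseteq> (\<Union>n. C i n)"
        and small: "\<And>i n. ediam d (C i n) \<le> ennreal \<delta>"
        and near: "\<And>i. (\<Sum>n. hterm d s (C i n))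
          \<le> haus_delta d s \<delta> (A i) + ennreal (e * (1/2) ^ Suc i)"
      by metis
    have "haus_delta d s \<delta> (\<Union>i. A i) \<le> (\<Sum>i. \<Sum>n. hterm d s (C i n))"
      using cover small by (rule haus_delta_UN_le_covers)
    also have "\<dots> \<le> (\<Sum>i. haus_delta d s \<delta> (A i) + ennreal (e * (1/2) ^ Suc i))"
      using near by (intro suminf_le) auto
    also have "\<dots> = (\<Sum>i. haus_delta d s \<delta> (A i)) + (\<Sum>i. ennreal (e * (1/2) ^ Suc i))"
      by (intro suminf_add[symmetric]) auto
    also have "(\<Sum>i. ennreal (e * (1/2) ^ Suc i)) = ennreal e"
      using sums_mult[OF power_half_series, of e] e by (intro suminf_ennreal_eq) auto
    finally show "haus_delta d s \<delta> (\<Union>i. A i) \<le> (\<Sum>i. haus_delta d s \<delta> (A i)) + ennreal e" .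
  qed
qed simp

interpretation haus_delta: outer_measure "haus_delta d s \<delta>" for d s \<delta>
proof
  have "haus_delta d s \<delta> {} = 0"
    using haus_delta_le_hterm[of d "{}" \<delta> s] by simp
  moreover have "haus_delta d s \<delta> A \<le> haus_delta d s \<delta> B" if "A \<subseteq> B" for A B
    by (rule haus_delta_ge, rule haus_delta_le) (use that in blast)+
  ultimately show "outer_measure_space UNIV (haus_delta d s \<delta>)"
    by (auto simp: outer_measure_space_def positive_def increasing_def countably_subadditive_def
        intro: haus_delta_subadditive)
qed

lemma haus_delta_antimono:
  assumes "\<delta> \<le> \<delta>'"
  shows "haus_delta d s \<delta>' A \<le> haus_delta d s \<delta> A"
  by (rule haus_delta_ge, rule haus_delta_le) (auto intro: order_trans[OF _ ennreal_leI[OF assms]])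

lemma haus_delta_le_outer: "\<delta> > 0 \<Longrightarrow> haus_delta d s \<delta> A \<le> haus_outer d s A"
  unfolding haus_outer_def by (rule SUP_upper) simp

lemma haus_outer_leI: "(\<And>\<delta>. \<delta> > 0 \<Longrightarrow> haus_delta d s \<delta> A \<le> x) \<Longrightarrow> haus_outer d s A \<le> x"
  unfolding haus_outer_def by (rule SUP_least) simp

interpretation haus_outer: outer_measure "haus_outer d s" for d s
proof
  have "haus_outer d s A \<le> haus_outer d s B" if "A \<subseteq> B" for A B
    by (rule haus_outer_leI) (meson haus_delta.mono[OF that] haus_delta_le_outer order_trans)
  moreover have "haus_outer d s (\<Union>i. A i) \<le> (\<Sum>i. haus_outer d s (A i))"
    for A :: "nat \<Rightarrow> (nat \<Rightarrow> real) set"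
    by (rule haus_outer_leI, rule order_trans[OF haus_delta.UN_le])
      (intro suminf_le haus_delta_le_outer, auto)
  ultimately show "outer_measure_space UNIV (haus_outer d s)"
    by (auto simp: outer_measure_space_def positive_def increasing_def countably_subadditive_def
        haus_outer_def)
qed

lemma haus_delta_separated:
  assumes \<delta>: "0 < \<delta>" "\<delta> < g" and sep: "\<And>x y. x \<in> A \<Longrightarrow> y \<in> B \<Longrightarrow> g \<le> dist2 d x y"
  shows "haus_delta d s \<delta> A + haus_delta d s \<delta> B \<le> haus_delta d s \<delta> (A \<union> B)"
proof (rule haus_delta_ge)
  fix C :: "nat \<Rightarrow> (nat \<Rightarrow> real) set"
  assume C: "A \<union> B \<subseteq> (\<Union>n. C n)" "\<And>n. ediam d (C n) \<le> ennreal \<delta>"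
  define meeting where "meeting A n = (if C n \<inter> A = {} then {} else C n)" for A n
  have meets_one: "C n \<inter> A = {} \<or> C n \<inter> B = {}" for n
  proof (rule ccontr)
    assume "\<not> ?thesis"
    then obtain x y where xy: "x \<in> C n" "x \<in> A" "y \<in> C n" "y \<in> B" by auto
    then have "ennreal (dist2 d x y) \<le> ennreal \<delta>"
      using dist2_le_ediam C(2) by (metis order_trans)
    then show False
      using sep[OF xy(2,4)] \<delta> by (simp add: ennreal_le_iff)
  qed
  have "haus_delta d s \<delta> X \<le> (\<Sum>n. hterm d s (meeting X n))" if "X \<subseteq> A \<union> B" for X
    using C that by (intro haus_delta_le) (fastforce simp: meeting_def)+
  then have "haus_delta d s \<delta> A + haus_delta d s \<delta> B
      \<le> (\<Sum>n. hterm d s (meeting A n)) + (\<Sum>n. hterm d s (meeting B n))"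
    by (intro add_mono) auto
  also have "\<dots> = (\<Sum>n. hterm d s (meeting A n) + hterm d s (meeting B n))"
    by (intro suminf_add) auto
  also have "\<dots> \<le> (\<Sum>n. hterm d s (C n))"
  proof (intro suminf_le)
    show "hterm d s (meeting A n) + hterm d s (meeting B n) \<le> hterm d s (C n)" for n
      using meets_one[of n] by (auto simp: meeting_def)
  qed auto
  finally show "haus_delta d s \<delta> A + haus_delta d s \<delta> B \<le> (\<Sum>n. hterm d s (C n))" .
qed

lemma haus_outer_separated:
  assumes g: "g > 0" and sep: "\<And>x y. x \<in> A \<Longrightarrow> y \<in> B \<Longrightarrow> g \<le> dist2 d x y"
  shows "haus_outer d s A + haus_outer d s B \<le> haus_outer d s (A \<union> B)"
proof -
  have "haus_outer d s A + haus_outer d s B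
      = (SUP \<delta>\<in>{0<..}. haus_delta d s \<delta> A + haus_delta d s \<delta> B)"
    unfolding haus_outer_def
  proof (rule SUP_add_directed_ennreal[symmetric])
    fix a b :: real assume "a \<in> {0<..}" "b \<in> {0<..}"
    then show "\<exists>c\<in>{0<..}. haus_delta d s a A + haus_delta d s b B
        \<le> haus_delta d s c A + haus_delta d s c B"
      by (intro bexI[of _ "min a b"] add_mono haus_delta_antimono) auto
  qed
  also have "\<dots> \<le> haus_outer d s (A \<union> B)"
  proof (rule SUP_least)
    fix \<delta> :: real assume \<delta>: "\<delta> \<in> {0<..}"
    let ?m = "min \<delta> (g / 2)"
    have m: "0 < ?m" "?m < g" "?m \<le> \<delta>" using \<delta> g by auto
    have "haus_delta d s \<delta> A + haus_delta d s \<delta> B \<le> haus_delta d s ?m A + haus_delta d s ?m B"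
      by (intro add_mono haus_delta_antimono m)
    also have "\<dots> \<le> haus_delta d s ?m (A \<union> B)"
      by (rule haus_delta_separated[OF m(1,2) sep])
    also have "\<dots> \<le> haus_outer d s (A \<union> B)"
      by (rule haus_delta_le_outer[OF m(1)])
    finally show "haus_delta d s \<delta> A + haus_delta d s \<delta> B \<le> haus_outer d s (A \<union> B)" .
  qed
  finally show ?thesis .
qed

lemma haus_outer_halfspace:
  assumes i: "i < d"
  shows "haus_outer d s (E \<inter> {x. x i \<le> c}) + haus_outer d s (E - {x. x i \<le> c}) = haus_outer d s E"
proof (rule haus_outer.caratheodory_sublevel)
  fix A B :: "(nat \<Rightarrow> real) set" and e :: real
  assume e: "e > 0" and gap: "\<And>x y. x \<in> A \<Longrightarrow> y \<in> B \<Longrightarrow> x i + e \<le> y i"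
  show "haus_outer d s A + haus_outer d s B \<le> haus_outer d s (A \<union> B)"
  proof (rule haus_outer_separated[OF e])
    fix x y assume "x \<in> A" "y \<in> B"
    then show "e \<le> dist2 d x y"
      using gap[of x y] abs_diff_le_dist2[OF i, of x y] by linarith
  qed
qed

lemma haus_outer_image_le:
  assumes T: "\<And>x y. x \<in> A \<Longrightarrow> y \<in> A \<Longrightarrow> dist2 e (T x) (T y) \<le> dist2 d x y"
  shows "haus_outer e s (T ` A) \<le> haus_outer d s A"
proof (rule haus_outer_leI)
  fix \<delta> :: real assume \<delta>: "\<delta> > 0"
  have "haus_delta e s \<delta> (T ` A) \<le> haus_delta d s \<delta> A"
  proof (rule haus_delta_ge)
    fix C :: "nat \<Rightarrow> (nat \<Rightarrow> real) set"
    assume C: "A \<subseteq> (\<Union>n. C n)" "\<And>n. ediam d (C n) \<le> ennreal \<delta>"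
    have ediam_image: "ediam e (T ` (C n \<inter> A)) \<le> ediam d (C n)" for n
      by (auto simp: ediam_le_iff intro!: order_trans[OF ennreal_leI[OF T] dist2_le_ediam])
    have "haus_delta e s \<delta> (T ` A) \<le> (\<Sum>n. hterm e s (T ` (C n \<inter> A)))"
    proof (rule haus_delta_le)
      show "T ` A \<subseteq> (\<Union>n. T ` (C n \<inter> A))" using C(1) by blast
      show "ediam e (T ` (C n \<inter> A)) \<le> ennreal \<delta>" for n
        using ediam_image C(2) by (rule order_trans)
    qed
    also have "\<dots> \<le> (\<Sum>n. hterm d s (C n))"
      by (intro suminf_le hterm_mono ediam_image) auto
    finally show "haus_delta e s \<delta> (T ` A) \<le> (\<Sum>n. hterm d s (C n))" .
  qed
  then show "haus_delta e s \<delta> (T ` A) \<le> haus_outer d s A"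
    using haus_delta_le_outer[OF \<delta>] by (rule order_trans)
qed

text \<open>A set of diameter \<open>D\<close> lies in a box of side \<open>2 D\<close>, which accounts for the factor \<open>4\<^sup>m\<close>.\<close>

lemma covering_box:
  assumes "ediam m C < \<infinity>"
  obtains b where "b \<in> sets (lebd m)" "C \<inter> Rd m \<subseteq> b"
    "ennreal (hconst m / 4 ^ m) * emeasure (lebd m) b = hterm m m C"
proof (cases "C = {}")
  case False
  then obtain x where x: "x \<in> C" by blast
  define D where "D = enn2real (ediam m C)"
  have D: "ediam m C = ennreal D" "D \<ge> 0"
    using assms by (auto simp: D_def)
  define b where "b = PiE {..<m} (\<lambda>i. {x i - D..x i + D})"
  show ?thesis
  proof (rule that)
    show "b \<in> sets (lebd m)"
      by (simp add: b_def PiE_sets_lebd)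
    show "C \<inter> Rd m \<subseteq> b"
    proof
      fix y assume y: "y \<in> C \<inter> Rd m"
      then have "ennreal (dist2 m y x) \<le> ennreal D"
        using x dist2_le_ediam[of y C x m] by (simp add: D(1))
      then have "dist2 m y x \<le> D"
        using D(2) by (simp add: ennreal_le_iff)
      then have "y i \<in> {x i - D..x i + D}" if "i < m" for i
        using abs_diff_le_dist2[OF that, of y x] by auto
      then show "y \<in> b"
        using y by (auto simp: b_def Rd_def PiE_iff)
    qed
    have "(4::real) ^ m = 2 ^ m * 2 ^ m"
      by (simp flip: power_mult_distrib)
    then have "hconst m / 4 ^ m * (2 * D) ^ m = hconst m * (D / 2) ^ m"
      by (simp add: power_mult_distrib power_divide)
    then show "ennreal (hconst m / 4 ^ m) * emeasure (lebd m) b = hterm m m C"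
      using False D
      by (simp add: b_def emeasure_lebd_cbox hterm_eq_ennreal less_imp_le flip: ennreal_mult)
  qed
qed (use that[of "{}"] in simp)

lemma emeasure_lebd_le_haus_outer:
  assumes "A \<in> sets (lebd m)"
  shows "ennreal (hconst m / 4 ^ m) * emeasure (lebd m) A \<le> haus_outer m m A"
proof -
  let ?c = "ennreal (hconst m / 4 ^ m)"
  have "?c * emeasure (lebd m) A \<le> haus_delta m m 1 A"
  proof (rule haus_delta_ge)
    fix C :: "nat \<Rightarrow> (nat \<Rightarrow> real) set"
    assume C: "A \<subseteq> (\<Union>n. C n)" "\<And>n. ediam m (C n) \<le> ennreal 1"
    have "\<exists>b. b \<in> sets (lebd m) \<and> C n \<inter> Rd m \<subseteq> b \<and> ?c * emeasure (lebd m) b = hterm m m (C n)" for n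
      using covering_box[OF le_less_trans[OF C(2)]] by (metis ennreal_less_top infinity_ennreal_def)
    then obtain b where b: "\<And>n. b n \<in> sets (lebd m)" "\<And>n. C n \<inter> Rd m \<subseteq> b n"
        "\<And>n. ?c * emeasure (lebd m) (b n) = hterm m m (C n)"
      by metis
    have "A \<subseteq> (\<Union>n. b n)"
      using C(1) b(2) sets.sets_into_space[OF assms] by fastforce
    then have "emeasure (lebd m) A \<le> emeasure (lebd m) (\<Union>n. b n)"
      using b(1) by (intro emeasure_mono) auto
    also have "\<dots> \<le> (\<Sum>n. emeasure (lebd m) (b n))"
      by (rule emeasure_subadditive_countably) (use b(1) in auto)
    finally have "?c * emeasure (lebd m) A \<le> ?c * (\<Sum>n. emeasure (lebd m) (b n))"
      by (rule mult_left_mono) simp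
    then show "?c * emeasure (lebd m) A \<le> (\<Sum>n. hterm m m (C n))"
      by (simp add: b(3) flip: ennreal_suminf_cmult)
  qed
  also have "\<dots> \<le> haus_outer m m A"
    by (rule haus_delta_le_outer) simp
  finally show ?thesis .
qed

subsection \<open>Hausdorff measures\<close>

lemma haus_outer_measure_space:
  obtains L where "measure_space (Rd d) L (haus_outer d s)" "sets (lebd d) \<subseteq> L"
proof -
  define L where "L = lambda_system (Rd d) (Pow (Rd d)) (haus_outer d s)"
  have "outer_measure_space (Pow (Rd d)) (haus_outer d s)"
    using haus_outer.outer_measure_space
    by (auto simp: outer_measure_space_def positive_def increasing_def countably_subadditive_def)
  then have measure_space: "measure_space (Rd d) L (haus_outer d s)"
    unfolding L_def by (rule sigma_algebra.caratheodory_lemma[OF sigma_algebra_Pow])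
  then interpret sigma_algebra "Rd d" L
    by (simp add: measure_space_def)
  have halfspace: "{x \<in> Rd d. x i \<le> c} \<in> L" if i: "i < d" for i c
    unfolding L_def algebra.lambda_system_eq[OF algebra_Pow]
  proof (intro CollectI conjI ballI)
    fix E assume "E \<in> Pow (Rd d)"
    then have "E \<inter> {x \<in> Rd d. x i \<le> c} = E \<inter> {x. x i \<le> c}"
        "E - {x \<in> Rd d. x i \<le> c} = E - {x. x i \<le> c}"
      by auto
    then show "haus_outer d s (E \<inter> {x \<in> Rd d. x i \<le> c}) + haus_outer d s (E - {x \<in> Rd d. x i \<le> c})
        = haus_outer d s E"
      using haus_outer_halfspace[OF i] by simp
  qed auto
  define N where "N = measure_of (Rd d) L (\<lambda>_. 0)"
  have N: "sets N = L" "space N = Rd d"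
    unfolding N_def using space_closed by (auto simp: sigma_sets_eq)
  have "(\<lambda>x. x) \<in> measurable N (lebd d)"
  proof (rule measurable_lebdI)
    show "(\<lambda>x. x i) \<in> borel_measurable N" if "i < d" for i
      using halfspace[OF that] by (simp add: borel_measurable_iff_le N)
  qed (simp add: N)
  then have "sets (lebd d) \<subseteq> L"
    using measurable_sets[of "\<lambda>x. x" N "lebd d"] sets.sets_into_space[of _ "lebd d"]
    by (fastforce simp: N Int_absorb2)
  with measure_space show ?thesis by (rule that)
qed

lemma space_hausdorff [simp]: "space (hausdorff d s) = Rd d"
  unfolding hausdorff_def by (rule space_measure_of) (use sets.space_closed[of "lebd d"] in simp)

lemma sets_hausdorff [measurable_cong, simp]: "sets (hausdorff d s) = sets (lebd d)"
  unfolding hausdorff_def using sets.space_closed[of "lebd d"] sets.sigma_sets_eq[of "lebd d"]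
  by simp

lemma emeasure_hausdorff:
  assumes "X \<in> sets (lebd d)"
  shows "emeasure (hausdorff d s) X = haus_outer d s X"
proof (rule emeasure_measure_of[OF hausdorff_def])
  obtain L where L: "measure_space (Rd d) L (haus_outer d s)" "sets (lebd d) \<subseteq> L"
    by (rule haus_outer_measure_space)
  show "sets (lebd d) \<subseteq> Pow (Rd d)"
    using sets.space_closed[of "lebd d"] by simp
  show "positive (sets (hausdorff d s)) (haus_outer d s)"
    by (simp add: positive_def)
  have "countably_additive L (haus_outer d s)"
    using L(1) by (simp add: measure_space_def)
  then show "countably_additive (sets (hausdorff d s)) (haus_outer d s)"
    unfolding countably_additive_def sets_hausdorff using L(2) by (meson subset_trans subsetD)
qed (use assms in simp)

subsection \<open>The Hausdorff measure of spheres\<close>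

lemma sphere_lift:
  assumes q: "q \<in> obox m (zerod m) (R / (real m + 1))" and "R > 0"
  obtains z where "z \<in> sphered (Suc m) R" "restrict z {..<m} = q"
proof -
  define \<sigma> where "\<sigma> = (\<Sum>i<m. (q i)\<^sup>2)"
  have "norm2 m q \<le> m * (R / (real m + 1))"
    using subsetD[OF obox_zerod_subset_cballd q] by (simp add: cballd_def)
  also have "\<dots> = R * (m / (real m + 1))"
    by simp
  also have "\<dots> \<le> R * 1"
    using \<open>R > 0\<close> by (intro mult_left_mono) auto
  finally have "\<sigma> \<le> R\<^sup>2"
    by (simp add: norm2_def \<sigma>_def sqrt_le_D)
  define z where "z = restrict (\<lambda>i. if i < m then q i else sqrt (R\<^sup>2 - \<sigma>)) {..<Suc m}"
  have "(\<Sum>i<Suc m. (z i)\<^sup>2) = \<sigma> + (R\<^sup>2 - \<sigma>)"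
    using \<open>\<sigma> \<le> R\<^sup>2\<close> by (simp add: z_def \<sigma>_def)
  then have "z \<in> sphered (Suc m) R"
    using \<open>R > 0\<close> by (simp add: sphered_def norm2_def z_def del: sum.lessThan_Suc)
  moreover have "restrict z {..<m} = q"
    using q by (intro Rd_eqI[of _ m] restrict_in_Rd) (auto simp: z_def obox_iff)
  ultimately show ?thesis by (rule that)
qed

lemma dist2_restrict_le: "m \<le> d \<Longrightarrow> dist2 m (restrict x {..<m}) (restrict y {..<m}) \<le> dist2 d x y"
  unfolding dist2_def norm2_def by (intro real_sqrt_le_mono) (auto intro!: sum_mono2)

lemma haus_outer_sphere_pos:
  assumes d: "d \<ge> 1" and R: "R > 0"
  shows "haus_outer d (d - 1) (sphered d R) > 0"
proof -
  obtain m where m: "d = Suc m"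
    using d by (cases d) auto
  define e where "e = R / (real m + 1)"
  have e: "e > 0" using R by (simp add: e_def)
  have "0 < ennreal (hconst m / 4 ^ m) * emeasure (lebd m) (obox m (zerod m) e)"
    using e by (simp add: emeasure_lebd_obox ennreal_zero_less_mult_iff)
  also have "\<dots> \<le> haus_outer m m (obox m (zerod m) e)"
    by (rule emeasure_lebd_le_haus_outer) simp
  also have "\<dots> \<le> haus_outer m m ((\<lambda>x. restrict x {..<m}) ` sphered d R)"
    using sphere_lift[OF _ R] unfolding m e_def by (intro haus_outer.mono) (metis imageI subsetI)
  also have "\<dots> \<le> haus_outer d m (sphered d R)"
    by (rule haus_outer_image_le, rule dist2_restrict_le) (simp add: m)
  finally show ?thesis by (simp add: m)
qed

lemma power_diff_le:
  fixes a b :: real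
  assumes "0 \<le> b" "b \<le> a"
  shows "a ^ n - b ^ n \<le> n * (a - b) * a ^ (n - 1)"
proof (cases n)
  case (Suc m)
  have "a ^ n - b ^ n = (a - b) * (\<Sum>i<Suc m. a ^ i * b ^ (m - i))"
    unfolding Suc by (rule diff_power_eq_sum)
  also have "\<dots> \<le> (a - b) * (\<Sum>i<Suc m. a ^ m)"
  proof (intro mult_left_mono sum_mono)
    fix i assume "i \<in> {..<Suc m}"
    then have "a ^ m = a ^ i * a ^ (m - i)"
      by (simp flip: power_add)
    then show "a ^ i * b ^ (m - i) \<le> a ^ m"
      using assms by (simp add: mult_left_mono power_mono)
  qed (use assms in simp)
  finally show ?thesis by (simp add: Suc mult_ac)
qed simp

lemma separated_card_le_emeasure:
  assumes P: "finite P" "P \<subseteq> Rd d" and "\<delta> > 0" and A: "A \<in> sets (lebd d)"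
    and sep: "\<And>p q. p \<in> P \<Longrightarrow> q \<in> P \<Longrightarrow> p \<noteq> q \<Longrightarrow> \<delta> \<le> dist2 d p q"
    and sub: "\<And>p. p \<in> P \<Longrightarrow> balld d p (\<delta> / 2) \<subseteq> A"
  shows "ennreal (real (card P) * (\<delta> / 2) ^ d) * emeasure (lebd d) (oballd d 1)
      \<le> emeasure (lebd d) A"
proof -
  have "disjoint_family_on (\<lambda>p. balld d p (\<delta> / 2)) P"
    unfolding disjoint_family_on_def
  proof (intro ballI impI equals0I)
    fix p q y assume pq: "p \<in> P" "q \<in> P" "p \<noteq> q" and "y \<in> balld d p (\<delta> / 2) \<inter> balld d q (\<delta> / 2)"
    then have "dist2 d p y < \<delta> / 2" "dist2 d y q < \<delta> / 2"
      by (auto simp: balld_def dist2_commute[of d y])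
    then show False
      using sep[OF pq] dist2_triangle[of d p q y] by linarith
  qed
  then have "(\<Sum>p\<in>P. emeasure (lebd d) (balld d p (\<delta> / 2)))
      = emeasure (lebd d) (\<Union>p\<in>P. balld d p (\<delta> / 2))"
    using P by (intro sum_emeasure) auto
  also have "\<dots> \<le> emeasure (lebd d) A"
    using sub by (intro emeasure_mono A) auto
  also have "(\<Sum>p\<in>P. emeasure (lebd d) (balld d p (\<delta> / 2)))
      = (\<Sum>p\<in>P. ennreal ((\<delta> / 2) ^ d) * emeasure (lebd d) (oballd d 1))"
    using P \<open>\<delta> > 0\<close> by (intro sum.cong) (auto simp: emeasure_balld)
  also have "\<dots> = ennreal (real (card P) * (\<delta> / 2) ^ d) * emeasure (lebd d) (oballd d 1)"
    using \<open>\<delta> > 0\<close> by (simp add: ennreal_of_nat_eq_real_of_nat ennreal_mult mult.assoc)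
  finally show ?thesis .
qed

lemma separated_sphere_card_le:
  assumes d: "d \<ge> 1" and \<delta>: "0 < \<delta>" "\<delta> \<le> R" and P: "finite P" "P \<subseteq> sphered d R"
    and sep: "\<And>p q. p \<in> P \<Longrightarrow> q \<in> P \<Longrightarrow> p \<noteq> q \<Longrightarrow> \<delta> \<le> dist2 d p q"
  shows "real (card P) * \<delta> ^ (d - 1) \<le> real d * 2 ^ d * (2 * R) ^ (d - 1)"
proof -
  obtain v where v: "v > 0" "emeasure (lebd d) (oballd d 1) = ennreal v"
    by (rule oballd_1_volume)
  let ?shell = "oballd d (R + \<delta> / 2) - oballd d (R - \<delta> / 2)"
  have balls_in_shell: "balld d p (\<delta> / 2) \<subseteq> ?shell" if "p \<in> P" for p
  proof
    fix y assume y: "y \<in> balld d p (\<delta> / 2)"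
    have "norm2 d p = R" using that P by (auto simp: sphered_def)
    then show "y \<in> ?shell"
      using y dist2_triangle[of d y "zerod d" p] dist2_triangle[of d p "zerod d" y]
          dist2_commute[of d y p]
      by (auto simp: balld_def oballd_def)
  qed
  have "ennreal (real (card P) * (\<delta> / 2) ^ d) * ennreal v \<le> emeasure (lebd d) ?shell"
    unfolding v(2)[symmetric] using P \<delta>(1) sep balls_in_shell
    by (intro separated_card_le_emeasure) (auto simp: sphered_def)
  also have "\<dots> = ennreal ((R + \<delta> / 2) ^ d - (R - \<delta> / 2) ^ d) * ennreal v"
    using \<delta> by (simp add: emeasure_oballd_Diff v(2))
  finally have "ennreal (real (card P) * (\<delta> / 2) ^ d * v)
      \<le> ennreal (((R + \<delta> / 2) ^ d - (R - \<delta> / 2) ^ d) * v)"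
    using \<delta> v(1) by (simp add: ennreal_mult power_mono)
  then have "real (card P) * (\<delta> / 2) ^ d \<le> (R + \<delta> / 2) ^ d - (R - \<delta> / 2) ^ d"
    using \<delta> v(1) by (simp add: power_mono ennreal_le_iff)
  also have "\<dots> \<le> d * \<delta> * (R + \<delta> / 2) ^ (d - 1)"
    using power_diff_le[of "R - \<delta> / 2" "R + \<delta> / 2" d] \<delta> by simp
  also have "\<dots> \<le> d * \<delta> * (2 * R) ^ (d - 1)"
    using \<delta> by (intro mult_left_mono power_mono) auto
  finally have "real (card P) * (\<delta> / 2) ^ d \<le> real d * \<delta> * (2 * R) ^ (d - 1)" .
  moreover have "(\<delta> / 2) ^ d = \<delta> * \<delta> ^ (d - 1) / 2 ^ d"
    using d by (cases d) (simp_all add: power_divide)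
  ultimately have "\<delta> * (real (card P) * \<delta> ^ (d - 1)) \<le> \<delta> * (real d * 2 ^ d * (2 * R) ^ (d - 1))"
    by (simp add: pos_divide_le_eq mult_ac)
  then show ?thesis using \<delta> by simp
qed

lemma sphere_net:
  assumes d: "d \<ge> 1" and \<delta>: "0 < \<delta>" "\<delta> \<le> R"
  obtains P where "finite P" "P \<subseteq> sphered d R" "sphered d R \<subseteq> (\<Union>p\<in>P. balld d p \<delta>)"
    "real (card P) * \<delta> ^ (d - 1) \<le> real d * 2 ^ d * (2 * R) ^ (d - 1)"
proof -
  define separated where "separated P \<longleftrightarrow> finite P \<and> P \<subseteq> sphered d R \<and>
    (\<forall>p\<in>P. \<forall>q\<in>P. p \<noteq> q \<longrightarrow> \<delta> \<le> dist2 d p q)" for P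
  let ?b = "real d * 2 ^ d * (2 * R) ^ (d - 1)"
  have bound: "real (card P) * \<delta> ^ (d - 1) \<le> ?b" if "separated P" for P
    using that separated_sphere_card_le[OF d \<delta>] by (auto simp: separated_def)
  have "card P \<le> nat \<lceil>?b / \<delta> ^ (d - 1)\<rceil>" if "separated P" for P
  proof -
    have "real (card P) \<le> ?b / \<delta> ^ (d - 1)"
      using bound[OF that] \<delta>(1) by (simp add: pos_le_divide_eq)
    then show ?thesis by linarith
  qed
  moreover have "separated {}" by (simp add: separated_def)
  ultimately obtain P where P: "separated P" "\<And>Q. separated Q \<Longrightarrow> card Q \<le> card P"
    using ex_has_greatest_nat[of separated "{}" card] by (metis le_imp_less_Suc)
  have "\<exists>p\<in>P. x \<in> balld d p \<delta>" if x: "x \<in> sphered d R" for x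
  proof (rule ccontr)
    assume "\<not> ?thesis"
    then have far: "\<delta> \<le> dist2 d p x" "\<delta> \<le> dist2 d x p" if "p \<in> P" for p
      using that x by (auto simp: balld_def sphered_def not_less dist2_commute[of d x])
    then have "x \<notin> P" using \<delta>(1) by force
    moreover have "separated (insert x P)"
      using P(1) x far by (auto simp: separated_def)
    ultimately show False
      using P(1) P(2)[of "insert x P"] by (simp add: separated_def)
  qed
  then have cover: "sphered d R \<subseteq> (\<Union>p\<in>P. balld d p \<delta>)" by blast
  show ?thesis
    by (rule that[OF _ _ cover bound[OF P(1)]]) (use P(1) in \<open>auto simp: separated_def\<close>)
qed

lemma haus_outer_sphere_finite:
  assumes d: "d \<ge> 1" and R: "R > 0"
  shows "haus_outer d (d - 1) (sphered d R) < \<infinity>"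
proof -
  let ?b = "real d * 2 ^ d * (2 * R) ^ (d - 1)"
  have "haus_outer d (d - 1) (sphered d R) \<le> ennreal (hconst (d - 1) * ?b)"
  proof (rule haus_outer_leI)
    fix \<delta> :: real assume "\<delta> > 0"
    define r where "r = min R (\<delta> / 2)"
    have r: "0 < r" "r \<le> R" "2 * r \<le> \<delta>"
      using R \<open>\<delta> > 0\<close> by (auto simp: r_def)
    obtain P where P: "finite P" "P \<subseteq> sphered d R" "sphered d R \<subseteq> (\<Union>p\<in>P. balld d p r)"
        "real (card P) * r ^ (d - 1) \<le> ?b"
      by (rule sphere_net[OF d r(1,2)])
    have "dist2 d x y \<le> 2 * r" if "x \<in> balld d p r" "y \<in> balld d p r" for x y p
      using that dist2_triangle[of d x y p] dist2_commute[of d x p] by (auto simp: balld_def)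
    then have ediam: "ediam d (balld d p r) \<le> ennreal (2 * r)" for p
      by (auto simp: ediam_le_iff intro: ennreal_leI)
    have "haus_delta d (d - 1) \<delta> (sphered d R) \<le> (\<Sum>p\<in>P. haus_delta d (d - 1) \<delta> (balld d p r))"
      using haus_delta.mono[OF P(3)] haus_delta.finite_UN_le[OF P(1)] by (rule order_trans)
    also have "\<dots> \<le> (\<Sum>p\<in>P. ennreal (hconst (d - 1) * (2 * r / 2) ^ (d - 1)))"
      using r ediam
      by (intro sum_mono order_trans[OF haus_delta_le_hterm hterm_le])
        (auto intro: order_trans[OF ediam ennreal_leI])
    also have "\<dots> = ennreal (hconst (d - 1) * (card P * r ^ (d - 1)))"
      using r
      by (simp add: ennreal_of_nat_eq_real_of_nat mult.left_commute less_imp_le flip: ennreal_mult)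
    also have "\<dots> \<le> ennreal (hconst (d - 1) * ?b)"
      using P(4) by (intro ennreal_leI mult_left_mono) (auto simp: less_imp_le)
    finally show "haus_delta d (d - 1) \<delta> (sphered d R) \<le> ennreal (hconst (d - 1) * ?b)" .
  qed
  then show ?thesis by (rule le_less_trans) simp
qed

subsection \<open>Measures with equal caps\<close>

text \<open>Two finite measures that each give equal mass to all caps of equal radius are proportional.
  Only one inequality is needed: average a function over caps of radius tending to zero, exchange
  the two integrations, and apply Fatou's lemma.\<close>

locale equal_cap_measures = \<mu>: finite_measure \<mu> + \<nu>: finite_measure \<nu>
  for \<mu> \<nu> :: "'a measure" +
  fixes \<delta> :: "'a \<Rightarrow> 'a \<Rightarrow> real" and S :: "'a set" and c :: 'a
  assumes sets_eq [measurable_cong]: "sets \<nu> = sets \<mu>"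
    and dist_measurable [measurable]: "(\<lambda>p. \<delta> (fst p) (snd p)) \<in> borel_measurable (\<mu> \<Otimes>\<^sub>M \<mu>)"
    and dist_sym: "\<delta> x y = \<delta> y x"
    and AE_in_S: "AE x in \<mu>. x \<in> S" "AE x in \<nu>. x \<in> S"
    and S_space: "S \<subseteq> space \<mu>" and c: "c \<in> S"
    and cap_pos: "\<tau> > 0 \<Longrightarrow> emeasure \<mu> {x \<in> space \<mu>. \<delta> c x < \<tau>} > 0"
    and cap_eq: "y \<in> S \<Longrightarrow> emeasure \<mu> {x \<in> space \<mu>. \<delta> y x < \<tau>} = emeasure \<mu> {x \<in> space \<mu>. \<delta> c x < \<tau>}"
      "y \<in> S \<Longrightarrow> emeasure \<nu> {x \<in> space \<nu>. \<delta> y x < \<tau>} = emeasure \<nu> {x \<in> space \<nu>. \<delta> c x < \<tau>}"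
begin

definition near :: "real \<Rightarrow> 'a \<Rightarrow> 'a \<Rightarrow> ennreal" where
  "near \<tau> x y = (if \<delta> x y < \<tau> then 1 else 0)"

definition cap_mass :: "'a measure \<Rightarrow> real \<Rightarrow> ennreal" where
  "cap_mass M \<tau> = emeasure M {x \<in> space M. \<delta> c x < \<tau>}"

lemma cap_mass_pos: "\<tau> > 0 \<Longrightarrow> cap_mass \<mu> \<tau> \<noteq> 0"
  unfolding cap_mass_def using cap_pos[of \<tau>] by simp

lemma cap_mass_finite: "cap_mass \<mu> \<tau> \<noteq> \<infinity>"
  by (simp add: cap_mass_def)

lemma near_measurable [measurable]: "(\<lambda>p. near \<tau> (fst p) (snd p)) \<in> borel_measurable (\<mu> \<Otimes>\<^sub>M \<mu>)"
  unfolding near_def by measurable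

lemma near_measurable_section [measurable]: "x \<in> space \<mu> \<Longrightarrow> near \<tau> x \<in> borel_measurable \<mu>"
  using measurable_compose[OF measurable_Pair1' near_measurable] by simp

lemma nn_integral_near:
  assumes M [measurable_cong]: "sets M = sets \<mu>" and x: "x \<in> S"
  shows "(\<integral>\<^sup>+y. near \<tau> x y \<partial>M) = emeasure M {y \<in> space M. \<delta> x y < \<tau>}"
proof -
  have "(\<lambda>y. \<delta> x y) \<in> borel_measurable \<mu>"
    using measurable_compose[OF measurable_Pair1' dist_measurable] x S_space by auto
  then have "{y \<in> space M. \<delta> x y < \<tau>} \<in> sets M"
    by measurable
  moreover have "(\<integral>\<^sup>+y. near \<tau> x y \<partial>M) = (\<integral>\<^sup>+y. indicator {y \<in> space M. \<delta> x y < \<tau>} y \<partial>M)"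
    by (intro nn_integral_cong) (simp add: near_def)
  ultimately show ?thesis by simp
qed

lemma near_sym: "near \<tau> x y = near \<tau> y x"
  by (simp add: near_def dist_sym[of x])

lemma nn_integral_near_swap:
  assumes G [measurable]: "G \<in> borel_measurable \<mu>"
  shows "(\<integral>\<^sup>+x. \<integral>\<^sup>+y. near \<tau> x y * G y \<partial>\<mu> \<partial>\<nu>) = cap_mass \<nu> \<tau> * (\<integral>\<^sup>+y. G y \<partial>\<mu>)"
proof -
  interpret pair_sigma_finite \<nu> \<mu> ..
  have space_eq: "space \<nu> = space \<mu>"
    using sets_eq by (rule sets_eq_imp_space_eq)
  have "(\<integral>\<^sup>+x. \<integral>\<^sup>+y. near \<tau> x y * G y \<partial>\<mu> \<partial>\<nu>) = (\<integral>\<^sup>+y. \<integral>\<^sup>+x. near \<tau> x y * G y \<partial>\<nu> \<partial>\<mu>)"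
  proof (rule Fubini'[symmetric])
    have "(\<lambda>p. near \<tau> (fst p) (snd p) * G (snd p)) \<in> borel_measurable (\<nu> \<Otimes>\<^sub>M \<mu>)"
      by measurable
    then show "(\<lambda>(x, y). near \<tau> x y * G y) \<in> borel_measurable (\<nu> \<Otimes>\<^sub>M \<mu>)"
      by (simp add: split_def)
  qed
  also have "\<dots> = (\<integral>\<^sup>+y. (\<integral>\<^sup>+x. near \<tau> y x \<partial>\<nu>) * G y \<partial>\<mu>)"
  proof (rule nn_integral_cong)
    fix y assume "y \<in> space \<mu>"
    then have "near \<tau> y \<in> borel_measurable \<nu>" by measurable
    from nn_integral_multc[OF this, of "G y"]
    show "(\<integral>\<^sup>+x. near \<tau> x y * G y \<partial>\<nu>) = (\<integral>\<^sup>+x. near \<tau> y x \<partial>\<nu>) * G y"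
      by (simp add: near_sym[of \<tau> _ y])
  qed
  also have "\<dots> = (\<integral>\<^sup>+y. cap_mass \<nu> \<tau> * G y \<partial>\<mu>)"
    by (rule nn_integral_cong_AE)
      (use AE_in_S(1) in \<open>auto elim!: eventually_mono
        simp: nn_integral_near[OF sets_eq] cap_eq cap_mass_def\<close>)
  also have "\<dots> = cap_mass \<nu> \<tau> * (\<integral>\<^sup>+y. G y \<partial>\<mu>)"
    by (rule nn_integral_cmult) simp
  finally show ?thesis .
qed

lemma nn_integral_near_cap_mass: "x \<in> S \<Longrightarrow> (\<integral>\<^sup>+y. near \<tau> x y \<partial>\<mu>) = cap_mass \<mu> \<tau>"
  by (simp add: nn_integral_near cap_eq cap_mass_def)

lemma cap_mass_ratio:
  assumes "\<tau> > 0"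
  shows "cap_mass \<nu> \<tau> / cap_mass \<mu> \<tau> = emeasure \<nu> (space \<nu>) / emeasure \<mu> (space \<mu>)"
proof -
  let ?h = "cap_mass \<mu> \<tau>" and ?n = "cap_mass \<nu> \<tau>"
  have total: "emeasure \<mu> (space \<mu>) \<noteq> 0" "emeasure \<mu> (space \<mu>) \<noteq> top"
    using cap_mass_pos[OF assms] emeasure_space[of \<mu> "{x \<in> space \<mu>. \<delta> c x < \<tau>}"]
    by (auto simp: cap_mass_def)
  have "?n * emeasure \<mu> (space \<mu>) = (\<integral>\<^sup>+x. \<integral>\<^sup>+y. near \<tau> x y * 1 \<partial>\<mu> \<partial>\<nu>)"
    by (subst nn_integral_near_swap) simp_all
  also have "\<dots> = (\<integral>\<^sup>+x. ?h \<partial>\<nu>)"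
    by (rule nn_integral_cong_AE)
      (use AE_in_S(2) in \<open>auto elim!: eventually_mono simp: nn_integral_near_cap_mass\<close>)
  also have "\<dots> = ?h * emeasure \<nu> (space \<nu>)" by simp
  finally have swap: "?n * emeasure \<mu> (space \<mu>) = ?h * emeasure \<nu> (space \<nu>)" .
  have "?n = ?n * emeasure \<mu> (space \<mu>) / emeasure \<mu> (space \<mu>)"
    using total by (simp add: mult_divide_eq_ennreal)
  also have "\<dots> = emeasure \<nu> (space \<nu>) / emeasure \<mu> (space \<mu>) * ?h"
    unfolding swap by (simp only: ennreal_divide_times ennreal_times_divide mult.commute)
  finally show ?thesis
    using cap_mass_pos[OF assms] cap_mass_finite[of \<tau>] by (simp add: mult_divide_eq_ennreal)
qed

definition cap_average :: "real \<Rightarrow> ('a \<Rightarrow> ennreal) \<Rightarrow> 'a \<Rightarrow> ennreal" where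
  "cap_average \<tau> G x = (\<integral>\<^sup>+y. near \<tau> x y * G y \<partial>\<mu>) / cap_mass \<mu> \<tau>"

lemma cap_average_measurable [measurable]:
  assumes [measurable]: "G \<in> borel_measurable \<mu>"
  shows "cap_average \<tau> G \<in> borel_measurable \<mu>"
proof -
  have "(\<lambda>p. near \<tau> (fst p) (snd p) * G (snd p)) \<in> borel_measurable (\<mu> \<Otimes>\<^sub>M \<mu>)"
    by measurable
  then have "(\<lambda>x. \<integral>\<^sup>+y. near \<tau> x y * G y \<partial>\<mu>) \<in> borel_measurable \<mu>"
    by (intro \<mu>.borel_measurable_nn_integral) (simp add: split_def)
  then show ?thesis unfolding cap_average_def[abs_def] by measurable
qed

lemma nn_integral_cap_average:
  assumes "\<tau> > 0" and [measurable]: "G \<in> borel_measurable \<mu>"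
  shows "(\<integral>\<^sup>+x. cap_average \<tau> G x \<partial>\<nu>)
    = emeasure \<nu> (space \<nu>) / emeasure \<mu> (space \<mu>) * (\<integral>\<^sup>+y. G y \<partial>\<mu>)"
proof -
  have "(\<lambda>p. near \<tau> (fst p) (snd p) * G (snd p)) \<in> borel_measurable (\<nu> \<Otimes>\<^sub>M \<mu>)"
    by measurable
  then have "(\<lambda>x. \<integral>\<^sup>+y. near \<tau> x y * G y \<partial>\<mu>) \<in> borel_measurable \<nu>"
    by (intro \<mu>.borel_measurable_nn_integral) (simp add: split_def)
  then have "(\<integral>\<^sup>+x. cap_average \<tau> G x \<partial>\<nu>) = cap_mass \<nu> \<tau> * (\<integral>\<^sup>+y. G y \<partial>\<mu>) / cap_mass \<mu> \<tau>"
    unfolding cap_average_def by (simp add: nn_integral_divide nn_integral_near_swap)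
  then show ?thesis
    by (simp add: cap_mass_ratio[OF assms(1), symmetric] ennreal_divide_times ennreal_times_divide
        mult.commute)
qed

lemma cap_average_ge:
  assumes "\<tau> > 0" and x: "x \<in> S" and G: "\<And>y. y \<in> S \<Longrightarrow> \<delta> x y < \<tau> \<Longrightarrow> a \<le> G y"
  shows "a \<le> cap_average \<tau> G x"
proof -
  have [measurable]: "near \<tau> x \<in> borel_measurable \<mu>"
    using x S_space by (intro near_measurable_section) auto
  have "a = a * cap_mass \<mu> \<tau> / cap_mass \<mu> \<tau>"
    using cap_mass_pos[OF assms(1)] cap_mass_finite[of \<tau>] by (simp add: mult_divide_eq_ennreal)
  also have "a * cap_mass \<mu> \<tau> = (\<integral>\<^sup>+y. near \<tau> x y * a \<partial>\<mu>)"
    by (subst nn_integral_multc) (simp_all add: nn_integral_near_cap_mass x mult.commute)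
  also have "\<dots> \<le> (\<integral>\<^sup>+y. near \<tau> x y * G y \<partial>\<mu>)"
    by (rule nn_integral_mono_AE)
      (use AE_in_S(1) in \<open>auto elim!: eventually_mono simp: near_def intro: G\<close>)
  finally show ?thesis
    unfolding cap_average_def by (simp add: divide_right_mono_ennreal)
qed

lemma le_liminf_cap_average:
  assumes x: "x \<in> S"
    and lsc: "\<And>e. e > 0 \<Longrightarrow> \<exists>\<tau>>0. \<forall>y\<in>S. \<delta> x y < \<tau> \<longrightarrow> G x \<le> G y + ennreal e"
  shows "G x \<le> liminf (\<lambda>j. cap_average (1 / real (Suc j)) G x)"
proof (rule ennreal_le_epsilon)
  fix e :: real assume "e > 0"
  then obtain \<tau> where \<tau>: "\<tau> > 0" "\<And>y. y \<in> S \<Longrightarrow> \<delta> x y < \<tau> \<Longrightarrow> G x \<le> G y + ennreal e"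
    using lsc by blast
  obtain J where J: "inverse (real (Suc J)) < \<tau>"
    using reals_Archimedean[OF \<tau>(1)] by blast
  have "G x - ennreal e \<le> cap_average (1 / real (Suc j)) G x" if "J \<le> j" for j
  proof (rule cap_average_ge[OF _ x])
    fix y assume y: "y \<in> S" "\<delta> x y < 1 / real (Suc j)"
    have "1 / real (Suc j) \<le> inverse (real (Suc J))"
      using that by (simp add: inverse_eq_divide frac_le)
    then have "G x \<le> G y + ennreal e"
      using J y by (intro \<tau>(2)) auto
    then show "G x - ennreal e \<le> G y"
      by (simp add: ennreal_minus_le_iff add.commute)
  qed simp
  then have "\<forall>\<^sub>F j in sequentially. G x - ennreal e \<le> cap_average (1 / real (Suc j)) G x"
    by (auto simp: eventually_sequentially)
  then have "G x - ennreal e \<le> liminf (\<lambda>j. cap_average (1 / real (Suc j)) G x)"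
    by (rule Liminf_bounded)
  then show "G x \<le> liminf (\<lambda>j. cap_average (1 / real (Suc j)) G x) + ennreal e"
    by (simp add: ennreal_minus_le_iff add.commute)
qed

lemma nn_integral_le_proportional:
  assumes G [measurable]: "G \<in> borel_measurable \<mu>"
    and lsc: "\<And>x e. x \<in> S \<Longrightarrow> e > 0 \<Longrightarrow> \<exists>\<tau>>0. \<forall>y\<in>S. \<delta> x y < \<tau> \<longrightarrow> G x \<le> G y + ennreal e"
  shows "(\<integral>\<^sup>+x. G x \<partial>\<nu>) \<le> emeasure \<nu> (space \<nu>) / emeasure \<mu> (space \<mu>) * (\<integral>\<^sup>+x. G x \<partial>\<mu>)"
proof -
  let ?A = "\<lambda>j. cap_average (1 / real (Suc j)) G"
  have "(\<integral>\<^sup>+x. G x \<partial>\<nu>) \<le> (\<integral>\<^sup>+x. liminf (\<lambda>j. ?A j x) \<partial>\<nu>)"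
    by (rule nn_integral_mono_AE)
      (use AE_in_S(2) in \<open>auto elim!: eventually_mono
        intro: le_liminf_cap_average lsc simp del: of_nat_Suc\<close>)
  also have "\<dots> \<le> liminf (\<lambda>j. \<integral>\<^sup>+x. ?A j x \<partial>\<nu>)"
    by (rule nn_integral_liminf) measurable
  also have "\<dots> = emeasure \<nu> (space \<nu>) / emeasure \<mu> (space \<mu>) * (\<integral>\<^sup>+x. G x \<partial>\<mu>)"
    by (simp add: nn_integral_cap_average Liminf_const)
  finally show ?thesis .
qed

end

subsection \<open>Averages over spheres and over directions\<close>

definition pball :: "nat \<Rightarrow> real \<Rightarrow> (nat \<Rightarrow> real) set" where
  "pball d R = oballd d R - {zerod d}"

lemma pball_iff: "x \<in> pball d R \<longleftrightarrow> x \<in> Rd d \<and> 0 < norm2 d x \<and> norm2 d x < R"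
  unfolding pball_def oballd_def using norm2_pos_iff[of x d] by auto

lemma pball_subset_oballd: "pball d R \<subseteq> oballd d R"
  by (auto simp: pball_def)

lemma pball_sets [measurable]: "pball d R \<in> sets (lebd d)"
proof -
  have "{x \<in> Rd d. 0 < norm2 d x \<and> norm2 d x < R} \<in> sets (lebd d)"
    by (rule sets_lebd_Collect) measurable
  moreover have "{x \<in> Rd d. 0 < norm2 d x \<and> norm2 d x < R} = pball d R"
    by (auto simp: pball_iff)
  ultimately show ?thesis by simp
qed

definition sproj :: "nat \<Rightarrow> real \<Rightarrow> (nat \<Rightarrow> real) \<Rightarrow> nat \<Rightarrow> real" where
  "sproj d s x = ray d x (s / norm2 d x)"

lemma sproj_in_Rd [simp]: "sproj d s x \<in> Rd d"
  by (simp add: sproj_def)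

lemma norm2_sproj: "norm2 d x > 0 \<Longrightarrow> norm2 d (sproj d s x) = \<bar>s\<bar>"
  by (simp add: sproj_def)

lemma sproj_in_sphered: "x \<in> pball d R \<Longrightarrow> s \<ge> 0 \<Longrightarrow> sproj d s x \<in> sphered d s"
  by (simp add: sphered_def norm2_sproj pball_iff)

lemma sproj_self: "x \<in> Rd d \<Longrightarrow> norm2 d x > 0 \<Longrightarrow> sproj d (norm2 d x) x = x"
  by (simp add: sproj_def ray_1)

lemma sproj_eq_ray: "sproj d s x = ray d (\<lambda>i. x i / norm2 d x) s"
  unfolding sproj_def by (rule Rd_eqI[of _ d]) auto

lemma reflect_sproj: "dotd d v v \<noteq> 0 \<Longrightarrow> reflect d v (sproj d s x) = sproj d s (reflect d v x)"
  by (simp add: sproj_def reflect_ray norm2_reflect)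

lemma sproj_measurable_pair: "(\<lambda>(s, x). sproj d s x) \<in> measurable (borel \<Otimes>\<^sub>M lebd d) (lebd d)"
proof (rule measurable_lebdI)
  fix i assume i: "i < d"
  have "(\<lambda>p. fst p / norm2 d (snd p) * snd p i) \<in> borel_measurable (borel \<Otimes>\<^sub>M lebd d)"
    using measurable_compose[OF measurable_snd coordinate_measurable[OF i]] by measurable
  then show "(\<lambda>p. (case p of (s, x) \<Rightarrow> sproj d s x) i) \<in> borel_measurable (borel \<Otimes>\<^sub>M lebd d)"
    using i by (simp add: sproj_def split_def)
qed (auto split: prod.split)

lemma sproj_measurable [measurable]: "sproj d s \<in> measurable (lebd d) (lebd d)"
  using measurable_compose[OF measurable_Pair1' sproj_measurable_pair, of s] by simp

lemma reflection_of_sphere: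
  assumes "y \<in> sphered d s" "z \<in> sphered d s"
  shows "y = z \<or> (\<exists>v. dotd d v v \<noteq> 0 \<and> reflect d v y = z \<and> reflect d v z = y)"
  using assms reflection_exists[of y d z] unfolding sphered_def by auto

lemma haus_outer_cap_le:
  assumes "y \<in> sphered d s" "z \<in> sphered d s"
  shows "haus_outer d m (sphered d s \<inter> balld d z \<tau>) \<le> haus_outer d m (sphered d s \<inter> balld d y \<tau>)"
  using reflection_of_sphere[OF assms]
proof (elim disjE exE conjE)
  fix v assume v: "dotd d v v \<noteq> 0" "reflect d v z = y"
  have "sphered d s \<inter> balld d z \<tau> \<subseteq> reflect d v ` (sphered d s \<inter> balld d y \<tau>)"
  proof
    fix w assume w: "w \<in> sphered d s \<inter> balld d z \<tau>"
    then have "reflect d v w \<in> sphered d s \<inter> balld d y \<tau>"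
      using dist2_reflect[OF v(1), of z w] by (simp add: sphered_def balld_def norm2_reflect v)
    moreover have "w = reflect d v (reflect d v w)"
      using w by (simp add: reflect_reflect v sphered_def)
    ultimately show "w \<in> reflect d v ` (sphered d s \<inter> balld d y \<tau>)" by blast
  qed
  then have "haus_outer d m (sphered d s \<inter> balld d z \<tau>)
      \<le> haus_outer d m (reflect d v ` (sphered d s \<inter> balld d y \<tau>))"
    by (rule haus_outer.mono)
  also have "\<dots> \<le> haus_outer d m (sphered d s \<inter> balld d y \<tau>)"
    by (rule haus_outer_image_le) (simp add: dist2_reflect v)
  finally show ?thesis .
qed simp

lemma haus_outer_cap_eq:
  assumes "y \<in> sphered d s" "z \<in> sphered d s"
  shows "haus_outer d m (sphered d s \<inter> balld d y \<tau>) = haus_outer d m (sphered d s \<inter> balld d z \<tau>)"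
  using haus_outer_cap_le[OF assms] haus_outer_cap_le[OF assms(2,1)] by (rule antisym[rotated])

lemma haus_outer_cap_pos:
  assumes d: "d \<ge> 1" and s: "s > 0" and \<tau>: "\<tau> > 0" and y: "y \<in> sphered d s"
  shows "haus_outer d (d - 1) (sphered d s \<inter> balld d y \<tau>) > 0"
proof (rule ccontr)
  assume "\<not> ?thesis"
  then have null: "haus_outer d (d - 1) (sphered d s \<inter> balld d z \<tau>) = 0" if "z \<in> sphered d s" for z
    using haus_outer_cap_eq[OF y that, of "d - 1" \<tau>] by simp
  have "0 < min \<tau> s" "min \<tau> s \<le> s"
    using \<tau> s by auto
  then obtain P where P: "finite P" "P \<subseteq> sphered d s" "sphered d s \<subseteq> (\<Union>p\<in>P. balld d p (min \<tau> s))"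
    by (rule sphere_net[OF d])
  have "sphered d s \<subseteq> (\<Union>p\<in>P. sphered d s \<inter> balld d p \<tau>)"
    using P(3) by (fastforce simp: balld_def)
  then have "haus_outer d (d - 1) (sphered d s)
      \<le> (\<Sum>p\<in>P. haus_outer d (d - 1) (sphered d s \<inter> balld d p \<tau>))"
    by (rule order_trans[OF haus_outer.mono haus_outer.finite_UN_le[OF P(1)]])
  also have "\<dots> = 0"
    using P(2) null by (intro sum.neutral) blast
  finally show False
    using haus_outer_sphere_pos[OF d s] by simp
qed

lemma emeasure_directions_cap_eq:
  assumes "y \<in> sphered d s" "z \<in> sphered d s"
  shows "emeasure (lebd d) {x \<in> pball d R. dist2 d y (sproj d s x) < \<tau>}
    = emeasure (lebd d) {x \<in> pball d R. dist2 d z (sproj d s x) < \<tau>}"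
  using reflection_of_sphere[OF assms]
proof (elim disjE exE conjE)
  fix v assume v: "dotd d v v \<noteq> 0" "reflect d v y = z"
  let ?A = "\<lambda>y. {x \<in> pball d R. dist2 d y (sproj d s x) < \<tau>}"
  have A_sets: "?A y \<in> sets (lebd d)" if "y \<in> Rd d" for y
  proof -
    have "{x \<in> Rd d. x \<in> pball d R \<and> dist2 d y (sproj d s x) < \<tau>} \<in> sets (lebd d)"
      using that by (intro sets_lebd_Collect) measurable
    moreover have "{x \<in> Rd d. x \<in> pball d R \<and> dist2 d y (sproj d s x) < \<tau>} = ?A y"
      by (auto simp: pball_iff)
    ultimately show ?thesis by simp
  qed
  have z: "z \<in> Rd d" and y: "y \<in> Rd d"
    using assms by (auto simp: sphered_def)
  have "dist2 d z (sproj d s (reflect d v x)) = dist2 d y (sproj d s x)" for x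
    using dist2_reflect[OF v(1), of y "sproj d s x"] by (simp add: v reflect_sproj)
  then have "(\<integral>\<^sup>+x. indicator (?A z) (reflect d v x) \<partial>lebd d) = (\<integral>\<^sup>+x. indicator (?A y) x \<partial>lebd d)"
    by (intro nn_integral_cong) (auto simp: indicator_def pball_iff norm2_reflect v)
  then show ?thesis
    using nn_integral_lebd_reflect[OF v(1), of "indicator (?A z)"] A_sets[OF y] A_sets[OF z] by simp
qed simp

definition sphere_measure :: "nat \<Rightarrow> real \<Rightarrow> (nat \<Rightarrow> real) measure" where
  "sphere_measure d s = density (hausdorff d (d - 1)) (indicator (sphered d s))"

lemma sets_sphere_measure [measurable_cong, simp]: "sets (sphere_measure d s) = sets (lebd d)"
  by (simp add: sphere_measure_def)

lemma space_sphere_measure [simp]: "space (sphere_measure d s) = Rd d"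
  by (simp add: sphere_measure_def)

lemma emeasure_sphere_measure:
  "A \<in> sets (lebd d) \<Longrightarrow> emeasure (sphere_measure d s) A = haus_outer d (d - 1) (sphered d s \<inter> A)"
  unfolding sphere_measure_def by (subst emeasure_restricted) (auto simp: emeasure_hausdorff)

lemma emeasure_sphere_measure_total:
  "emeasure (sphere_measure d s) (Rd d) = emeasure (hausdorff d (d - 1)) (sphered d s)"
proof -
  have "sphered d s \<inter> Rd d = sphered d s"
    by (auto simp: sphered_def)
  then show ?thesis
    using emeasure_sphere_measure[OF sets.top[of "lebd d", simplified]]
    by (simp add: emeasure_hausdorff)
qed

lemma AE_sphere_measure: "AE x in sphere_measure d s. x \<in> sphered d s"
  unfolding sphere_measure_def by (subst AE_density) (auto simp: indicator_def)

lemma nn_integral_sphere_measure: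
  assumes "f \<in> borel_measurable (lebd d)"
  shows "(\<integral>\<^sup>+y. f y \<partial>sphere_measure d s) = (\<integral>\<^sup>+y\<in>sphered d s. f y \<partial>hausdorff d (d - 1))"
proof -
  have "(\<integral>\<^sup>+y. f y \<partial>sphere_measure d s)
      = (\<integral>\<^sup>+y. indicator (sphered d s) y * f y \<partial>hausdorff d (d - 1))"
    unfolding sphere_measure_def by (rule nn_integral_density) (use assms in measurable)
  then show ?thesis by (simp add: mult.commute)
qed

definition direction_measure :: "nat \<Rightarrow> real \<Rightarrow> real \<Rightarrow> (nat \<Rightarrow> real) measure" where
  "direction_measure d R s = distr (density (lebd d) (indicator (pball d R))) (lebd d) (sproj d s)"

lemma sets_direction_measure [measurable_cong, simp]:
  "sets (direction_measure d R s) = sets (lebd d)"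
  by (simp add: direction_measure_def)

lemma space_direction_measure [simp]: "space (direction_measure d R s) = Rd d"
  by (simp add: direction_measure_def)

lemma emeasure_direction_measure:
  assumes "A \<in> sets (lebd d)"
  shows "emeasure (direction_measure d R s) A = emeasure (lebd d) {x \<in> pball d R. sproj d s x \<in> A}"
proof -
  have "pball d R \<inter> (sproj d s -` A \<inter> Rd d) = {x \<in> pball d R. sproj d s x \<in> A}"
    by (auto simp: pball_iff)
  then show ?thesis
    using assms measurable_sets[OF sproj_measurable assms]
    by (simp add: direction_measure_def emeasure_distr emeasure_restricted)
qed

lemma emeasure_direction_measure_total:
  "emeasure (direction_measure d R s) (Rd d) = emeasure (lebd d) (pball d R)"
  using emeasure_direction_measure[OF sets.top[of "lebd d", simplified]] by simp

lemma AE_direction_measure: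
  assumes "s \<ge> 0"
  shows "AE x in direction_measure d R s. x \<in> sphered d s"
proof -
  have "AE x in density (lebd d) (indicator (pball d R)). sproj d s x \<in> sphered d s"
    using assms by (subst AE_density) (auto simp: indicator_def intro!: AE_I2 sproj_in_sphered)
  moreover have "{x \<in> Rd d. x \<in> sphered d s} = sphered d s"
    by (auto simp: sphered_def)
  ultimately show ?thesis
    unfolding direction_measure_def by (subst AE_distr_iff) simp_all
qed

lemma nn_integral_direction_measure:
  assumes f [measurable]: "f \<in> borel_measurable (lebd d)"
  shows "(\<integral>\<^sup>+y. f y \<partial>direction_measure d R s) = (\<integral>\<^sup>+x\<in>pball d R. f (sproj d s x) \<partial>lebd d)"
proof -
  have "(\<integral>\<^sup>+y. f y \<partial>direction_measure d R s)
      = (\<integral>\<^sup>+x. f (sproj d s x) \<partial>density (lebd d) (indicator (pball d R)))"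
    unfolding direction_measure_def by (rule nn_integral_distr) simp_all
  also have "\<dots> = (\<integral>\<^sup>+x. indicator (pball d R) x * f (sproj d s x) \<partial>lebd d)"
    by (rule nn_integral_density) measurable
  finally show ?thesis by (simp add: mult.commute)
qed

lemma equal_cap_measures_sphere:
  assumes d: "d \<ge> 1" and s: "s > 0" and c: "c \<in> sphered d s"
    and finite: "emeasure (lebd d) (pball d R) \<noteq> \<infinity>"
  shows "equal_cap_measures (sphere_measure d s) (direction_measure d R s) (dist2 d)
    (sphered d s) c"
proof -
  interpret \<mu>: finite_measure "sphere_measure d s"
    by (rule finite_measureI)
      (use haus_outer_sphere_finite[OF d s] in
          \<open>simp add: emeasure_sphere_measure_total emeasure_hausdorff\<close>)
  interpret \<nu>: finite_measure "direction_measure d R s"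
    by (rule finite_measureI) (use finite in \<open>simp add: emeasure_direction_measure_total\<close>)
  have R: "y \<in> Rd d" if "y \<in> sphered d s" for y
    using that by (simp add: sphered_def)
  have ball: "{x \<in> Rd d. dist2 d y x < \<tau>} = balld d y \<tau>" for y \<tau>
    by (simp add: balld_def)
  show ?thesis
  proof
    show "(\<lambda>p. dist2 d (fst p) (snd p))
        \<in> borel_measurable (sphere_measure d s \<Otimes>\<^sub>M sphere_measure d s)"
      by measurable
    show "AE x in direction_measure d R s. x \<in> sphered d s"
      using s by (intro AE_direction_measure) simp
    show "0 < emeasure (sphere_measure d s) {x \<in> space (sphere_measure d s). dist2 d c x < \<tau>}"
      if "\<tau> > 0" for \<tau>
      using haus_outer_cap_pos[OF d s that c] R[OF c] by (simp add: ball emeasure_sphere_measure)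
    fix y \<tau> assume y: "y \<in> sphered d s"
    show "emeasure (sphere_measure d s) {x \<in> space (sphere_measure d s). dist2 d y x < \<tau>}
        = emeasure (sphere_measure d s) {x \<in> space (sphere_measure d s). dist2 d c x < \<tau>}"
      using haus_outer_cap_eq[OF y c] R[OF y] R[OF c] by (simp add: ball emeasure_sphere_measure)
    show "emeasure (direction_measure d R s) {x \<in> space (direction_measure d R s). dist2 d y x < \<tau>}
        = emeasure (direction_measure d R s) {x \<in> space (direction_measure d R s). dist2 d c x < \<tau>}"
      using emeasure_directions_cap_eq[OF y c, of R \<tau>] R[OF y] R[OF c]
      by (simp add: ball emeasure_direction_measure) (simp add: balld_def)
  qed (use c R in \<open>auto simp: dist2_commute AE_sphere_measure\<close>)
qed

lemma abs_lower_semicontinuous_on_sphere: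
  fixes g :: "(nat \<Rightarrow> real) \<Rightarrow> real"
  assumes g: "continuous_on (sphered d s) g" and x: "x \<in> sphered d s" and "e > 0"
  shows "\<exists>\<tau>>0. \<forall>y\<in>sphered d s. dist2 d x y < \<tau> \<longrightarrow> ennreal \<bar>g x\<bar> \<le> ennreal \<bar>g y\<bar> + ennreal e"
proof -
  obtain r where r: "r > 0" "\<And>y. y \<in> obox d x r \<inter> sphered d s \<Longrightarrow> \<bar>g y - g x\<bar> < e"
    using continuous_on_Rd_obox[OF g _ x \<open>e > 0\<close>, of d] by (auto simp: sphered_def)
  have "ennreal \<bar>g x\<bar> \<le> ennreal \<bar>g y\<bar> + ennreal e" if y: "y \<in> sphered d s" "dist2 d x y < r" for y
  proof -
    have "y \<in> obox d x r"
      using y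
      by (auto simp: obox_iff sphered_def abs_minus_commute
          intro: le_less_trans[OF abs_diff_le_dist2])
    then have "\<bar>g x\<bar> \<le> \<bar>g y\<bar> + e"
      using r(2)[of y] y(1) by auto
    then show ?thesis
      using \<open>e > 0\<close> by (simp add: ennreal_leI flip: ennreal_plus)
  qed
  then show ?thesis using r(1) by blast
qed

lemma nn_integral_directions_le_sph_avg:
  fixes g :: "(nat \<Rightarrow> real) \<Rightarrow> real"
  assumes d: "d \<ge> 1" and s: "s > 0" and g: "continuous_on (sphered d s) g"
    and finite: "emeasure (lebd d) (pball d R) \<noteq> \<infinity>"
  shows "(\<integral>\<^sup>+x\<in>pball d R. ennreal \<bar>g (sproj d s x)\<bar> \<partial>lebd d)
      \<le> emeasure (lebd d) (pball d R) * sph_avg d g s"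
proof -
  have "sphered d s \<noteq> {}"
    using haus_outer_sphere_pos[OF d s] by auto
  then obtain c where "c \<in> sphered d s" by blast
  then interpret equal_cap_measures "sphere_measure d s" "direction_measure d R s" "dist2 d"
      "sphered d s" c
    using finite by (rule equal_cap_measures_sphere[OF d s])
  define G where "G y = ennreal \<bar>indicator (sphered d s) y * g y\<bar>" for y
  have G [measurable]: "G \<in> borel_measurable (lebd d)"
    unfolding G_def using borel_measurable_continuous_on_lebd[OF sphered_sets g] by measurable
  have "(\<integral>\<^sup>+x\<in>pball d R. ennreal \<bar>g (sproj d s x)\<bar> \<partial>lebd d) = (\<integral>\<^sup>+y. G y \<partial>direction_measure d R s)"
    unfolding nn_integral_direction_measure[OF G]
    using s sproj_in_sphered[of _ d R s]
    by (intro nn_integral_cong) (auto simp: G_def indicator_def)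
  also have "\<dots> \<le> emeasure (lebd d) (pball d R) / emeasure (hausdorff d (d - 1)) (sphered d s)
      * (\<integral>\<^sup>+y. G y \<partial>sphere_measure d s)"
    using nn_integral_le_proportional[of G] abs_lower_semicontinuous_on_sphere[OF g]
    by (simp add: G_def emeasure_sphere_measure_total emeasure_direction_measure_total)
  also have "(\<integral>\<^sup>+y. G y \<partial>sphere_measure d s)
      = (\<integral>\<^sup>+y\<in>sphered d s. ennreal \<bar>g y\<bar> \<partial>hausdorff d (d - 1))"
    unfolding nn_integral_sphere_measure[OF G]
    by (intro nn_integral_cong) (auto simp: G_def indicator_def)
  finally show ?thesis
    unfolding sph_avg_def by (simp add: ennreal_divide_times ennreal_times_divide mult.commute)
qed

subsection \<open>Uniform approximation by Taylor polynomials\<close>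

lemma infc_err_sup_le:
  assumes "k > 0" "\<epsilon> > 0" "\<delta> > 0" "\<rho> \<ge> 0" "C \<ge> 0"
    and K: "cballd d \<delta> \<subseteq> K" "K \<subseteq> cballd d \<rho>" "U \<subseteq> K"
    and star: "\<And>x t. x \<in> K \<Longrightarrow> 0 < t \<Longrightarrow> t < 1 \<Longrightarrow> ray d x t \<in> U"
    and cont: "\<And>f. f \<in> F \<Longrightarrow> continuous_on K f"
    and local: "\<And>f x. f \<in> F \<Longrightarrow> x \<in> cballd d \<delta> \<Longrightarrow> \<bar>f x - taylor d k f x\<bar> \<le> C * norm2 d x ^ k"
    and global: "\<And>f x. f \<in> F \<Longrightarrow> x \<in> U \<Longrightarrow> \<bar>f x - taylor d k f x\<bar> \<le> \<epsilon> / 4"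
  shows "\<exists>m \<le> (d + 1) ^ (k - 1). infc K F (err_sup K) \<epsilon> = enat m"
proof (rule infc_le_local_polynomial_approximation[where \<eta> = "\<epsilon> / 2" and \<rho> = \<rho> and C = C
      and G = "\<lambda>g. g"])
  fix f g assume fg: "f \<in> F" "g \<in> F"
    and close: "\<And>x. x \<in> cballd d \<rho> \<Longrightarrow> \<bar>taylor d k f x - taylor d k g x\<bar> \<le> \<epsilon> / 2"
  have interior: "\<bar>f x - g x\<bar> \<le> \<epsilon>" if x: "x \<in> U" for x
  proof -
    have "x \<in> cballd d \<rho>"
      using x K by blast
    then show ?thesis
      using close[of x] global[OF fg(1) x] global[OF fg(2) x] by linarith
  qed
  have "\<bar>f x - g x\<bar> \<le> \<epsilon>" if x: "x \<in> K" for x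
  proof (rule abs_le_of_ray_interior[where F = "\<lambda>x. f x - g x" and K = K and U = U])
    show "continuous_on K (\<lambda>x. f x - g x)"
      using fg by (intro continuous_on_diff cont)
    show "x \<in> Rd d"
      using x K(2) by (auto simp: cballd_def)
  qed (use x K interior star in auto)
  then show "err_sup K f g \<le> ennreal \<epsilon>"
    unfolding err_sup_def by (intro SUP_least ennreal_leI)
qed (use assms in auto)

subsection \<open>The class on the cube\<close>

lemma ocube_iff: "x \<in> ocube d \<longleftrightarrow> x \<in> Rd d \<and> (\<forall>i<d. \<bar>x i\<bar> < 1/2)"
  by (auto simp: ocube_eq_obox obox_iff)

lemma cube_iff: "x \<in> cube d \<longleftrightarrow> x \<in> Rd d \<and> (\<forall>i<d. \<bar>x i\<bar> \<le> 1/2)"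
proof -
  have "x i \<in> {-1/2..1/2} \<longleftrightarrow> \<bar>x i\<bar> \<le> 1/2" for i
    by auto
  then show ?thesis unfolding cube_def Rd_def PiE_iff by blast
qed

lemma ocube_subset_cube: "ocube d \<subseteq> cube d"
  by (force simp: ocube_iff cube_iff intro: less_imp_le)

lemma ray_in_ocube:
  assumes "x \<in> cube d" "0 \<le> t" "t < 1"
  shows "ray d x t \<in> ocube d"
proof -
  have "\<bar>t * x i\<bar> < 1/2" if "i < d" for i
  proof -
    have "t * \<bar>x i\<bar> \<le> t * (1/2)"
      using assms that by (intro mult_left_mono) (auto simp: cube_iff)
    also have "\<dots> < 1/2"
      using assms(3) by simp
    finally show ?thesis using assms(2) by (simp add: abs_mult)
  qed
  then show ?thesis by (simp add: ocube_iff)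
qed

lemma F1_smooth_function: "f \<in> F1 d \<Longrightarrow> smooth_function d (ocube d) (cube d) f"
  by (simp add: F1_def smooth_function_def openin_Rd_ocube ocube_subset_cube)

lemma F1_sum_tcoef_le:
  assumes f: "f \<in> F1 d" and y: "y \<in> ocube d"
  shows "(\<Sum>\<beta>\<in>mindices d k. \<bar>tcoef d f y \<beta>\<bar>) \<le> 1"
proof -
  have "ennreal (\<Sum>\<beta>\<in>mindices d k. \<bar>tcoef d f y \<beta>\<bar>)
      = (\<Sum>\<beta>\<in>mindices d k. ennreal \<bar>Dmulti d \<beta> f y\<bar> / ennreal (mfact d \<beta>))"
    by (simp add: tcoef_def divide_ennreal sum_ennreal less_imp_le)
  also have "\<dots> \<le> (\<Sum>\<beta>\<in>mindices d k. supn (ocube d) (Dmulti d \<beta> f) / ennreal (\<Prod>i<d. fact (\<beta> i)))"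
    unfolding supn_def mfact_def by (intro sum_mono divide_right_mono_ennreal SUP_upper y)
  also have "\<dots> \<le> 1"
    using f by (simp add: F1_def)
  finally show ?thesis by (simp add: sum_nonneg)
qed

lemma F1_remainder_le:
  assumes f: "f \<in> F1 d" and x: "x \<in> ocube d" and k: "k > 0" and b: "b \<ge> 0" "\<And>i. i < d \<Longrightarrow> \<bar>x i\<bar> \<le> b"
  shows "\<bar>f x - taylor d k f x\<bar> \<le> b ^ k"
proof -
  interpret smooth_function d "ocube d" "cube d" f
    by (rule F1_smooth_function[OF f])
  have xR: "x \<in> Rd d" using x by (simp add: ocube_iff)
  have ray: "ray d x t \<in> ocube d" if "0 \<le> t" "t \<le> 1" for t
    using that x ray_in_ocube[of x d t] UK ray_1[OF xR] by (cases "t = 1") auto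
  obtain t where t: "0 < t" "t < 1"
      "f (ray d x 1) - taylor d k f (ray d x 1) = differential d k f (ray d x t) x / fact k * 1 ^ k"
    using taylor_lagrange_remainder[OF zero_less_one k ray] by blast
  let ?c = "tcoef d f (ray d x t)"
  have "\<bar>f x - taylor d k f x\<bar> = \<bar>hform d k ?c x\<bar>"
    using t(3) by (simp add: ray_1[OF xR] differential_def)
  also have "\<dots> \<le> (\<Sum>\<beta>\<in>mindices d k. \<bar>?c \<beta>\<bar> * b ^ k)"
    unfolding hform_def
    by (rule order_trans[OF sum_abs sum_mono])
      (simp add: abs_mult abs_mpow_le[OF _ b(2)] mult_left_mono)
  also have "\<dots> \<le> 1 * b ^ k"
    unfolding sum_distrib_right[symmetric]
    by (rule mult_right_mono[OF F1_sum_tcoef_le[OF f ray]]) (use t b in auto)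
  finally show ?thesis by simp
qed

lemma F1_infc_le:
  assumes \<epsilon>: "\<epsilon> > 0" and k: "k > 0" "(1/2) ^ k \<le> \<epsilon> / 4"
  shows "\<exists>m \<le> (d + 1) ^ (k - 1). infc (cube d) (F1 d) (err_sup (cube d)) \<epsilon> = enat m"
proof (rule infc_err_sup_le[where U = "ocube d" and \<delta> = "1/4" and \<rho> = d and C = 1])
  have small_ball: "x \<in> ocube d" if "x \<in> cballd d (1/4)" for x
    using that abs_le_norm2[of _ d x] by (fastforce simp: cballd_def ocube_iff)
  then show "cballd d (1/4) \<subseteq> cube d"
    using ocube_subset_cube by blast
  show "cube d \<subseteq> cballd d d"
  proof
    fix x assume x: "x \<in> cube d"
    then have "norm2 d x \<le> d * (1/2)"
      by (intro norm2_le_mult_abs_bound) (auto simp: cube_iff)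
    then show "x \<in> cballd d d"
      using x by (simp add: cballd_def cube_iff)
  qed
  show "continuous_on (cube d) f" if "f \<in> F1 d" for f
    using that by (simp add: F1_def smooth_on_def)
  show "\<bar>f x - taylor d k f x\<bar> \<le> 1 * norm2 d x ^ k" if "f \<in> F1 d" "x \<in> cballd d (1/4)" for f x
    using F1_remainder_le[OF that(1) small_ball[OF that(2)] k(1) norm2_nonneg abs_le_norm2] by simp
  show "\<bar>f x - taylor d k f x\<bar> \<le> \<epsilon> / 4" if "f \<in> F1 d" "x \<in> ocube d" for f x
    using F1_remainder_le[OF that k(1), of "1/2"] that(2) k(2) by (fastforce simp: ocube_iff)
  show "ray d x t \<in> ocube d" if "x \<in> cube d" "0 < t" "t < 1" for x t
    using that by (intro ray_in_ocube) auto
qed (use assms ocube_subset_cube in auto)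

subsection \<open>Taylor remainders in the normal direction\<close>

locale smooth_on_ball = smooth_function d "oballd d R" "cballd d R" f for d R f
begin

lemma differential_sproj:
  assumes x: "norm2 d x > 0" and s: "0 < s" "s < R"
  shows "differential d k f (sproj d s x) (\<lambda>i. x i / norm2 d x) = ndiff d k f (sproj d s x)"
proof -
  have norm: "norm2 d (sproj d s x) = s"
    using x s by (simp add: norm2_sproj)
  then have "sproj d s x \<in> oballd d R"
    using s by (simp add: oballd_def)
  then have "ndiff d k f (sproj d s x) = differential d k f (sproj d s x) (\<lambda>i. sproj d s x i / s)"
    using norm by (simp add: ndiff_eq_differential)
  also have "\<dots> = differential d k f (sproj d s x) (\<lambda>i. x i / norm2 d x)"
    by (rule differential_cong) (use s in \<open>simp add: sproj_def\<close>)
  finally show ?thesis by simp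
qed

lemma ray_normal_in_ball:
  assumes "x \<in> pball d R" "0 \<le> t" "t \<le> norm2 d x"
  shows "ray d (\<lambda>i. x i / norm2 d x) t \<in> oballd d R"
  using assms by (simp add: pball_iff oballd_def norm2_sproj flip: sproj_eq_ray)

lemma ray_normal_self: "x \<in> pball d R \<Longrightarrow> ray d (\<lambda>i. x i / norm2 d x) (norm2 d x) = x"
  by (simp add: pball_iff sproj_self flip: sproj_eq_ray)

lemma normal_lagrange_remainder:
  assumes x: "x \<in> pball d R" and k: "k > 0"
  obtains s where "0 < s" "s < norm2 d x"
    "f x - taylor d k f x = ndiff d k f (sproj d s x) / fact k * norm2 d x ^ k"
proof -
  let ?v = "\<lambda>i. x i / norm2 d x"
  have b: "norm2 d x > 0" "norm2 d x < R"
    using x by (auto simp: pball_iff)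
  obtain s where s: "0 < s" "s < norm2 d x"
      "f (ray d ?v (norm2 d x)) - taylor d k f (ray d ?v (norm2 d x))
      = differential d k f (ray d ?v s) ?v / fact k * norm2 d x ^ k"
    using taylor_lagrange_remainder[OF b(1) k ray_normal_in_ball[OF x]] by blast
  then show ?thesis
    using that[OF s(1,2)] b differential_sproj[OF b(1) s(1), of k]
    by (simp add: ray_normal_self[OF x] sproj_eq_ray)
qed

lemma continuous_on_ndiff: "continuous_on (pball d R) (ndiff d k f)"
proof -
  have "continuous_on (pball d R) (\<lambda>y. differential d k f y (\<lambda>i. y i / norm2 d y))"
    unfolding differential_def hform_def tcoef_def mpow_def
    by (intro continuous_intros continuous_on_subset[OF continuous_on_Dmulti pball_subset_oballd]
        continuous_on_coordinate continuous_on_norm2)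
      (auto simp: pball_iff less_imp_neq[OF mfact_pos, symmetric])
  then show ?thesis
    by (rule continuous_on_cong[THEN iffD1, rotated 2])
      (use subsetD[OF pball_subset_oballd] in \<open>auto simp: ndiff_eq_differential\<close>)
qed

end

lemma smooth_on_ballI: "smooth_on d (oballd d R) (cballd d R) f \<Longrightarrow> smooth_on_ball d R f"
  by (simp add: smooth_on_ball_def smooth_function_def openin_Rd_oballd oballd_subset_cballd)

subsection \<open>The uniform class on the ball\<close>

lemma F2_remainder_le:
  assumes f: "f \<in> F2 d R" and x: "x \<in> oballd d R" and k: "k > 0"
  shows "\<bar>f x - taylor d k f x\<bar> \<le> norm2 d x ^ k / fact k"
proof (cases "x = zerod d")
  case True
  then show ?thesis using k by (simp add: taylor_zerod)
next
  case False
  interpret smooth_on_ball d R f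
    using f by (intro smooth_on_ballI) (simp add: F2_def)
  have x: "x \<in> pball d R"
    using x False by (simp add: pball_def)
  obtain s where s: "0 < s" "s < norm2 d x"
      "f x - taylor d k f x = ndiff d k f (sproj d s x) / fact k * norm2 d x ^ k"
    by (rule normal_lagrange_remainder[OF x k])
  have "sproj d s x \<in> oballd d R - {zerod d}"
    using s x pball_iff[of "sproj d s x" d R]
    by (auto simp: pball_iff norm2_sproj simp flip: pball_def)
  then have "ennreal \<bar>ndiff d k f (sproj d s x)\<bar> \<le> supn (oballd d R - {zerod d}) (ndiff d k f)"
    unfolding supn_def by (rule SUP_upper)
  also have "\<dots> \<le> 1"
    using f by (simp add: F2_def)
  finally have "\<bar>ndiff d k f (sproj d s x)\<bar> \<le> 1" by simp
  then show ?thesis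
    unfolding s(3) by (simp add: abs_mult mult_left_le_one_le divide_right_mono)
qed

lemma F2_infc_le:
  assumes R: "R > 0" and \<epsilon>: "\<epsilon> > 0" and k: "k > 0" "R ^ k / fact k \<le> \<epsilon> / 4"
  shows "\<exists>m \<le> (d + 1) ^ (k - 1). infc (cballd d R) (F2 d R) (err_sup (cballd d R)) \<epsilon> = enat m"
proof (rule infc_err_sup_le[where U = "oballd d R" and \<delta> = "R / 2" and \<rho> = R and C = 1])
  show "continuous_on (cballd d R) f" if "f \<in> F2 d R" for f
    using that by (simp add: F2_def smooth_on_def)
  show "\<bar>f x - taylor d k f x\<bar> \<le> 1 * norm2 d x ^ k"
    if f: "f \<in> F2 d R" and x: "x \<in> cballd d (R / 2)" for f x
  proof -
    have "x \<in> oballd d R"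
      using x R by (auto simp: cballd_def oballd_def)
    then have "\<bar>f x - taylor d k f x\<bar> \<le> norm2 d x ^ k / fact k"
      using F2_remainder_le[OF f _ k(1)] by simp
    also have "\<dots> \<le> norm2 d x ^ k / 1"
      by (intro divide_left_mono) auto
    finally show ?thesis by simp
  qed
  show "\<bar>f x - taylor d k f x\<bar> \<le> \<epsilon> / 4" if f: "f \<in> F2 d R" and x: "x \<in> oballd d R" for f x
  proof -
    have "\<bar>f x - taylor d k f x\<bar> \<le> norm2 d x ^ k / fact k"
      by (rule F2_remainder_le[OF f x k(1)])
    also have "\<dots> \<le> R ^ k / fact k"
      using x by (intro divide_right_mono power_mono) (auto simp: oballd_def)
    also note k(2)
    finally show ?thesis .
  qed
  show "ray d x t \<in> oballd d R" if "x \<in> cballd d R" "0 < t" "t < 1" for x t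
  proof -
    have "t * norm2 d x \<le> t * R"
      using that by (simp add: cballd_def)
    also have "\<dots> < R"
      using that R by simp
    finally show ?thesis using that by (simp add: oballd_def)
  qed
qed (use assms oballd_subset_cballd in \<open>auto simp: cballd_def\<close>)

subsection \<open>Balls of unit volume\<close>

lemma emeasure_sphered:
  assumes R: "R > 0"
  shows "emeasure (lebd d) (sphered d R) = 0"
proof -
  obtain v where v: "v > 0" "emeasure (lebd d) (oballd d 1) = ennreal v"
    by (rule oballd_1_volume)
  have shell: "emeasure (lebd d) (sphered d R) \<le> ennreal (((R + e) ^ d - R ^ d) * v)"
    if "e > 0" for e
  proof -
    have "emeasure (lebd d) (sphered d R) \<le> emeasure (lebd d) (oballd d (R + e) - oballd d R)"
      using that by (intro emeasure_mono) (auto simp: sphered_def oballd_def sets_lebd_Collect)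
    also have "\<dots> = ennreal (((R + e) ^ d - R ^ d) * v)"
      using R that v by (simp add: emeasure_oballd_Diff power_mono ennreal_mult)
    finally show ?thesis .
  qed
  have "((\<lambda>e. ennreal (((R + e) ^ d - R ^ d) * v))
      \<longlongrightarrow> ennreal (((R + 0) ^ d - R ^ d) * v)) (at_right 0)"
    by (intro tendsto_intros tendsto_ennrealI)
  then have "emeasure (lebd d) (sphered d R) \<le> ennreal (((R + 0) ^ d - R ^ d) * v)"
    by (rule tendsto_lowerbound) (auto intro!: eventually_at_right_less[THEN eventually_mono] shell)
  then show ?thesis by simp
qed

lemma AE_cballd_in_oballd:
  assumes "R > 0"
  shows "AE x in lebd d. x \<in> cballd d R \<longrightarrow> x \<in> oballd d R"
proof -
  have "AE x in lebd d. x \<notin> sphered d R"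
    by (rule AE_not_in) (simp add: null_sets_def emeasure_sphered[OF assms])
  then show ?thesis
    by eventually_elim (auto simp: cballd_def oballd_def sphered_def)
qed

locale unit_volume_ball =
  fixes d :: nat and R :: real
  assumes d: "d \<ge> 1" and R: "R > 0" and volume: "emeasure (lebd d) (cballd d R) = 1"
begin

lemma emeasure_le_1: "A \<subseteq> cballd d R \<Longrightarrow> emeasure (lebd d) A \<le> 1"
  using emeasure_mono[of A "cballd d R" "lebd d"] volume by simp

lemma radius_le: "R \<le> sqrt d / 2"
proof -
  define a where "a = R / sqrt d"
  have a: "a > 0" using R d by (simp add: a_def)
  have "obox d (zerod d) a \<subseteq> cballd d R"
  proof
    fix x assume x: "x \<in> obox d (zerod d) a"
    have "(\<Sum>i<d. (x i)\<^sup>2) \<le> (\<Sum>i<d. a\<^sup>2)"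
      using x
      by (intro sum_mono) (auto simp: obox_iff abs_le_square_iff[symmetric] intro: less_imp_le)
    also have "\<dots> = R\<^sup>2"
      using d by (simp add: a_def power_divide)
    finally have "norm2 d x \<le> R"
      unfolding norm2_def using R by (intro real_le_lsqrt) auto
    then show "x \<in> cballd d R"
      using x by (simp add: cballd_def obox_iff)
  qed
  then have "emeasure (lebd d) (obox d (zerod d) a) \<le> 1"
    by (rule emeasure_le_1)
  then have "(2 * a) ^ d \<le> 1"
    using a by (simp add: emeasure_lebd_obox flip: ennreal_1)
  then have "2 * a \<le> 1"
    using d a power_le_one_iff[of "2 * a" d] by simp
  then show ?thesis
    using d by (simp add: a_def field_simps)
qed

end

subsection \<open>The integral norm on balls\<close>

definition ball_L1 :: "nat \<Rightarrow> real \<Rightarrow> ((nat \<Rightarrow> real) \<Rightarrow> real) \<Rightarrow> ennreal" where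
  "ball_L1 d R g = (\<integral>\<^sup>+x\<in>oballd d R. ennreal \<bar>g x\<bar> \<partial>lebd d)"

lemma borel_measurable_ball_integrand:
  assumes "continuous_on (oballd d R) g"
  shows "(\<lambda>x. ennreal \<bar>g x\<bar> * indicator (oballd d R) x) \<in> borel_measurable (lebd d)"
proof -
  have "(\<lambda>x. ennreal \<bar>indicator (oballd d R) x * g x\<bar>) \<in> borel_measurable (lebd d)"
    using borel_measurable_continuous_on_lebd[OF oballd_sets assms] by measurable
  moreover have "ennreal \<bar>indicator (oballd d R) x * g x\<bar>
      = ennreal \<bar>g x\<bar> * indicator (oballd d R) x"
    for x
    by (simp add: indicator_def)
  ultimately show ?thesis by simp
qed

lemma ball_L1_diff_le:
  assumes "continuous_on (oballd d R) u" "continuous_on (oballd d R) v"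
  shows "ball_L1 d R (\<lambda>x. u x - v x) \<le> ball_L1 d R u + ball_L1 d R v"
proof -
  have "ball_L1 d R (\<lambda>x. u x - v x)
      \<le> (\<integral>\<^sup>+x. ennreal \<bar>u x\<bar> * indicator (oballd d R) x
          + ennreal \<bar>v x\<bar> * indicator (oballd d R) x \<partial>lebd d)"
    unfolding ball_L1_def
    by (intro nn_integral_mono)
      (auto simp: indicator_def intro!: ennreal_leI simp flip: ennreal_plus)
  also have "\<dots> = ball_L1 d R u + ball_L1 d R v"
    unfolding ball_L1_def using assms by (intro nn_integral_add borel_measurable_ball_integrand)
  finally show ?thesis .
qed

lemma continuous_le_if_excess_small:
  fixes F G :: "(nat \<Rightarrow> real) \<Rightarrow> real"
  assumes U: "openin (top_of_set (Rd d)) U" and F: "continuous_on U F" and G: "continuous_on U G"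
    and excess: "\<And>e. e > 0 \<Longrightarrow>
      \<exists>w. (\<forall>y\<in>U. F y \<le> G y + \<bar>w y\<bar>) \<and> (\<integral>\<^sup>+y\<in>U. ennreal \<bar>w y\<bar> \<partial>lebd d) < ennreal e"
    and x: "x \<in> U"
  shows "F x \<le> G x"
proof (rule ccontr)
  assume "\<not> F x \<le> G x"
  define a where "a = (F x - G x) / 2"
  have a: "a > 0" using \<open>\<not> F x \<le> G x\<close> by (simp add: a_def)
  have UR: "U \<subseteq> Rd d" by (rule openin_imp_subset[OF U])
  obtain r1 where r1: "r1 > 0" "\<And>y. y \<in> obox d x r1 \<inter> U \<Longrightarrow> \<bar>(F y - G y) - (F x - G x)\<bar> < a"
    using continuous_on_Rd_obox[OF continuous_on_diff[OF F G] UR x a] by metis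
  obtain r2 where r2: "r2 > 0" "obox d x r2 \<subseteq> U"
    by (rule openin_Rd_E[OF U x])
  define r where "r = min r1 r2"
  have r: "r > 0" "obox d x r \<subseteq> obox d x r1" "obox d x r \<subseteq> U"
    using r1(1) r2 obox_mono[of r r1 d x] obox_mono[of r r2 d x] by (auto simp: r_def)
  have gap: "a \<le> F y - G y" if "y \<in> obox d x r" for y
  proof -
    have "\<bar>(F y - G y) - (F x - G x)\<bar> < a"
      using that r by (intro r1(2)) auto
    moreover have "F x - G x = 2 * a" by (simp add: a_def)
    ultimately show ?thesis by linarith
  qed
  have "a * (2 * r) ^ d > 0" using a r by simp
  then obtain w where w: "\<And>y. y \<in> U \<Longrightarrow> F y \<le> G y + \<bar>w y\<bar>"
      "(\<integral>\<^sup>+y\<in>U. ennreal \<bar>w y\<bar> \<partial>lebd d) < ennreal (a * (2 * r) ^ d)"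
    using excess by blast
  have "ennreal (a * (2 * r) ^ d) = (\<integral>\<^sup>+y\<in>obox d x r. ennreal a \<partial>lebd d)"
    using a r by (simp add: nn_integral_cmult_indicator emeasure_lebd_obox ennreal_mult)
  also have "\<dots> \<le> (\<integral>\<^sup>+y\<in>U. ennreal \<bar>w y\<bar> \<partial>lebd d)"
  proof (rule nn_integral_mono)
    fix y
    have "ennreal a \<le> ennreal \<bar>w y\<bar>" if "y \<in> obox d x r"
      using gap[OF that] w(1)[of y] r(3) that by (intro ennreal_leI) auto
    then show "ennreal a * indicator (obox d x r) y \<le> ennreal \<bar>w y\<bar> * indicator U y"
      using r(3) by (auto simp: indicator_def)
  qed
  finally show False using w(2) by simp
qed

subsection \<open>Finite differences of forms\<close>

lemma degree_difference_less:
  fixes p :: "real poly"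
  assumes "degree p > 0"
  shows "degree (p - pcompose p [:1, 1:]) < degree p"
proof (cases "p - pcompose p [:1, 1:] = 0")
  case False
  then show ?thesis
  proof (rule degree_less_if_less_eqI[rotated 2])
    show "degree (p - pcompose p [:1, 1:]) \<le> degree p"
      by (rule degree_diff_le) (auto simp: degree_pcompose)
    have "coeff (pcompose p [:1, 1:]) (degree p) = lead_coeff (pcompose p [:1, 1:])"
      by (simp add: degree_pcompose)
    also have "\<dots> = lead_coeff p"
      by (subst lead_coeff_comp) auto
    finally show "coeff (p - pcompose p [:1, 1:]) (degree p) = 0" by simp
  qed
qed (use assms in simp)

lemma alternating_binomial_Suc:
  fixes \<phi> :: "nat \<Rightarrow> real"
  shows "(\<Sum>i\<le>Suc n. (-1) ^ i * real (Suc n choose i) * \<phi> i)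
    = (\<Sum>i\<le>n. (-1) ^ i * real (n choose i) * (\<phi> i - \<phi> (Suc i)))"
proof -
  let ?a = "\<lambda>n i. (-1) ^ i * real (n choose i)"
  have "(\<Sum>i\<le>n. ?a n i * \<phi> i) = (\<Sum>i\<le>Suc n. ?a n i * \<phi> i)"
    by simp
  also have "\<dots> = \<phi> 0 + (\<Sum>i\<le>n. ?a n (Suc i) * \<phi> (Suc i))"
    by (subst sum.atMost_Suc_shift) simp
  finally have shift: "(\<Sum>i\<le>n. ?a n i * \<phi> i) = \<phi> 0 + (\<Sum>i\<le>n. ?a n (Suc i) * \<phi> (Suc i))" .
  have "(\<Sum>i\<le>Suc n. ?a (Suc n) i * \<phi> i) = \<phi> 0 + (\<Sum>i\<le>n. ?a (Suc n) (Suc i) * \<phi> (Suc i))"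
    by (subst sum.atMost_Suc_shift) simp
  also have "(\<Sum>i\<le>n. ?a (Suc n) (Suc i) * \<phi> (Suc i))
      = (\<Sum>i\<le>n. ?a n (Suc i) * \<phi> (Suc i)) - (\<Sum>i\<le>n. ?a n i * \<phi> (Suc i))"
    unfolding sum_subtractf[symmetric] by (intro sum.cong) (auto simp: algebra_simps)
  finally show ?thesis
    using shift by (simp add: right_diff_distrib sum_subtractf)
qed

lemma alternating_binomial_poly:
  fixes p :: "real poly"
  assumes "degree p < n"
  shows "(\<Sum>i\<le>n. (-1) ^ i * real (n choose i) * poly p (real i)) = 0"
  using assms
proof (induction n arbitrary: p)
  case (Suc n)
  let ?q = "p - pcompose p [:1, 1:]"
  have difference: "poly p (real i) - poly p (real (Suc i)) = poly ?q (real i)" for i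
    by (simp add: poly_pcompose add.commute)
  have "(\<Sum>i\<le>n. (-1) ^ i * real (n choose i) * poly ?q (real i)) = 0"
  proof (cases "degree p")
    case 0
    then have "?q = 0" by (auto elim!: degree_eq_zeroE)
    then show ?thesis by simp
  next
    case (Suc m)
    then show ?thesis
      using degree_difference_less[of p] Suc.prems by (intro Suc.IH) simp
  qed
  then show ?case
    unfolding alternating_binomial_Suc[of _ "\<lambda>i. poly p (real i)"] difference .
qed simp

lemma hform_line_poly:
  obtains p where "degree p \<le> k" "\<And>t. poly p t = hform d k c (line d x u t)"
proof -
  define P where "P \<beta> = (\<Prod>i<d. [:x i, u i:] ^ \<beta> i)" for \<beta> :: "nat \<Rightarrow> nat"
  have deg: "degree (P \<beta>) \<le> k" if "\<beta> \<in> mindices d k" for \<beta>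
  proof -
    have "degree (P \<beta>) \<le> (\<Sum>i<d. degree ([:x i, u i:] ^ \<beta> i))"
      unfolding P_def using degree_prod_sum_le[of "{..<d}" "\<lambda>i. [:x i, u i:] ^ \<beta> i"] by simp
    also have "\<dots> \<le> (\<Sum>i<d. \<beta> i)"
    proof (rule sum_mono)
      fix i
      have "degree ([:x i, u i:] ^ \<beta> i) \<le> degree [:x i, u i:] * \<beta> i"
        by (rule degree_power_le)
      also have "\<dots> \<le> 1 * \<beta> i"
        by (rule mult_right_mono) auto
      finally show "degree ([:x i, u i:] ^ \<beta> i) \<le> \<beta> i" by simp
    qed
    finally show ?thesis
      using that by (simp add: mindices_def)
  qed
  have "poly (P \<beta>) t = mpow d (line d x u t) \<beta>" for \<beta> t
    unfolding P_def mpow_def poly_prod by (intro prod.cong) auto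
  then have "poly (\<Sum>\<beta>\<in>mindices d k. smult (c \<beta>) (P \<beta>)) t = hform d k c (line d x u t)" for t
    by (simp add: poly_sum hform_def)
  moreover have "degree (\<Sum>\<beta>\<in>mindices d k. smult (c \<beta>) (P \<beta>)) \<le> k"
    by (intro degree_sum_le) (auto intro: deg)
  ultimately show ?thesis using that by blast
qed

lemma abs_hform_le_differences:
  assumes x: "x \<in> Rd d"
  shows "\<bar>hform d k c x\<bar>
      \<le> (\<Sum>i=1..Suc k. real (Suc k choose i) * \<bar>hform d k c (line d x u (real i))\<bar>)"
proof -
  obtain p where p: "degree p \<le> k" "\<And>t. poly p t = hform d k c (line d x u t)"
    using hform_line_poly[of k d c x u] by blast
  let ?g = "\<lambda>i. (-1) ^ i * real (Suc k choose i) * poly p (real i)"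
  have "(\<Sum>i\<le>Suc k. ?g i) = 0"
    using p(1) by (intro alternating_binomial_poly) simp
  moreover have "{..Suc k} = insert 0 {1..Suc k}" by auto
  ultimately have "poly p 0 = - (\<Sum>i=1..Suc k. ?g i)" by simp
  also have "\<bar>\<dots>\<bar> \<le> (\<Sum>i=1..Suc k. \<bar>?g i\<bar>)"
    unfolding abs_minus_cancel by (rule sum_abs)
  also have "\<dots> = (\<Sum>i=1..Suc k. real (Suc k choose i) * \<bar>hform d k c (line d x u (real i))\<bar>)"
    by (simp add: abs_mult p(2))
  finally show ?thesis
    using line_0[OF x, of u] by (simp add: p(2))
qed

lemma nn_integral_box_line_le_ball_L1:
  fixes q :: "(nat \<Rightarrow> real) \<Rightarrow> real"
  assumes q [measurable]: "q \<in> borel_measurable (lebd d)" and "t \<ge> 1"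
    and ball: "\<And>u. u \<in> Q \<Longrightarrow> line d x u t \<in> oballd d r"
  shows "(\<integral>\<^sup>+u\<in>Q. ennreal \<bar>q (line d x u t)\<bar> \<partial>lebd d) \<le> ball_L1 d r q"
proof -
  define g where "g y = ennreal \<bar>q y\<bar> * indicator (oballd d r) y" for y
  have "g \<in> borel_measurable (lebd d)"
    unfolding g_def by measurable
  have "(\<integral>\<^sup>+u\<in>Q. ennreal \<bar>q (line d x u t)\<bar> \<partial>lebd d) \<le> 1 * (\<integral>\<^sup>+u. g (line d x u t) \<partial>lebd d)"
    unfolding mult_1 by (intro nn_integral_mono) (use ball in \<open>auto simp: g_def indicator_def\<close>)
  also have "\<dots> \<le> ennreal (\<bar>t\<bar> ^ d) * (\<integral>\<^sup>+u. g (line d x u t) \<partial>lebd d)"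
    by (rule mult_right_mono) (use \<open>t \<ge> 1\<close> in \<open>auto simp: one_le_power\<close>)
  also have "\<dots> = ball_L1 d r q"
    using nn_integral_lebd_affine[OF \<open>g \<in> borel_measurable (lebd d)\<close>, of t x] \<open>t \<ge> 1\<close>
    by (simp add: ball_L1_def g_def)
  finally show ?thesis .
qed

lemma line_in_oballd:
  assumes "d \<ge> 1" "r > 0" and x: "x \<in> cballd d (r / 2)" and t: "0 \<le> t" "t \<le> real k + 1"
    and u: "u \<in> obox d (zerod d) (r / (4 * (real k + 1) * d))"
  shows "line d x u t \<in> oballd d r"
proof -
  have "norm2 d u \<le> d * (r / (4 * (real k + 1) * d))"
    using subsetD[OF obox_zerod_subset_cballd u] by (simp add: cballd_def)
  then have "norm2 d u \<le> r / (4 * (real k + 1))"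
    using \<open>d \<ge> 1\<close> by simp
  then have "t * norm2 d u \<le> (real k + 1) * (r / (4 * (real k + 1)))"
    using t by (intro mult_mono) auto
  also have "\<dots> = r / 4"
    using of_nat_0_le_iff[of k, where 'a = real] by (simp add: field_simps)
  finally have "norm2 d (\<lambda>i. t * u i) \<le> r / 4"
    using t norm2_scale[of d "\<lambda>i. t * u i" t u] by simp
  moreover have "norm2 d (line d x u t) \<le> norm2 d x + norm2 d (\<lambda>i. t * u i)"
    using norm2_triangle[of d x "\<lambda>i. t * u i"]
    by (simp add: norm2_cong[of d "line d x u t" "\<lambda>i. x i + t * u i"])
  ultimately show ?thesis
    using x \<open>r > 0\<close> by (simp add: oballd_def cballd_def)
qed

lemma hform_le_ball_L1:
  fixes k :: nat
  assumes d: "d \<ge> 1" and r: "r > 0" and x: "x \<in> cballd d (r / 2)"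
  defines "\<eta> \<equiv> r / (4 * (real k + 1) * d)"
  shows "ennreal ((2 * \<eta>) ^ d * \<bar>hform d k c x\<bar>) \<le> 2 ^ Suc k * ball_L1 d r (hform d k c)"
proof -
  let ?q = "hform d k c" and ?Q = "obox d (zerod d) \<eta>"
  let ?b = "\<lambda>i. ennreal (real (Suc k choose i))"
  have \<eta>: "\<eta> > 0" using d r by (simp add: \<eta>_def)
  have [measurable]: "(\<lambda>u. ?q (line d x u t)) \<in> borel_measurable (lebd d)" for t
    by (rule measurable_compose[OF line_measurable hform_measurable])
  have difference: "ennreal \<bar>?q x\<bar> \<le> (\<Sum>i=1..Suc k. ?b i * ennreal \<bar>?q (line d x u (real i))\<bar>)" for u
  proof -
    have "ennreal \<bar>?q x\<bar>
        \<le> ennreal (\<Sum>i=1..Suc k. real (Suc k choose i) * \<bar>?q (line d x u (real i))\<bar>)"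
      using x by (intro ennreal_leI abs_hform_le_differences) (simp add: cballd_def)
    then show ?thesis
      by (subst (asm) sum_ennreal[symmetric]) (auto simp: ennreal_mult simp del: binomial_Suc_Suc)
  qed
  have "ennreal ((2 * \<eta>) ^ d * \<bar>?q x\<bar>) = (\<integral>\<^sup>+u\<in>?Q. ennreal \<bar>?q x\<bar> \<partial>lebd d)"
    using \<eta> by (simp add: nn_integral_cmult_indicator emeasure_lebd_obox ennreal_mult mult.commute)
  also have "\<dots> \<le>
      (\<integral>\<^sup>+u. (\<Sum>i=1..Suc k. ?b i * (ennreal \<bar>?q (line d x u (real i))\<bar> * indicator ?Q u)) \<partial>lebd d)"
    unfolding mult.assoc[symmetric] sum_distrib_right[symmetric]
    by (intro nn_integral_mono mult_right_mono difference) simp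
  also have "\<dots> = (\<Sum>i=1..Suc k. ?b i * (\<integral>\<^sup>+u\<in>?Q. ennreal \<bar>?q (line d x u (real i))\<bar> \<partial>lebd d))"
    by (subst nn_integral_sum) (auto intro!: sum.cong nn_integral_cmult)
  also have "\<dots> \<le> (\<Sum>i=1..Suc k. ?b i * ball_L1 d r ?q)"
    by (intro sum_mono mult_left_mono nn_integral_box_line_le_ball_L1 hform_measurable
        line_in_oballd[OF d r x])
      (auto simp: \<eta>_def)
  also have "\<dots> \<le> (\<Sum>i\<le>Suc k. ?b i * ball_L1 d r ?q)"
    by (rule sum_mono2) auto
  also have "\<dots> = 2 ^ Suc k * ball_L1 d r ?q"
  proof -
    have "(\<Sum>i\<le>Suc k. ?b i) = of_nat (\<Sum>i\<le>Suc k. Suc k choose i)"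
      by (simp add: ennreal_of_nat_eq_real_of_nat del: binomial_Suc_Suc sum.atMost_Suc)
    then show ?thesis
      by (simp only: sum_distrib_right[symmetric] choose_row_sum of_nat_power of_nat_numeral)
  qed
  finally show ?thesis .
qed

lemma abs_hform_le_if_le_on_sphere:
  assumes \<rho>: "\<rho> > 0" and k: "k > 0" and x: "x \<in> Rd d"
    and M: "\<And>y. y \<in> sphered d \<rho> \<Longrightarrow> \<bar>hform d k c y\<bar> \<le> M"
  shows "\<bar>hform d k c x\<bar> \<le> M * (norm2 d x / \<rho>) ^ k"
proof (cases "x = zerod d")
  case True
  then show ?thesis using k by (simp add: hform_zerod power_0_left)
next
  case False
  then have x0: "norm2 d x > 0" using norm2_pos_iff[OF x] by simp
  define y where "y = ray d x (\<rho> / norm2 d x)"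
  have "y \<in> sphered d \<rho>"
    using x0 \<rho> by (simp add: y_def sphered_def)
  moreover have "hform d k c x = (norm2 d x / \<rho>) ^ k * hform d k c y"
    by (rule hform_scale) (use x0 \<rho> in \<open>simp add: y_def\<close>)
  ultimately show ?thesis
    using M[of y] \<rho> by (simp add: abs_mult mult.commute[of M] mult_left_mono)
qed

subsection \<open>Integration along rays\<close>

lemma abs_integral_le_nn_integral:
  fixes h :: "real \<Rightarrow> real"
  assumes "continuous_on {a..b} h"
  shows "ennreal \<bar>integral {a..b} h\<bar> \<le> (\<integral>\<^sup>+s\<in>{a..b}. ennreal \<bar>h s\<bar> \<partial>lborel)"
proof -
  have h: "set_integrable lborel {a..b} h"
    by (rule borel_integrable_atLeastAtMost'[OF assms])
  have "ennreal \<bar>integral {a..b} h\<bar> = ennreal (norm (LINT s|lborel. indicator {a..b} s *\<^sub>R h s))"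
    using set_borel_integral_eq_integral(2)[OF h] by (simp add: set_lebesgue_integral_def)
  also have "\<dots> \<le> (\<integral>\<^sup>+s. norm (indicator {a..b} s *\<^sub>R h s) \<partial>lborel)"
    using h unfolding set_integrable_def by (rule integral_norm_bound_ennreal)
  also have "\<dots> = (\<integral>\<^sup>+s\<in>{a..b}. ennreal \<bar>h s\<bar> \<partial>lborel)"
    by (intro nn_integral_cong) (simp add: indicator_def)
  finally show ?thesis .
qed

lemma abs_integral_weighted_le_nn_integral:
  fixes w h :: "real \<Rightarrow> real"
  assumes w: "continuous_on {a..b} w" "\<And>s. s \<in> {a..b} \<Longrightarrow> \<bar>w s\<bar> \<le> C" and h: "continuous_on {a..b} h"
    and C: "C \<ge> 0"
  shows "ennreal \<bar>integral {a..b} (\<lambda>s. w s * h s)\<bar>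
    \<le> ennreal C * (\<integral>\<^sup>+s\<in>{a..b}. ennreal \<bar>h s\<bar> \<partial>lborel)"
proof -
  have "ennreal \<bar>integral {a..b} (\<lambda>s. w s * h s)\<bar> \<le> (\<integral>\<^sup>+s\<in>{a..b}. ennreal \<bar>w s * h s\<bar> \<partial>lborel)"
    by (intro abs_integral_le_nn_integral continuous_on_mult w(1) h)
  also have "\<dots> \<le> (\<integral>\<^sup>+s. ennreal C * ennreal \<bar>indicator {a..b} s * h s\<bar> \<partial>lborel)"
    using C w(2)
    by (intro nn_integral_mono)
      (auto simp: indicator_def abs_mult simp flip: ennreal_mult
        intro!: ennreal_leI mult_right_mono)
  also have "\<dots> = ennreal C * (\<integral>\<^sup>+s. ennreal \<bar>indicator {a..b} s * h s\<bar> \<partial>lborel)"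
  proof (rule nn_integral_cmult)
    show "(\<lambda>s. ennreal \<bar>indicator {a..b} s * h s\<bar>) \<in> borel_measurable lborel"
      using borel_measurable_continuous_on_indicator[OF _ h]
      by (intro measurable_compose[OF borel_measurable_abs measurable_ennreal]) simp
  qed
  also have "(\<integral>\<^sup>+s. ennreal \<bar>indicator {a..b} s * h s\<bar> \<partial>lborel)
      = (\<integral>\<^sup>+s\<in>{a..b}. ennreal \<bar>h s\<bar> \<partial>lborel)"
    by (intro nn_integral_cong) (simp add: indicator_def)
  finally show ?thesis .
qed

definition ray_L1 :: "nat \<Rightarrow> real \<Rightarrow> ((nat \<Rightarrow> real) \<Rightarrow> real) \<Rightarrow> (nat \<Rightarrow> real) \<Rightarrow> ennreal" where
  "ray_L1 d R g x = (\<integral>\<^sup>+s\<in>{0<..<R}. ennreal \<bar>g (sproj d s x)\<bar> \<partial>lborel)"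

lemma ray_integrand_measurable:
  assumes g: "continuous_on (pball d R) g"
  shows "(\<lambda>(s, x). ennreal \<bar>g (sproj d s x)\<bar> * indicator {0<..<R} s * indicator (pball d R) x)
    \<in> borel_measurable (lborel \<Otimes>\<^sub>M lebd d)"
proof -
  define N where "N y = indicator (pball d R) y * g y" for y
  have N: "N \<in> borel_measurable (lebd d)"
    unfolding N_def by (rule borel_measurable_continuous_on_lebd[OF pball_sets g])
  have "(\<lambda>(s, x). sproj d s x) \<in> measurable (lborel \<Otimes>\<^sub>M lebd d) (lebd d)"
    using sproj_measurable_pair[of d] by (simp cong: measurable_cong_sets)
  from measurable_compose[OF this N]
  have [measurable]: "(\<lambda>p. N (sproj d (fst p) (snd p))) \<in> borel_measurable (lborel \<Otimes>\<^sub>M lebd d)"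
    by (simp add: split_def)
  have "(\<lambda>p. ennreal \<bar>N (sproj d (fst p) (snd p))\<bar> * indicator {0<..<R} (fst p)
        * indicator (pball d R) (snd p))
      \<in> borel_measurable (lborel \<Otimes>\<^sub>M lebd d)"
    by measurable
  moreover have "ennreal \<bar>N (sproj d s x)\<bar> * indicator {0<..<R} s * indicator (pball d R) x
      = ennreal \<bar>g (sproj d s x)\<bar> * indicator {0<..<R} s * indicator (pball d R) x" for s x
    by (auto simp: N_def indicator_def pball_iff norm2_sproj)
  ultimately show ?thesis by (simp add: split_def)
qed

lemma ray_L1_indicator:
  "ray_L1 d R g x * indicator A x
      = (\<integral>\<^sup>+s. ennreal \<bar>g (sproj d s x)\<bar> * indicator {0<..<R} s * indicator A x \<partial>lborel)"
  by (simp add: ray_L1_def indicator_def)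

lemma ray_L1_measurable:
  assumes "continuous_on (pball d R) g"
  shows "(\<lambda>x. ray_L1 d R g x * indicator (pball d R) x) \<in> borel_measurable (lebd d)"
  unfolding ray_L1_indicator
  using measurable_pair_swap[OF ray_integrand_measurable[OF assms]]
  by (intro lborel.borel_measurable_nn_integral) (simp add: split_def)

lemma nn_integral_ray_L1_le:
  assumes d: "d \<ge> 1" and g: "continuous_on (pball d R) g"
    and finite: "emeasure (lebd d) (pball d R) \<noteq> \<infinity>"
  shows "(\<integral>\<^sup>+x\<in>pball d R. ray_L1 d R g x \<partial>lebd d)
    \<le> (\<integral>\<^sup>+s\<in>{0<..<R}. emeasure (lebd d) (pball d R) * sph_avg d g s \<partial>lborel)"
proof -
  interpret sigma_finite_measure "lebd d" by (rule sigma_finite_lebd)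
  interpret pair_sigma_finite lborel "lebd d" ..
  let ?G = "\<lambda>s x. ennreal \<bar>g (sproj d s x)\<bar> * indicator {0<..<R} s * indicator (pball d R) x"
  have "(\<integral>\<^sup>+x\<in>pball d R. ray_L1 d R g x \<partial>lebd d) = (\<integral>\<^sup>+s. (\<integral>\<^sup>+x. ?G s x \<partial>lebd d) \<partial>lborel)"
    unfolding ray_L1_indicator by (rule Fubini'[OF ray_integrand_measurable[OF g]])
  also have "\<dots> \<le> (\<integral>\<^sup>+s\<in>{0<..<R}. emeasure (lebd d) (pball d R) * sph_avg d g s \<partial>lborel)"
  proof (rule nn_integral_mono)
    fix s :: real
    show "(\<integral>\<^sup>+x. ?G s x \<partial>lebd d)
        \<le> emeasure (lebd d) (pball d R) * sph_avg d g s * indicator {0<..<R} s"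
    proof (cases "s \<in> {0<..<R}")
      case True
      then have "sphered d s \<subseteq> pball d R"
        by (auto simp: sphered_def pball_iff)
      then have "continuous_on (sphered d s) g"
        by (rule continuous_on_subset[OF g])
      then show ?thesis
        using True nn_integral_directions_le_sph_avg[OF d _ _ finite, of s g] by simp
    qed simp
  qed
  finally show ?thesis .
qed

lemma (in smooth_on_ball) remainder_le_ray_L1:
  assumes x: "x \<in> pball d R" and k: "k > 0"
  shows "ennreal \<bar>f x - taylor d k f x\<bar>
      \<le> ennreal (R ^ (k - 1) / fact (k - 1)) * ray_L1 d R (ndiff d k f) x"
proof -
  let ?v = "\<lambda>i. x i / norm2 d x" and ?b = "norm2 d x" and ?C = "R ^ (k - 1) / fact (k - 1)"
  define D where "D s = differential d k f (ray d ?v s) ?v" for s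
  define w where "w s = (?b - s) ^ (k - 1) / fact (k - 1)" for s
  have b: "0 < ?b" "?b < R"
    using x by (auto simp: pball_iff)
  have "f x - taylor d k f x = integral {0..?b} (\<lambda>s. w s * D s)"
    using taylor_integral_remainder[OF b(1) k ray_normal_in_ball[OF x]]
    by (simp only: ray_normal_self[OF x] w_def D_def)
  also have "ennreal \<bar>\<dots>\<bar> \<le> ennreal ?C * (\<integral>\<^sup>+s\<in>{0..?b}. ennreal \<bar>D s\<bar> \<partial>lborel)"
  proof (rule abs_integral_weighted_le_nn_integral)
    show "continuous_on {0..?b} w"
      unfolding w_def by (intro continuous_intros) auto
    show "continuous_on {0..?b} D"
      unfolding D_def by (intro continuous_on_differential_ray ray_normal_in_ball[OF x]) auto
    show "\<bar>w s\<bar> \<le> ?C" if "s \<in> {0..?b}" for s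
      using that b by (auto simp: w_def intro!: divide_right_mono power_mono)
  qed (use b in auto)
  also have "(\<integral>\<^sup>+s\<in>{0..?b}. ennreal \<bar>D s\<bar> \<partial>lborel) \<le> ray_L1 d R (ndiff d k f) x"
    unfolding ray_L1_def
  proof (rule nn_integral_mono_AE)
    show "AE s in lborel. ennreal \<bar>D s\<bar> * indicator {0..?b} s
        \<le> ennreal \<bar>ndiff d k f (sproj d s x)\<bar> * indicator {0<..<R} s"
      using AE_lborel_singleton[of "0::real"]
    proof eventually_elim
      case (elim s)
      then show ?case
        using b differential_sproj[OF b(1), of s k] by (auto simp: D_def indicator_def sproj_eq_ray)
    qed
  qed
  finally show ?thesis by (simp add: mult_left_mono)
qed

subsection \<open>The integral class on the ball\<close>

lemma F3_smooth_on_ball: "f \<in> F3 d R \<Longrightarrow> smooth_on_ball d R f"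
  by (intro smooth_on_ballI) (simp add: F3_def)

context unit_volume_ball
begin

lemma F3_remainder_L1:
  assumes f: "f \<in> F3 d R" and k: "k > 0"
  shows "ball_L1 d R (\<lambda>x. f x - taylor d k f x) \<le> ennreal (R ^ (k - 1) / fact (k - 1))"
proof -
  interpret smooth_on_ball d R f by (rule F3_smooth_on_ball[OF f])
  let ?c = "ennreal (R ^ (k - 1) / fact (k - 1))" and ?g = "ndiff d k f"
  have "pball d R \<subseteq> cballd d R"
    using pball_subset_oballd oballd_subset_cballd by blast
  then have vol: "emeasure (lebd d) (pball d R) \<le> 1"
    by (rule emeasure_le_1)
  have "ball_L1 d R (\<lambda>x. f x - taylor d k f x)
      \<le> (\<integral>\<^sup>+x. ?c * (ray_L1 d R ?g x * indicator (pball d R) x) \<partial>lebd d)"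
    unfolding ball_L1_def
  proof (rule nn_integral_mono)
    fix x
    show "ennreal \<bar>f x - taylor d k f x\<bar> * indicator (oballd d R) x
        \<le> ?c * (ray_L1 d R ?g x * indicator (pball d R) x)"
      using remainder_le_ray_L1[OF _ k, of x] taylor_zerod[OF k, of d f]
      by (cases "x = zerod d") (auto simp: pball_def indicator_def)
  qed
  also have "\<dots> = ?c * (\<integral>\<^sup>+x\<in>pball d R. ray_L1 d R ?g x \<partial>lebd d)"
    by (rule nn_integral_cmult[OF ray_L1_measurable[OF continuous_on_ndiff]])
  also have "\<dots> \<le> ?c * (\<integral>\<^sup>+s\<in>{0<..<R}. emeasure (lebd d) (pball d R) * sph_avg d ?g s \<partial>lborel)"
    using vol
    by (intro mult_left_mono nn_integral_ray_L1_le[OF d continuous_on_ndiff])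
      (auto simp: top_unique)
  also have "\<dots> \<le> ?c * (\<integral>\<^sup>+s\<in>{0<..<R}. 1 * sph_avg d ?g s \<partial>lborel)"
    by (intro mult_left_mono nn_integral_mono mult_right_mono vol) auto
  also have "\<dots> \<le> ?c * 1"
    using f by (intro mult_left_mono) (auto simp: F3_def)
  finally show ?thesis by simp
qed

lemma F3_hform_L1:
  assumes f: "f \<in> F3 d R" and j: "j > 0"
  shows "ball_L1 d R (hform d j (tcoef d f (zerod d))) \<le> ennreal (2 * max 1 R ^ j)"
proof -
  interpret smooth_on_ball d R f by (rule F3_smooth_on_ball[OF f])
  let ?r = "\<lambda>k x. f x - taylor d k f x"
  have bound: "R ^ n / fact n \<le> max 1 R ^ j" if "n \<le> j" for n
  proof -
    have "R ^ n / fact n \<le> R ^ n / 1"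
      using R by (intro divide_left_mono) auto
    also have "\<dots> \<le> max 1 R ^ n"
      using R by (simp add: power_mono)
    also have "\<dots> \<le> max 1 R ^ j"
      by (rule power_increasing[OF that]) simp
    finally show ?thesis .
  qed
  have r: "continuous_on (oballd d R) (?r k)" for k
    by (intro continuous_on_diff continuous_on_interior continuous_on_mpoly)
  have "ball_L1 d R (hform d j (tcoef d f (zerod d))) = ball_L1 d R (\<lambda>x. ?r j x - ?r (Suc j) x)"
    by (simp add: mpoly_Suc)
  also have "\<dots> \<le> ball_L1 d R (?r j) + ball_L1 d R (?r (Suc j))"
    by (rule ball_L1_diff_le[OF r r])
  also have "\<dots>
      \<le> ennreal (R ^ (j - 1) / fact (j - 1)) + ennreal (R ^ (Suc j - 1) / fact (Suc j - 1))"
    using j by (intro add_mono F3_remainder_L1[OF f]) auto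
  also have "\<dots> \<le> ennreal (max 1 R ^ j) + ennreal (max 1 R ^ j)"
    by (intro add_mono ennreal_leI bound) auto
  also have "\<dots> = ennreal (2 * max 1 R ^ j)"
    by (simp flip: ennreal_plus)
  finally show ?thesis .
qed

lemma F3_abs_hform_le_half_ball:
  assumes f: "f \<in> F3 d R" and j: "j > 0" and y: "y \<in> cballd d (R / 2)"
  shows "\<bar>hform d j (tcoef d f (zerod d)) y\<bar> \<le> 4 * (2 * real d / R) ^ d * (2 * max 1 R * 2 ^ d) ^ j"
proof -
  let ?q = "hform d j (tcoef d f (zerod d))" and ?C = "2 ^ Suc j * (2 * max 1 R ^ j)"
  define a where "a = 2 * (R / (4 * (real j + 1) * d))"
  have "a > 0"
    using d R by (simp add: a_def)
  have inverse_a: "1 / a = 2 * real d / R * (real j + 1)"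
    using d R by (simp add: a_def field_simps)
  have "ennreal (a ^ d * \<bar>?q y\<bar>) \<le> 2 ^ Suc j * ball_L1 d R ?q"
    unfolding a_def by (rule hform_le_ball_L1[OF d R y])
  also have "\<dots> \<le> 2 ^ Suc j * ennreal (2 * max 1 R ^ j)"
    by (intro mult_left_mono F3_hform_L1[OF f j]) simp
  also have "(2::ennreal) ^ Suc j = ennreal (2 ^ Suc j)"
    using ennreal_power[of 2 "Suc j"] by (simp del: power_Suc)
  also have "ennreal (2 ^ Suc j) * ennreal (2 * max 1 R ^ j) = ennreal ?C"
    by (rule ennreal_mult[symmetric]) auto
  finally have "a ^ d * \<bar>?q y\<bar> \<le> ?C"
    by (subst (asm) ennreal_le_iff) auto
  then have "\<bar>?q y\<bar> \<le> ?C * (1 / a) ^ d"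
    using \<open>a > 0\<close> by (simp add: power_one_over pos_le_divide_eq mult.commute)
  also have "\<dots> = ?C * (2 * real d / R) ^ d * (real j + 1) ^ d"
    by (simp only: inverse_a power_mult_distrib mult.assoc)
  also have "\<dots> \<le> ?C * (2 * real d / R) ^ d * (2 ^ j) ^ d"
  proof (intro mult_left_mono power_mono)
    have "Suc j \<le> 2 ^ j"
      by (rule Suc_leI[OF less_exp])
    then show "real j + 1 \<le> 2 ^ j"
      by (simp flip: of_nat_le_iff[where 'a = real])
  qed (use R in auto)
  also have "\<dots> = 4 * (2 * real d / R) ^ d * (2 * max 1 R * 2 ^ d) ^ j"
    by (simp add: power_mult_distrib power_mult[symmetric] mult.commute[of j d])
  finally show ?thesis .
qed

lemma F3_abs_hform_le:
  "\<exists>A\<ge>0. \<exists>D>0. \<forall>f\<in>F3 d R. \<forall>j>0. \<forall>x\<in>Rd d.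
    \<bar>hform d j (tcoef d f (zerod d)) x\<bar> \<le> A * (D * norm2 d x) ^ j"
proof -
  define A where "A = 4 * (2 * real d / R) ^ d"
  define B where "B = 2 * max 1 R * 2 ^ d"
  show ?thesis
  proof (rule exI[of _ A], intro conjI exI[of _ "B / (R / 2)"] ballI allI impI)
    show "A \<ge> 0"
      using R by (simp add: A_def)
    show "B / (R / 2) > 0"
      using R by (simp add: B_def)
    fix f x and j :: nat
    assume f: "f \<in> F3 d R" and j: "j > 0" and x: "x \<in> Rd d"
    let ?q = "hform d j (tcoef d f (zerod d))"
    have "\<bar>?q y\<bar> \<le> A * B ^ j" if "y \<in> sphered d (R / 2)" for y
      unfolding A_def B_def
      by (rule F3_abs_hform_le_half_ball[OF f j]) (use that in \<open>simp add: sphered_def cballd_def\<close>)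
    then have "\<bar>?q x\<bar> \<le> A * B ^ j * (norm2 d x / (R / 2)) ^ j"
      using R by (intro abs_hform_le_if_le_on_sphere[OF _ j x]) auto
    also have "\<dots> = A * (B / (R / 2) * norm2 d x) ^ j"
      by (simp add: power_mult_distrib power_divide)
    finally show "\<bar>?q x\<bar> \<le> A * (B / (R / 2) * norm2 d x) ^ j" .
  qed
qed

end

lemma abs_mpoly_diff_le:
  fixes z :: real
  assumes "k \<le> n" and A: "A \<ge> 0" and z: "0 \<le> z" "z \<le> 1/2"
    and form: "\<And>j. k \<le> j \<Longrightarrow> \<bar>hform d j c y\<bar> \<le> A * z ^ j"
  shows "\<bar>mpoly d n c y - mpoly d k c y\<bar> \<le> 2 * A * z ^ k"
proof -
  have "\<bar>mpoly d n c y - mpoly d k c y\<bar> \<le> 2 * A * (z ^ k - z ^ n)"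
    using \<open>k \<le> n\<close>
  proof (induction n rule: dec_induct)
    case (step n)
    have "\<bar>mpoly d (Suc n) c y - mpoly d k c y\<bar> \<le> 2 * A * (z ^ k - z ^ n) + A * z ^ n"
      using step.IH form[OF step.hyps(1)] by (simp add: mpoly_Suc)
    also have "A * z ^ n \<le> 2 * A * (z ^ n - z ^ Suc n)"
    proof -
      have "z * (A * z ^ n) \<le> 1/2 * (A * z ^ n)"
        using A z by (intro mult_right_mono) auto
      then show ?thesis by (simp add: algebra_simps)
    qed
    finally show ?case by (simp add: algebra_simps)
  qed simp
  also have "\<dots> \<le> 2 * A * z ^ k"
    using A z by (simp add: mult_left_mono)
  finally show ?thesis .
qed

lemma power_over_fact_tendsto_0: "(\<lambda>n. R ^ n / fact n :: real) \<longlonglongrightarrow> 0"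
  using summable_LIMSEQ_zero[OF summable_exp[of R]] by (simp add: divide_inverse mult.commute)

lemma (in unit_volume_ball) F3_local_remainder_le_of_hform_le:
  assumes f: "f \<in> F3 d R" and k: "k > 0" and A: "A \<ge> 0" and D: "D > 0"
    and form: "\<And>j x. j > 0 \<Longrightarrow> x \<in> Rd d \<Longrightarrow>
      \<bar>hform d j (tcoef d f (zerod d)) x\<bar> \<le> A * (D * norm2 d x) ^ j"
    and \<delta>: "\<delta> \<le> R" "D * \<delta> \<le> 1/2" and x: "x \<in> oballd d \<delta>"
  shows "\<bar>f x - taylor d k f x\<bar> \<le> 2 * A * (D * norm2 d x) ^ k"
proof (rule continuous_le_if_excess_small[OF openin_Rd_oballd _ _ _ x])
  interpret smooth_on_ball d R f by (rule F3_smooth_on_ball[OF f])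
  have sub: "oballd d \<delta> \<subseteq> oballd d R"
    using \<delta>(1) by (auto simp: oballd_def)
  show "continuous_on (oballd d \<delta>) (\<lambda>x. \<bar>f x - taylor d k f x\<bar>)"
    by (intro continuous_intros continuous_on_mpoly
        continuous_on_subset[OF continuous_on_interior sub])
  show "continuous_on (oballd d \<delta>) (\<lambda>x. 2 * A * (D * norm2 d x) ^ k)"
    by (intro continuous_intros continuous_on_norm2)
  fix e :: real assume "e > 0"
  then have "\<forall>\<^sub>F n in sequentially. R ^ n / fact n < e \<and> k \<le> n"
    by (intro eventually_conj order_tendstoD(2)[OF power_over_fact_tendsto_0] eventually_ge_at_top)
  then obtain n where n: "R ^ n / fact n < e" "k \<le> n"
    using eventually_happens'[OF sequentially_bot] by blast
  let ?w = "\<lambda>y. f y - taylor d (Suc n) f y"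
  have "\<bar>f y - taylor d k f y\<bar> \<le> 2 * A * (D * norm2 d y) ^ k + \<bar>?w y\<bar>" if y: "y \<in> oballd d \<delta>" for y
  proof -
    have "D * norm2 d y \<le> D * \<delta>"
      using y D by (simp add: oballd_def)
    then have "D * norm2 d y \<le> 1/2"
      using \<delta>(2) by linarith
    then have "\<bar>taylor d (Suc n) f y - taylor d k f y\<bar> \<le> 2 * A * (D * norm2 d y) ^ k"
      using n(2) A D k y by (intro abs_mpoly_diff_le form) (auto simp: oballd_def)
    then show ?thesis by linarith
  qed
  moreover have "(\<integral>\<^sup>+y\<in>oballd d \<delta>. ennreal \<bar>?w y\<bar> \<partial>lebd d) < ennreal e"
  proof -
    have "(\<integral>\<^sup>+y\<in>oballd d \<delta>. ennreal \<bar>?w y\<bar> \<partial>lebd d) \<le> ball_L1 d R ?w"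
      unfolding ball_L1_def
      by (intro nn_integral_mono mult_left_mono) (use sub in \<open>auto simp: indicator_def\<close>)
    also have "\<dots> \<le> ennreal (R ^ n / fact n)"
      using F3_remainder_L1[OF f, of "Suc n"] by simp
    also have "\<dots> < ennreal e"
      using n(1) \<open>e > 0\<close> by (rule ennreal_lessI[rotated])
    finally show ?thesis .
  qed
  ultimately show "\<exists>w. (\<forall>y\<in>oballd d \<delta>. \<bar>f y - taylor d k f y\<bar> \<le> 2 * A * (D * norm2 d y) ^ k + \<bar>w y\<bar>)
      \<and> (\<integral>\<^sup>+y\<in>oballd d \<delta>. ennreal \<bar>w y\<bar> \<partial>lebd d) < ennreal e"
    by (intro exI[of _ ?w] conjI ballI)
qed

lemma (in unit_volume_ball) F3_local_remainder_le:
  assumes k: "k > 0"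
  obtains \<delta> C where "\<delta> > 0" "\<delta> \<le> R" "C \<ge> 0"
    "\<And>f x. f \<in> F3 d R \<Longrightarrow> x \<in> cballd d \<delta> \<Longrightarrow> \<bar>f x - taylor d k f x\<bar> \<le> C * norm2 d x ^ k"
proof -
  obtain A D where A: "A \<ge> 0" and D: "D > 0"
    and form: "\<forall>f\<in>F3 d R. \<forall>j>0. \<forall>x\<in>Rd d.
      \<bar>hform d j (tcoef d f (zerod d)) x\<bar> \<le> A * (D * norm2 d x) ^ j"
    using F3_abs_hform_le by blast
  define \<delta> where "\<delta> = min R (1 / (2 * D))"
  have \<delta>: "\<delta> > 0" "\<delta> \<le> R" "D * \<delta> \<le> 1/2"
    using R D by (auto simp: \<delta>_def min_mult_distrib_left)
  have "\<bar>f x - taylor d k f x\<bar> \<le> 2 * A * (D * norm2 d x) ^ k"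
    if "f \<in> F3 d R" "x \<in> oballd d \<delta>" for f x
    using that form
    by (intro F3_local_remainder_le_of_hform_le[OF _ k A D _ \<delta>(2,3)]) auto
  moreover have "cballd d (\<delta> / 2) \<subseteq> oballd d \<delta>"
    using \<delta>(1) by (auto simp: cballd_def oballd_def)
  ultimately show ?thesis
    using \<delta> A D
    by (intro that[of "\<delta> / 2" "2 * A * D ^ k"]) (auto simp: power_mult_distrib mult.assoc)
qed

context unit_volume_ball
begin

lemma err_L1_le:
  assumes g: "continuous_on (cballd d R) g"
    and fp: "continuous_on (oballd d R) (\<lambda>x. f x - p x)"
    and gq: "continuous_on (oballd d R) (\<lambda>x. g x - q x)"
    and close: "\<And>x. x \<in> cballd d R \<Longrightarrow> \<bar>p x - q x\<bar> \<le> \<eta>"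
  shows "err_L1 d (cballd d R) f (\<lambda>x. indicator (cballd d R) x * g x)
    \<le> ball_L1 d R (\<lambda>x. f x - p x) + ball_L1 d R (\<lambda>x. g x - q x) + ennreal \<eta>"
proof -
  let ?K = "cballd d R" and ?U = "oballd d R"
  let ?rf = "\<lambda>x. ennreal \<bar>f x - p x\<bar> * indicator ?U x"
    and ?rg = "\<lambda>x. ennreal \<bar>g x - q x\<bar> * indicator ?U x"
  have rm: "?rf \<in> borel_measurable (lebd d)" "?rg \<in> borel_measurable (lebd d)"
    using borel_measurable_ball_integrand[OF fp] borel_measurable_ball_integrand[OF gq] by simp_all
  have "(\<lambda>x. indicator ?K x * g x) \<in> borel_measurable (lebd d)"
    by (rule borel_measurable_continuous_on_lebd[OF cballd_sets g])
  then have "err_L1 d ?K f (\<lambda>x. indicator ?K x * g x)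
      = (\<integral>\<^sup>+x\<in>?K. ennreal \<bar>f x - indicator ?K x * g x\<bar> \<partial>lebd d)"
    by (simp add: err_L1_def)
  also have "\<dots> \<le> (\<integral>\<^sup>+x. (?rf x + ?rg x) + ennreal \<eta> * indicator ?U x \<partial>lebd d)"
  proof (rule nn_integral_mono_AE)
    show "AE x in lebd d. ennreal \<bar>f x - indicator ?K x * g x\<bar> * indicator ?K x
        \<le> (?rf x + ?rg x) + ennreal \<eta> * indicator ?U x"
      using AE_cballd_in_oballd[OF R]
    proof eventually_elim
      case (elim x)
      show ?case
      proof (cases "x \<in> ?K")
        case True
        then have U: "x \<in> ?U"
          using elim by blast
        have "\<bar>f x - g x\<bar> \<le> \<bar>f x - p x\<bar> + \<bar>g x - q x\<bar> + \<eta>" "\<eta> \<ge> 0"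
          using close[OF True] by linarith+
        then have "ennreal \<bar>f x - g x\<bar> \<le> ennreal \<bar>f x - p x\<bar> + ennreal \<bar>g x - q x\<bar> + ennreal \<eta>"
          by (simp flip: ennreal_plus)
        then show ?thesis using True U by simp
      qed simp
    qed
  qed
  also have "\<dots> = (ball_L1 d R (\<lambda>x. f x - p x) + ball_L1 d R (\<lambda>x. g x - q x))
      + ennreal \<eta> * emeasure (lebd d) ?U"
    using rm by (simp add: ball_L1_def nn_integral_add nn_integral_cmult_indicator)
  also have "\<dots> \<le> (ball_L1 d R (\<lambda>x. f x - p x) + ball_L1 d R (\<lambda>x. g x - q x)) + ennreal \<eta> * 1"
    by (intro add_left_mono mult_left_mono emeasure_le_1 oballd_subset_cballd) simp
  finally show ?thesis by simp
qed

lemma F3_infc_le: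
  assumes \<epsilon>: "\<epsilon> > 0" and k: "k > 0" "R ^ (k - 1) / fact (k - 1) \<le> \<epsilon> / 4"
  shows "\<exists>m \<le> (d + 1) ^ (k - 1). infc (cballd d R) (F3 d R) (err_L1 d (cballd d R)) \<epsilon> = enat m"
proof -
  obtain \<delta> C where near: "\<delta> > 0" "\<delta> \<le> R" "C \<ge> 0"
    "\<And>f x. f \<in> F3 d R \<Longrightarrow> x \<in> cballd d \<delta> \<Longrightarrow> \<bar>f x - taylor d k f x\<bar> \<le> C * norm2 d x ^ k"
    using F3_local_remainder_le[OF k(1), of thesis] by blast
  show ?thesis
  proof (rule infc_le_local_polynomial_approximation[where \<delta> = \<delta> and \<rho> = R and \<eta> = "\<epsilon> / 2" and C = C
        and G = "\<lambda>g x. indicator (cballd d R) x * g x"])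
    show "cballd d \<delta> \<subseteq> cballd d R"
      using near(2) by (auto simp: cballd_def)
    fix f g assume f: "f \<in> F3 d R" and g: "g \<in> F3 d R"
      and close: "\<And>x. x \<in> cballd d R \<Longrightarrow> \<bar>taylor d k f x - taylor d k g x\<bar> \<le> \<epsilon> / 2"
    interpret f: smooth_on_ball d R f by (rule F3_smooth_on_ball[OF f])
    interpret g: smooth_on_ball d R g by (rule F3_smooth_on_ball[OF g])
    have remainder: "ball_L1 d R (\<lambda>x. h x - taylor d k h x) \<le> ennreal (\<epsilon> / 4)" if "h \<in> F3 d R" for h
      using F3_remainder_L1[OF that k(1)] ennreal_leI[OF k(2)] by (rule order_trans)
    have "continuous_on (cballd d R) g"
      using g by (simp add: F3_def smooth_on_def)
    then have "err_L1 d (cballd d R) f (\<lambda>x. indicator (cballd d R) x * g x)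
        \<le> ball_L1 d R (\<lambda>x. f x - taylor d k f x) + ball_L1 d R (\<lambda>x. g x - taylor d k g x)
          + ennreal (\<epsilon> / 2)"
      by (intro err_L1_le close continuous_on_diff continuous_on_mpoly
          f.continuous_on_interior g.continuous_on_interior)
    also have "\<dots> \<le> ennreal (\<epsilon> / 4) + ennreal (\<epsilon> / 4) + ennreal (\<epsilon> / 2)"
      by (intro add_mono remainder f g order_refl)
    also have "\<dots> = ennreal \<epsilon>"
      using \<epsilon> by (simp flip: ennreal_plus)
    finally show "err_L1 d (cballd d R) f (\<lambda>x. indicator (cballd d R) x * g x) \<le> ennreal \<epsilon>" .
  qed (use near \<epsilon> k R in auto)
qed

end

subsection \<open>Rates\<close>

lemma power_over_fact_le_exp:
  fixes x :: real
  assumes "x \<ge> 0"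
  shows "x ^ k / fact k \<le> exp x"
proof -
  have "(\<Sum>n\<in>{k}. x ^ n /\<^sub>R fact n) \<le> (\<Sum>n. x ^ n /\<^sub>R fact n)"
    by (rule sum_le_suminf[OF summable_exp_generic]) (use assms in auto)
  then show ?thesis
    by (simp add: exp_def divide_inverse mult.commute)
qed

lemma (in unit_volume_ball) power_over_fact_le_exp_sqrt:
  "R ^ k / fact k \<le> exp (2 * sqrt d - k)"
proof -
  have "exp 1 * R \<le> 3 * (sqrt d / 2)"
    using exp_le R radius_le by (intro mult_mono) auto
  moreover have "sqrt (real d) \<ge> 0"
    by simp
  ultimately have e: "exp 1 * R \<le> 2 * sqrt d"
    by linarith
  have "exp 1 ^ k * (R ^ k / fact k) = (exp 1 * R) ^ k / fact k"
    by (simp add: power_mult_distrib)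
  also have "\<dots> \<le> exp (exp 1 * R)"
    using R by (intro power_over_fact_le_exp) simp
  also have "\<dots> \<le> exp (2 * sqrt d)"
    using e by simp
  finally have "exp (real k) * (R ^ k / fact k) \<le> exp (2 * sqrt d)"
    by (simp flip: exp_of_nat_mult)
  then show ?thesis
    by (simp add: exp_diff pos_le_divide_eq mult.commute)
qed

lemma (in unit_volume_ball) sufficient_order:
  assumes \<epsilon>: "0 < \<epsilon>" "\<epsilon> < 1"
  obtains k where "R ^ k / fact k \<le> \<epsilon> / 4" "k > 0" "real k \<le> 2 * sqrt d + ln (1 / \<epsilon>) + 4"
proof -
  define y where "y = 2 * sqrt d + ln (4 / \<epsilon>)"
  have ln4: "ln (4 / \<epsilon>) = ln 4 + ln (1 / \<epsilon>)" "ln (4::real) \<le> 3" "ln (4 / \<epsilon>) > 0"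
    using \<epsilon> ln_le_minus_one[of "4::real"] by (auto simp: ln_div)
  have "y > 0"
    unfolding y_def using ln4(3) by (intro add_nonneg_pos) auto
  define k where "k = nat \<lceil>y\<rceil>"
  have k: "y \<le> k" "k \<le> y + 1"
    using \<open>y > 0\<close> by (auto simp: k_def)
  have "R ^ k / fact k \<le> exp (2 * sqrt d - k)"
    by (rule power_over_fact_le_exp_sqrt)
  also have "\<dots> \<le> exp (- ln (4 / \<epsilon>))"
    using k(1) by (simp add: y_def)
  also have "\<dots> = \<epsilon> / 4"
    using \<epsilon> by (simp add: exp_minus)
  finally have "R ^ k / fact k \<le> \<epsilon> / 4" .
  moreover have "k > 0"
    using \<open>y > 0\<close> by (simp add: k_def)
  moreover have "real k \<le> 2 * sqrt d + ln (1 / \<epsilon>) + 4"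
    using k(2) ln4 unfolding y_def by linarith
  ultimately show ?thesis by (rule that)
qed

lemma abs_ln_le_of_le_power:
  assumes "m \<le> (d + 1) ^ k"
  shows "\<bar>ln (real m)\<bar> \<le> k * ln (real d + 1)"
proof (cases "m = 0")
  case False
  have "real m \<le> (real d + 1) ^ k"
    using assms by (simp flip: of_nat_le_iff[where 'a = real] add: add.commute)
  then have "ln (real m) \<le> ln ((real d + 1) ^ k)"
    using False by simp
  then show ?thesis
    using False by (simp add: ln_realpow)
qed simp

lemma abs_ln_le_of_order_le:
  fixes d :: nat
  assumes \<epsilon>: "0 < \<epsilon>" "\<epsilon> < 1"
    and m: "m \<le> (d + 1) ^ k" and k: "real k \<le> 2 * sqrt d + ln (1 / \<epsilon>) + 4"
  defines "x \<equiv> 1 / \<epsilon> + d"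
  shows "\<bar>ln (real m)\<bar> \<le> (2 * sqrt x + ln x + 4) * ln x"
proof -
  have inverse_\<epsilon>: "1 / \<epsilon> > 1"
    using \<epsilon> by simp
  then have x: "x \<ge> 1 / \<epsilon>" "x > 1"
    unfolding x_def by linarith+
  have "\<bar>ln (real m)\<bar> \<le> k * ln (real d + 1)"
    by (rule abs_ln_le_of_le_power[OF m])
  also have "\<dots> \<le> (2 * sqrt x + ln x + 4) * ln x"
  proof (rule mult_mono)
    have "ln (1 / \<epsilon>) \<le> ln x"
      using x \<epsilon> by (subst ln_le_cancel_iff) auto
    moreover have "sqrt d \<le> sqrt x"
      using \<epsilon> by (simp add: x_def)
    ultimately show "real k \<le> 2 * sqrt x + ln x + 4"
      using k by linarith
    show "ln (real d + 1) \<le> ln x"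
      using x(2) inverse_\<epsilon> by (subst ln_le_cancel_iff) (simp_all add: x_def)
    show "0 \<le> 2 * sqrt x + ln x + 4"
      using x by (intro add_nonneg_nonneg) auto
  qed simp
  finally show ?thesis .
qed

lemma weakly_tractableI:
  assumes N: "\<And>\<epsilon> d. 0 < \<epsilon> \<Longrightarrow> \<epsilon> < 1 \<Longrightarrow> d \<ge> 1 \<Longrightarrow>
    \<exists>m k. N \<epsilon> d = enat m \<and> m \<le> (d + 1) ^ k \<and> real k \<le> 2 * sqrt d + ln (1 / \<epsilon>) + 4"
  shows "weakly_tractable N"
  unfolding weakly_tractable_def
proof (intro conjI allI impI)
  fix \<epsilon> d assume "0 < (\<epsilon>::real) \<and> \<epsilon> < 1 \<and> (d::nat) \<ge> 1"
  then show "N \<epsilon> d \<noteq> \<infinity>" using N[of \<epsilon> d] by auto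
next
  fix \<eta> :: real assume "\<eta> > 0"
  define B where "B x = (2 * sqrt x + ln x + 4) * ln x" for x :: real
  have "((\<lambda>x. B x / x) \<longlongrightarrow> 0) at_top"
    unfolding B_def by real_asymp
  then have "\<forall>\<^sub>F x in at_top. B x / x < \<eta>"
    using \<open>\<eta> > 0\<close> by (rule order_tendstoD)
  then obtain M where M: "\<And>x. x \<ge> M \<Longrightarrow> B x / x < \<eta>"
    by (auto simp: eventually_at_top_linorder)
  show "\<exists>M. \<forall>\<epsilon> d. 0 < \<epsilon> \<and> \<epsilon> < 1 \<and> d \<ge> 1 \<and> 1 / \<epsilon> + real d \<ge> M \<longrightarrow>
        \<bar>ln (real (the_enat (N \<epsilon> d))) / (1 / \<epsilon> + real d)\<bar> < \<eta>"
  proof (intro exI[of _ M] allI impI)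
    fix \<epsilon> :: real and d :: nat
    let ?x = "1 / \<epsilon> + real d"
    assume large: "0 < \<epsilon> \<and> \<epsilon> < 1 \<and> d \<ge> 1 \<and> ?x \<ge> M"
    then obtain m k where m: "N \<epsilon> d = enat m" "m \<le> (d + 1) ^ k"
        "real k \<le> 2 * sqrt d + ln (1 / \<epsilon>) + 4"
      using N by blast
    have "?x > 0"
      using large by (simp add: add_pos_nonneg)
    then have "\<bar>ln (real (the_enat (N \<epsilon> d))) / ?x\<bar> = \<bar>ln (real m)\<bar> / ?x"
      by (simp add: m(1))
    also have "\<dots> \<le> B ?x / ?x"
      unfolding B_def using large \<open>?x > 0\<close> m(2,3)
      by (intro divide_right_mono abs_ln_le_of_order_le) auto
    also have "\<dots> < \<eta>"
      using large by (intro M) simp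
    finally show "\<bar>ln (real (the_enat (N \<epsilon> d))) / ?x\<bar> < \<eta>" .
  qed
qed

lemma quasi_poly_tractableI:
  assumes t: "t > 0" and N: "\<And>\<epsilon> d. 0 < \<epsilon> \<Longrightarrow> \<epsilon> < 1 \<Longrightarrow> d \<ge> 1 \<Longrightarrow>
    \<exists>m k. N \<epsilon> d = enat m \<and> m \<le> (d + 1) ^ k \<and> real k \<le> t * (1 + ln (1 / \<epsilon>))"
  shows "quasi_poly_tractable N"
  unfolding quasi_poly_tractable_def
proof (rule exI[of _ 1], rule exI[of _ t], intro conjI allI impI)
  fix \<epsilon> :: real and d :: nat
  assume \<epsilon>d: "0 < \<epsilon> \<and> \<epsilon> < 1 \<and> d \<ge> 1"
  then obtain m k where m: "N \<epsilon> d = enat m" "m \<le> (d + 1) ^ k" and k: "real k \<le> t * (1 + ln (1 / \<epsilon>))"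
    using N by blast
  have "2 * real d \<le> exp 1 * real d"
    by (rule mult_right_mono) (use exp_ge_add_one_self[of 1] in auto)
  moreover have "real d \<ge> 1"
    using \<epsilon>d by simp
  ultimately have "real d + 1 \<le> exp 1 * real d"
    by linarith
  then have "ln (real d + 1) \<le> ln (exp 1 * real d)"
    using \<epsilon>d by (subst ln_le_cancel_iff) auto
  then have d: "ln (real d + 1) \<le> 1 + ln (real d)"
    using \<epsilon>d by (simp add: ln_mult)
  have "real m \<le> (real d + 1) ^ k"
    using m(2) by (simp flip: of_nat_le_iff[where 'a = real] add: add.commute)
  also have "\<dots> = exp (real k * ln (real d + 1))"
    by (simp add: exp_of_nat_mult)
  also have "\<dots> \<le> exp (t * (1 + ln (1 / \<epsilon>)) * (1 + ln (real d)))"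
    using k d order_trans[OF of_nat_0_le_iff k] by (simp add: mult_mono)
  finally show "\<exists>n. N \<epsilon> d = enat n \<and> real n \<le> 1 * exp (t * (1 + ln (1 / \<epsilon>)) * (1 + ln (real d)))"
    using m(1) by auto
qed (use t in auto)

lemma half_power_order:
  assumes "0 < \<epsilon>" "\<epsilon> < 1"
  obtains k where "k > 0" "(1/2) ^ k \<le> \<epsilon> / 4" "real (k - 1) \<le> 2 * (1 + ln (1 / \<epsilon>))"
proof -
  define L where "L = ln (1 / \<epsilon>)"
  have L: "L > 0" "exp L = 1 / \<epsilon>"
    using assms by (auto simp: L_def)
  define k where "k = nat \<lceil>2 + 2 * L\<rceil>"
  have k: "2 + 2 * L \<le> k" "k < 2 + 2 * L + 1"
    using L(1) unfolding k_def by linarith+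
  have ln2: "ln (2::real) \<ge> 1/2"
    using ln_add_one_self_le_self2[of "-1/2"] by (simp add: ln_div)
  have "4 / \<epsilon> = exp (2 * ln 2) * exp (2 * L * (1/2))"
    using exp_of_nat_mult[of 2 "ln 2 :: real"] by (simp add: L(2))
  also have "\<dots> \<le> exp (2 * ln 2) * exp (2 * L * ln 2)"
    using ln2 L(1) by simp
  also have "\<dots> = exp ((2 + 2 * L) * ln 2)"
    by (simp add: distrib_right exp_add)
  also have "\<dots> \<le> exp (k * ln 2)"
    using k(1) by simp
  also have "\<dots> = 2 ^ k"
    by (simp add: exp_of_nat_mult)
  finally have "(1/2) ^ k \<le> \<epsilon> / 4"
    using assms by (simp add: power_divide field_simps)
  moreover have "k > 0" "real (k - 1) \<le> 2 * (1 + L)"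
    using k L(1) by (auto simp: of_nat_diff intro: gr0I)
  ultimately show ?thesis using that by (simp add: L_def)
qed

theorem theorem1p1:
  fixes r :: "nat \<Rightarrow> real"
  assumes "\<forall>d\<ge>1. r d > 0 \<and> emeasure (lebd d) (cballd d (r d)) = 1"
  shows "quasi_poly_tractable (\<lambda>\<epsilon> d. infc (cube d) (F1 d) (err_sup (cube d)) \<epsilon>)
       \<and> weakly_tractable (\<lambda>\<epsilon> d. infc (cballd d (r d)) (F2 d (r d)) (err_sup (cballd d (r d))) \<epsilon>)
       \<and> weakly_tractable (\<lambda>\<epsilon> d. infc (cballd d (r d)) (F3 d (r d)) (err_L1 d (cballd d (r d))) \<epsilon>)"
proof (intro conjI quasi_poly_tractableI[of 2] weakly_tractableI)
  fix \<epsilon> :: real and d :: nat assume \<epsilon>: "0 < \<epsilon>" "\<epsilon> < 1" and d: "d \<ge> 1"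
  obtain k where "k > 0" "(1/2) ^ k \<le> \<epsilon> / 4" "real (k - 1) \<le> 2 * (1 + ln (1 / \<epsilon>))"
    using half_power_order[OF \<epsilon>] .
  then show "\<exists>m k. infc (cube d) (F1 d) (err_sup (cube d)) \<epsilon> = enat m \<and>
      m \<le> (d + 1) ^ k \<and> real k \<le> 2 * (1 + ln (1 / \<epsilon>))"
    using F1_infc_le[OF \<epsilon>(1)] by blast
  interpret unit_volume_ball d "r d"
    using assms d by unfold_locales auto
  obtain k where k: "r d ^ k / fact k \<le> \<epsilon> / 4" "k > 0" "real k \<le> 2 * sqrt d + ln (1 / \<epsilon>) + 4"
    using sufficient_order[OF \<epsilon>] .
  then have "real (k - 1) \<le> 2 * sqrt d + ln (1 / \<epsilon>) + 4"
    by linarith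
  then show "\<exists>m k. infc (cballd d (r d)) (F2 d (r d)) (err_sup (cballd d (r d))) \<epsilon> = enat m \<and>
      m \<le> (d + 1) ^ k \<and> real k \<le> 2 * sqrt d + ln (1 / \<epsilon>) + 4"
    using F2_infc_le[OF R \<epsilon>(1) k(2,1)] by blast
  show "\<exists>m k. infc (cballd d (r d)) (F3 d (r d)) (err_L1 d (cballd d (r d))) \<epsilon> = enat m \<and>
      m \<le> (d + 1) ^ k \<and> real k \<le> 2 * sqrt d + ln (1 / \<epsilon>) + 4"
    using F3_infc_le[OF \<epsilon>(1), of "Suc k"] k by auto
qed simp

end
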